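(* Assume that for some real numbers $0<\alpha<1$ and $A>0$ we have $$\#\{r\le z : r \text{ prime},\ P(r-1)>r^{\alpha}\}\ \ge\ A\frac{z}{\log z}$$ for all sufficiently large $z$. Then for any real $\gamma$ with $0<\gamma\le\alpha$ there is a constant $c(\alpha,\gamma,A)>0$, depending only on $\alpha,\gamma,A$, such that for all but at most $O\big(x^{\max\{0,2\gamma-1\}}(\log x)^4\big)$ integers $n\le x$, every nontrivial monotone property of graphs on $n$ vertices all of whose members have at most $c(\alpha,\gamma,A)\,n^{1+\gamma}$ edges is evasive.
   Context: For an integer $k\ge 2$, $P(k)$ denotes the largest prime divisor of $k$, and $P(1)=0$. A graph property $\mathcal{P}_n$ of $n$-vertex graphs is a collection of (simple, undirected) graphs on the vertex set $\{1,\ldots,n\}$ that is invariant under relabelling of the vertices. It is monotone if it is preserved under deletion of edges, and nontrivial if it is neither empty nor the set of all graphs on $\{1,\ldots,n\}$. A Boolean function of $m$ variables is evasive if its deterministic query (decision-tree) complexity equals $m$. The property $\mathcal{P}_n$ is evasive if the Boolean function on $m=n(n-1)/2$ variables (the adjacency-matrix entries, one per unordered pair of vertices) deciding membership in $\mathcal{P}_n$ is evasive. "A property of graphs with at most $E$ edges" means a property every member graph of which has at most $E$ edges. The implied constant in the $O$-bound (as $x\to\infty$) may depend on $\alpha,\gamma,A$. *)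

theory Defs
  imports Complex_Main "HOL-Library.Landau_Symbols" "HOL-Computational_Algebra.Primes"
    "HOL-Combinatorics.Permutations"
begin

definition largest_prime_factor :: "nat \<Rightarrow> nat" where
  "largest_prime_factor k = (if k \<ge> 2 then Max (prime_factors k) else 0)"


text \<open>
  A simple graph on \<open>{1..n}\<close> is given by its edge set, a subset of \<open>vertex_pairs n\<close>;
  a graph property is a set of such edge sets.
\<close>

definition vertex_pairs :: "nat \<Rightarrow> nat set set" where
  "vertex_pairs n = {e. e \<subseteq> {1..n} \<and> card e = 2}"

definition relabel :: "(nat \<Rightarrow> nat) \<Rightarrow> nat set set \<Rightarrow> nat set set" where
  "relabel \<pi> G = (\<lambda>e. \<pi> ` e) ` G"

definition graph_property :: "nat \<Rightarrow> nat set set set \<Rightarrow> bool" where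
  "graph_property n \<P> \<longleftrightarrow>
     \<P> \<subseteq> Pow (vertex_pairs n) \<and>
     (\<forall>\<pi> G. \<pi> permutes {1..n} \<longrightarrow> G \<in> \<P> \<longrightarrow> relabel \<pi> G \<in> \<P>)"

definition monotone_property :: "nat set set set \<Rightarrow> bool" where
  "monotone_property \<P> \<longleftrightarrow> (\<forall>G H. G \<in> \<P> \<longrightarrow> H \<subseteq> G \<longrightarrow> H \<in> \<P>)"

definition nontrivial_property :: "nat \<Rightarrow> nat set set set \<Rightarrow> bool" where
  "nontrivial_property n \<P> \<longleftrightarrow> \<P> \<noteq> {} \<and> \<P> \<noteq> Pow (vertex_pairs n)"


datatype 'v decision_tree =
    Answer bool
  | Query 'v "'v decision_tree" "'v decision_tree"

text \<open>The first subtree of a query is taken when the queried variable is false.\<close>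

primrec run :: "'v decision_tree \<Rightarrow> ('v \<Rightarrow> bool) \<Rightarrow> bool" where
  "run (Answer b) x = b"
| "run (Query v l r) x = (if x v then run r x else run l x)"

primrec depth :: "'v decision_tree \<Rightarrow> nat" where
  "depth (Answer b) = 0"
| "depth (Query v l r) = Suc (max (depth l) (depth r))"

text \<open>
  A Boolean function of the variables in a finite set \<open>V\<close> is a function on all assignments
  whose value depends only on the restriction of the assignment to \<open>V\<close>. For such functions
  the minimum below is over a nonempty set and is at most \<open>card V\<close>
  (\<open>query_complexity_le_card\<close>).
\<close>

definition query_complexity :: "'v set \<Rightarrow> (('v \<Rightarrow> bool) \<Rightarrow> bool) \<Rightarrow> nat" where
  "query_complexity V f =
     (LEAST d. \<exists>t. set_decision_tree t \<subseteq> V \<and> (\<forall>x. run t x = f x) \<and> depth t = d)"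

definition evasive :: "'v set \<Rightarrow> (('v \<Rightarrow> bool) \<Rightarrow> bool) \<Rightarrow> bool" where
  "evasive V f \<longleftrightarrow> query_complexity V f = card V"

definition membership_function :: "nat \<Rightarrow> nat set set set \<Rightarrow> (nat set \<Rightarrow> bool) \<Rightarrow> bool" where
  "membership_function n \<P> x \<longleftrightarrow> {e \<in> vertex_pairs n. x e} \<in> \<P>"

definition evasive_property :: "nat \<Rightarrow> nat set set set \<Rightarrow> bool" where
  "evasive_property n \<P> \<longleftrightarrow> evasive (vertex_pairs n) (membership_function n \<P>)"


lemma decision_tree_exists:
  assumes "finite V" and "\<And>x y. (\<And>v. v \<in> V \<Longrightarrow> x v = y v) \<Longrightarrow> f x = f y"
  shows "\<exists>t. set_decision_tree t \<subseteq> V \<and> (\<forall>x. run t x = f x) \<and> depth t \<le> card V"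
  using assms
proof (induction V arbitrary: f rule: finite_induct)
  case empty
  have "run (Answer (f (\<lambda>_. False))) x = f x" for x
    unfolding run.simps by (rule empty.prems) (rule emptyE)
  then show ?case by (intro exI[of _ "Answer (f (\<lambda>_. False))"]) (simp del: run.simps)
next
  case (insert v V)
  have *: "\<exists>t. set_decision_tree t \<subseteq> V \<and> (\<forall>x. run t x = f (x(v := b))) \<and> depth t \<le> card V" for b
  proof (rule insert.IH)
    fix x y :: "'a \<Rightarrow> bool"
    assume eq: "\<And>u. u \<in> V \<Longrightarrow> x u = y u"
    show "f (x(v := b)) = f (y(v := b))"
      by (rule insert.prems) (use eq in auto)
  qed
  obtain l where l: "set_decision_tree l \<subseteq> V" "\<forall>x. run l x = f (x(v := False))" "depth l \<le> card V"
    using *[of False] by (elim exE conjE)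
  obtain r where r: "set_decision_tree r \<subseteq> V" "\<forall>x. run r x = f (x(v := True))" "depth r \<le> card V"
    using *[of True] by (elim exE conjE)
  have computes: "run (Query v l r) x = f x" for x
  proof (cases "x v")
    case True
    then have "x(v := True) = x" by (simp add: fun_eq_iff)
    with True show ?thesis by (simp only: run.simps if_True r(2))
  next
    case False
    then have "x(v := False) = x" by (simp add: fun_eq_iff)
    with False show ?thesis by (simp only: run.simps if_False l(2))
  qed
  have vars: "set_decision_tree (Query v l r) \<subseteq> insert v V"
    using l(1) r(1) by auto
  have dep: "depth (Query v l r) \<le> card (insert v V)"
    using l(3) r(3) insert.hyps by simp
  show ?case
    by (rule exI[of _ "Query v l r"]) (rule conjI[OF vars conjI[OF allI[OF computes] dep]])
qed

lemma query_complexity_le_card: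
  assumes "finite V" and "\<And>x y. (\<And>v. v \<in> V \<Longrightarrow> x v = y v) \<Longrightarrow> f x = f y"
  shows "query_complexity V f \<le> card V"
proof -
  have "\<exists>t. set_decision_tree t \<subseteq> V \<and> (\<forall>x. run t x = f x) \<and> depth t \<le> card V"
    by (rule decision_tree_exists[OF assms(1)]) (rule assms(2))
  then obtain t where t: "set_decision_tree t \<subseteq> V" "\<forall>x. run t x = f x" "depth t \<le> card V"
    by (elim exE conjE)
  have "query_complexity V f \<le> depth t"
    unfolding query_complexity_def by (rule Least_le, rule exI[of _ t]) (simp add: t(1,2))
  with t(3) show ?thesis by simp
qed

lemma card_vertex_pairs: "card (vertex_pairs n) = n * (n - 1) div 2"
  unfolding vertex_pairs_def by (simp add: n_subsets choose_two)

end

theory Submission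
  imports Defs
    "HOL-Analysis.Complex_Transcendental"
    "HOL-Analysis.Harmonic_Numbers"
    "HOL-Real_Asymp.Real_Asymp"
    "HOL-Number_Theory.Residue_Primitive_Roots"
begin

text \<open>
  Suppose \<open>n = p k + r\<close> with primes \<open>p\<close> and \<open>r\<close>, and let \<open>q\<close> be a prime divisor of \<open>r - 1\<close>. Arrange the
  vertices as \<open>k\<close> blocks \<open>F_p\<close> and one block \<open>F_r\<close>. The translations of the blocks \<open>F_p\<close> form a
  \<open>p\<close>-group; modulo it, a cyclic group permutes these blocks, multiplies them by \<open>F_p^*\<close> and
  translates \<open>F_r\<close>; on top of it sits the group of order \<open>q\<close> of multiplications of \<open>F_r\<close>. If a monotone
  property is not evasive, then its nonempty graphs, ordered by inclusion, form a poset with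
  acyclic order complex. Fixed points of such a group are then controlled by Oliver's argument:
  Smith theory for the \<open>p\<close>-group keeps acyclicity modulo \<open>p\<close>, the Lefschetz fixed point formula for the
  cyclic group gives vanishing reduced Euler characteristic, and orbit counting for the group of order
  \<open>q\<close> gives a nonempty invariant graph in the property. But a nonempty invariant graph has at least
  \<open>k p (p - 1) / 2\<close>, \<open>r q / 2\<close> or \<open>k p r / 2\<close> edges, which contradicts sparsity if \<open>p\<close> and \<open>q\<close>
  are at least of order \<open>n^\<gamma>\<close> and \<open>k p\<close> and \<open>r\<close> are of order \<open>n\<close>.

  Hence \<open>n\<close> in \<open>(x/2, x]\<close> is exceptional only if it avoids all residue classes \<open>r mod p\<close>, where \<open>r\<close>
  runs through the primes of size \<open>x\<close> with \<open>P(r - 1) > r^\<alpha>\<close> and \<open>p\<close> through the primes of size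
  \<open>Q = x^max(\<gamma>, 1/2)\<close>. The large sieve, applied to both sets, bounds the number of such \<open>n\<close> by
  \<open>O((Q^2 / x) (log x)^3)\<close>, and summation over dyadic intervals costs another logarithm.
\<close>

subsection \<open>Order complexes and acyclicity modulo an integer\<close>

text \<open>The obstacle of the topological half is the change of coefficients. Smith theory yields
  acyclicity modulo p only, and a Lefschetz formula over the field with p elements would determine
  the Euler characteristic only modulo p, whereas the final count modulo q needs it to be 0 as an
  integer. Chains therefore have integer coefficients throughout and acyclicity is a statement about
  congruences, so that a contraction modulo p can be used p-adically on integer matrices. In the
  arithmetic half the hypothesis is applied twice, at z = x/4 to supply r and at z = Q to supply the
  moduli p. Chebyshev's upper bound serves to discard the primes below d z, which keeps p and r of
  the orders Q and x. For Q below sqrt x the sieve constant would be of order x instead of Q^2 and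
  the resulting bound x / Q^2, up to logarithms, would be worse than at Q = sqrt x; hence the
  maximum of \<gamma> and 1/2.\<close>

definition order_chains :: "'a::order set \<Rightarrow> 'a set set" where
  "order_chains X = {K. K \<subseteq> X \<and> (\<forall>F\<in>K. \<forall>G\<in>K. F \<le> G \<or> G \<le> F)}"

definition incidence :: "'a::order \<Rightarrow> 'a set \<Rightarrow> int" where
  "incidence F K = (-1) ^ card {G\<in>K. G < F}"

text \<open>The coefficient of the boundary of c at K: each one-point enlargement of K contributes
  with the sign of the position of the new point. U only fixes a common finite range of summation,
  so that subcomplexes share one operator; restriction to a complex is expressed by
  \<open>supported\<close>.\<close>

definition boundary :: "'a::order set \<Rightarrow> ('a set \<Rightarrow> int) \<Rightarrow> 'a set \<Rightarrow> int" where
  "boundary U c K = (\<Sum>F\<in>U - K. incidence F K * c (insert F K))"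

definition supported :: "'b set \<Rightarrow> ('b \<Rightarrow> int) \<Rightarrow> bool" where
  "supported S c \<longleftrightarrow> (\<forall>K. K \<notin> S \<longrightarrow> c K = 0)"

text \<open>
  The empty chain belongs to \<open>order_chains X\<close>, so this is vanishing of reduced homology; in
  particular the order complex of the empty poset is not acyclic (unless \<open>m\<close> is a unit).
\<close>

definition acyclic_mod :: "'a::order set \<Rightarrow> int \<Rightarrow> 'a set set \<Rightarrow> bool" where
  "acyclic_mod U m \<K> \<longleftrightarrow>
     (\<forall>c. supported \<K> c \<longrightarrow> (\<forall>K. m dvd boundary U c K) \<longrightarrow>
        (\<exists>b. supported \<K> b \<and> (\<forall>K. m dvd c K - boundary U b K)))"

lemma acyclic_modD:
  assumes "acyclic_mod U m \<K>" "supported \<K> c" "\<And>K. m dvd boundary U c K"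
  obtains b where "supported \<K> b" "\<And>K. m dvd c K - boundary U b K"
  using assms unfolding acyclic_mod_def by blast

lemma chains_subset: "K \<in> order_chains X \<Longrightarrow> L \<subseteq> K \<Longrightarrow> L \<in> order_chains X"
  unfolding order_chains_def by blast

lemma chains_mono: "X \<subseteq> Y \<Longrightarrow> order_chains X \<subseteq> order_chains Y"
  unfolding order_chains_def by blast

lemma chains_insert:
  "insert F K \<in> order_chains X \<longleftrightarrow> F \<in> X \<and> K \<in> order_chains X \<and> (\<forall>G\<in>K. F \<le> G \<or> G \<le> F)"
  unfolding order_chains_def by auto

lemma finite_chains: "finite X \<Longrightarrow> finite (order_chains X)"
  unfolding order_chains_def by simp

lemma chains_finite: "finite X \<Longrightarrow> K \<in> order_chains X \<Longrightarrow> finite K"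
  unfolding order_chains_def using finite_subset by blast

lemma boundary_add: "boundary U (\<lambda>K. c K + d K) K = boundary U c K + boundary U d K"
  by (simp add: boundary_def ring_distribs sum.distrib)

lemma boundary_diff: "boundary U (\<lambda>K. c K - d K) K = boundary U c K - boundary U d K"
  by (simp add: boundary_def ring_distribs sum_subtractf)

lemma boundary_sum: "boundary U (\<lambda>K. \<Sum>i\<in>I. c i K) K = (\<Sum>i\<in>I. boundary U (c i) K)"
  unfolding boundary_def sum_distrib_left by (rule sum.swap)

lemma boundary_cmult: "boundary U (\<lambda>K. a * c K) K = a * boundary U c K"
  unfolding boundary_def sum_distrib_left by (rule sum.cong) auto

lemma boundary_dvd:
  assumes "\<And>K. m dvd c K - d K"
  shows "m dvd boundary U c K - boundary U d K"
  unfolding boundary_diff[symmetric] unfolding boundary_def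
  by (intro dvd_sum dvd_mult assms)

lemma boundary_supported:
  assumes "\<And>K L. K \<in> \<K> \<Longrightarrow> L \<subseteq> K \<Longrightarrow> L \<in> \<K>" "supported \<K> c"
  shows "supported \<K> (boundary U c)"
  unfolding supported_def boundary_def
proof (intro allI impI sum.neutral ballI)
  fix K F assume "K \<notin> \<K>"
  then have "insert F K \<notin> \<K>" using assms(1) by blast
  then show "incidence F K * c (insert F K) = 0" using assms(2) by (simp add: supported_def)
qed

lemma incidence_sq [simp]: "incidence F K * incidence F K = 1"
  unfolding incidence_def by (simp add: power_add[symmetric] flip: mult_2)

lemma incidence_insert:
  assumes "finite K" "G \<notin> K"
  shows "incidence F (insert G K) = (if G < F then - incidence F K else incidence F K)"
proof -
  have "{H \<in> insert G K. H < F} = (if G < F then insert G {H\<in>K. H < F} else {H\<in>K. H < F})"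
    by auto
  then show ?thesis using assms unfolding incidence_def by simp
qed

lemma incidence_swap:
  assumes "finite K" "F \<notin> K" "G \<notin> K" "F \<noteq> G" "F \<le> G \<or> G \<le> F"
  shows "incidence F (insert G K) * incidence G (insert F K) = - (incidence F K * incidence G K)"
  using assms by (auto simp: incidence_insert)

lemma incidence_antisym:
  assumes "finite K" "F \<notin> K" "G \<notin> K" "F \<noteq> G" "F \<le> G \<or> G \<le> F"
  shows "incidence F K * incidence G (insert F K) = - (incidence G K * incidence F (insert G K))"
  using assms by (auto simp: incidence_insert)

text \<open>The terms for (F, G) and (G, F) cancel if F and G are comparable. Otherwise the signs
  are equal, but then the enlarged set is not a chain and c vanishes on it.\<close>

lemma boundary_boundary:
  assumes "finite U" "supported (order_chains U) c"
  shows "boundary U (boundary U c) K = 0"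
proof (cases "K \<in> order_chains U")
  case False
  have "supported (order_chains U) (boundary U (boundary U c))"
    by (intro boundary_supported assms(2)) (auto intro: chains_subset)
  with False show ?thesis by (simp add: supported_def)
next
  case True
  then have finK: "finite K" using assms(1) chains_finite by blast
  let ?f = "\<lambda>F G. incidence F K * incidence G (insert F K) * c (insert G (insert F K))"
  let ?S = "{(F,G). F \<in> U - K \<and> G \<in> U - K \<and> F \<noteq> G}"
  have fS: "finite ?S" by (rule finite_subset[of _ "U \<times> U"]) (use assms(1) in auto)
  have "boundary U (boundary U c) K
      = (\<Sum>F\<in>U - K. \<Sum>G\<in>U - insert F K. ?f F G)"
    unfolding boundary_def by (simp add: sum_distrib_left mult.assoc)
  also have "\<dots> = (\<Sum>(F,G)\<in>Sigma (U - K) (\<lambda>F. U - insert F K). ?f F G)"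
    by (rule sum.Sigma) (use assms(1) in auto)
  also have "Sigma (U - K) (\<lambda>F. U - insert F K) = ?S" by auto
  finally have 1: "boundary U (boundary U c) K = (\<Sum>(F,G)\<in>?S. ?f F G)" .
  have "(\<Sum>(F,G)\<in>?S. ?f F G) = (\<Sum>(F,G)\<in>?S. ?f G F)"
    by (rule sum.reindex_bij_witness[of _ prod.swap prod.swap]) auto
  also have "\<dots> = (\<Sum>(F,G)\<in>?S. - ?f F G)"
  proof (rule sum.cong[OF refl], clarify)
    fix F G assume FG: "F \<in> U" "F \<notin> K" "G \<in> U" "G \<notin> K" "F \<noteq> G"
    show "?f G F = - ?f F G"
    proof (cases "insert F (insert G K) \<in> order_chains U")
      case True
      then have "F \<le> G \<or> G \<le> F" unfolding order_chains_def by blast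
      from incidence_antisym[OF finK _ _ _ this] FG show ?thesis
        by (simp add: insert_commute)
    next
      case False
      then show ?thesis using assms(2) by (simp add: supported_def insert_commute)
    qed
  qed
  also have "\<dots> = - (\<Sum>(F,G)\<in>?S. ?f F G)"
    by (simp add: sum_negf[symmetric] case_prod_unfold)
  finally show ?thesis using 1 by simp
qed

text \<open>Joining with the apex a is a contracting homotopy: the boundary of the join of a and c
  is c minus the join of a with the boundary of c, hence congruent to c for a cycle.\<close>

lemma acyclic_mod_cone:
  assumes U: "finite U" "X \<subseteq> U" and a: "a \<in> X" "\<And>F. F \<in> X \<Longrightarrow> F \<le> a \<or> a \<le> F"
  shows "acyclic_mod U m (order_chains X)"
  unfolding acyclic_mod_def
proof (intro allI impI)
  fix c assume c: "supported (order_chains X) c" and cyc: "\<forall>K. m dvd boundary U c K"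
  define b where "b K = (if a \<in> K then incidence a (K - {a}) * c (K - {a}) else 0)" for K
  define b' where "b' K = (if K \<in> order_chains X then b K else 0)" for K
  have ins: "insert a K \<in> order_chains X" if "K \<in> order_chains X" for K
    using that a by (auto simp: chains_insert order_chains_def)
  have b_eq: "b' K = b K" for K
  proof (cases "K \<in> order_chains X")
    case False
    have "b K = 0"
    proof (cases "a \<in> K")
      case True
      then have "K - {a} \<notin> order_chains X" using ins[of "K - {a}"] False by (auto simp: insert_absorb)
      then show ?thesis using c by (simp add: b_def supported_def)
    qed (simp add: b_def)
    with False show ?thesis by (simp add: b'_def)
  qed (simp add: b'_def)
  have aU: "a \<in> U" using a U by auto
  have supp: "supported (order_chains X) b" unfolding supported_def by (metis b_eq b'_def)
  have "m dvd c K - boundary U b K" for K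
  proof (cases "K \<in> order_chains X")
    case False
    have "supported (order_chains X) (boundary U b)"
      by (intro boundary_supported supp) (auto intro: chains_subset)
    with False c show ?thesis by (simp add: supported_def)
  next
    case K: True
    have finK: "finite K" using K U chains_finite finite_subset by metis
    show ?thesis
    proof (cases "a \<in> K")
      case False
      have "boundary U b K = (\<Sum>F\<in>{a}. incidence F K * b (insert F K))"
        unfolding boundary_def
        by (rule sum.mono_neutral_right) (use U aU False in \<open>auto simp: b_def\<close>)
      also have "\<dots> = incidence a K * incidence a K * c K"
        using False by (simp add: b_def)
      finally show ?thesis by simp
    next
      case True
      define L where "L = K - {a}"
      have KL: "K = insert a L" "a \<notin> L" "finite L" using True finK by (auto simp: L_def)
      have "boundary U b K = (\<Sum>F\<in>U - K. - incidence a L * (incidence F L * c (insert F L)))"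
        unfolding boundary_def
      proof (rule sum.cong[OF refl])
        fix F assume F: "F \<in> U - K"
        then have ne: "F \<noteq> a" "F \<notin> L" using KL by auto
        have e: "insert F K - {a} = insert F L" using ne KL by auto
        show "incidence F K * b (insert F K) = - incidence a L * (incidence F L * c (insert F L))"
        proof (cases "F \<in> X")
          case FX: True
          have "incidence F (insert a L) * incidence a (insert F L) = - (incidence F L * incidence a L)"
            using a(2)[OF FX] ne KL by (intro incidence_swap) auto
          moreover have "incidence F K * b (insert F K) = incidence F (insert a L) * incidence a (insert F L) * c (insert F L)"
            using True KL unfolding b_def e by simp
          ultimately show ?thesis by simp
        next
          case False
          then have "c (insert F L) = 0" using c by (auto simp: supported_def chains_insert)
          then show ?thesis unfolding b_def e by simp
        qed
      qed
      also have "\<dots> = - incidence a L * (\<Sum>F\<in>U - K. incidence F L * c (insert F L))"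
        by (simp add: sum_distrib_left)
      also have "(\<Sum>F\<in>U - K. incidence F L * c (insert F L)) = boundary U c L - incidence a L * c K"
      proof -
        have e: "U - L = insert a (U - K)" using KL aU by auto
        have "finite (U - K)" "a \<notin> U - K" using U True by auto
        then have "boundary U c L
            = incidence a L * c (insert a L) + (\<Sum>F\<in>U - K. incidence F L * c (insert F L))"
          unfolding boundary_def e by (rule sum.insert)
        then show ?thesis unfolding KL(1)[symmetric] by simp
      qed
      finally have "boundary U b K = - incidence a L * (boundary U c L - incidence a L * c K)" .
      moreover have "- x * (y - x * z) = z - x * y" if "x * x = 1" for x y z :: int
      proof -
        have "- x * (y - x * z) = (x * x) * z - x * y" by (simp add: algebra_simps)
        then show ?thesis using that by simp
      qed
      ultimately have "boundary U b K = c K - incidence a L * boundary U c L"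
        using incidence_sq by metis
      then show ?thesis using cyc by simp
    qed
  qed
  with supp show "\<exists>b. supported (order_chains X) b \<and> (\<forall>K. m dvd c K - boundary U b K)" by blast
qed

text \<open>Split z as a + b along A and B. The boundary of a is, modulo m, a cycle on the
  intersection; filling it by c makes a - c and b + c cycles on A and B, and their fillings add up
  to a filling of z.\<close>

lemma acyclic_mod_mayer_vietoris:
  assumes U: "finite U" "X \<subseteq> U" "A \<subseteq> X" "B \<subseteq> X"
    and cover: "\<And>K. K \<in> order_chains X \<Longrightarrow> K \<subseteq> A \<or> K \<subseteq> B"
    and acyc: "acyclic_mod U m (order_chains A)" "acyclic_mod U m (order_chains B)"
      "acyclic_mod U m (order_chains (A \<inter> B))"
  shows "acyclic_mod U m (order_chains X)"
  unfolding acyclic_mod_def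
proof (intro allI impI)
  fix z assume z: "supported (order_chains X) z" and cyc: "\<forall>K. m dvd boundary U z K"
  define a where "a K = (if K \<subseteq> A then z K else 0)" for K
  define b where "b K = z K - a K" for K
  have mem: "K \<in> order_chains Y \<longleftrightarrow> K \<in> order_chains X \<and> K \<subseteq> Y" if "Y \<subseteq> X" for K Y
    using that unfolding order_chains_def by auto
  have IX: "A \<inter> B \<subseteq> X" using U by auto
  have sa: "supported (order_chains A) a"
    using z by (auto simp: supported_def a_def mem[OF U(3)])
  have sb: "supported (order_chains B) b"
    using z cover by (auto simp: supported_def a_def b_def mem[OF U(4)])
  have sda: "supported (order_chains A) (boundary U a)"
    by (intro boundary_supported sa) (auto intro: chains_subset)
  have sdb: "supported (order_chains B) (boundary U b)"
    by (intro boundary_supported sb) (auto intro: chains_subset)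
  \<comment> \<open>Outside the intersection one of the two boundaries vanishes exactly, while their
    sum vanishes only modulo m. The truncation w is supported on the intersection and congruent to
    the boundary of a.\<close>
  define w where "w K = (if K \<in> order_chains (A \<inter> B) then boundary U a K else 0)" for K
  have sum: "boundary U a K + boundary U b K = boundary U z K" for K
    unfolding boundary_add[symmetric] b_def by simp
  have w: "m dvd boundary U a K - w K" for K
  proof (cases "K \<in> order_chains (A \<inter> B)")
    case False
    then have "boundary U a K = 0 \<or> boundary U b K = 0"
      using sda sdb unfolding supported_def mem[OF U(3)] mem[OF U(4)] mem[OF IX] by auto
    then have "boundary U a K = 0 \<or> boundary U a K = boundary U z K" using sum[of K] by auto
    then show ?thesis using cyc False by (auto simp: w_def)
  qed (simp add: w_def)
  have sw: "supported (order_chains (A \<inter> B)) w" by (simp add: supported_def w_def)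
  have sa': "supported (order_chains U) a"
    using sa chains_mono[of A U] U unfolding supported_def by blast
  have "m dvd boundary U w K" for K
    using boundary_dvd[of m "boundary U a" w U K, OF w] boundary_boundary[OF U(1) sa', of K]
    by simp
  from acyclic_modD[OF acyc(3) sw this] obtain c where
    sc: "supported (order_chains (A \<inter> B)) c" and c: "\<And>K. m dvd w K - boundary U c K" by blast
  have ac: "m dvd boundary U a K - boundary U c K" for K
    using dvd_add[OF w[of K] c[of K]] by simp
  have "supported (order_chains A) (\<lambda>K. a K - c K)"
    using sa sc unfolding supported_def mem[OF U(3)] mem[OF IX] by auto
  moreover have "m dvd boundary U (\<lambda>K. a K - c K) K" for K
    using ac by (simp add: boundary_diff)
  ultimately obtain u where su: "supported (order_chains A) u" and u: "\<And>K. m dvd a K - c K - boundary U u K"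
    using acyclic_modD[OF acyc(1)] by blast
  have "supported (order_chains B) (\<lambda>K. b K + c K)"
    using sb sc unfolding supported_def mem[OF U(4)] mem[OF IX] by auto
  moreover have "m dvd boundary U (\<lambda>K. b K + c K) K" for K
  proof -
    have "boundary U (\<lambda>K. b K + c K) K = boundary U z K - (boundary U a K - boundary U c K)"
      using sum[of K] by (simp add: boundary_add)
    then show ?thesis using dvd_diff[OF cyc[rule_format, of K] ac[of K]] by simp
  qed
  ultimately obtain v where sv: "supported (order_chains B) v" and v: "\<And>K. m dvd b K + c K - boundary U v K"
    using acyclic_modD[OF acyc(2)] by blast
  have "supported (order_chains X) (\<lambda>K. u K + v K)"
    using su sv unfolding supported_def mem[OF U(4)] mem[OF U(3)] by auto
  moreover have "m dvd z K - boundary U (\<lambda>K. u K + v K) K" for K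
  proof -
    have "z K - boundary U (\<lambda>K. u K + v K) K = (a K - c K - boundary U u K) + (b K + c K - boundary U v K)"
      by (simp add: boundary_add b_def)
    then show ?thesis using dvd_add[OF u[of K] v[of K]] by simp
  qed
  ultimately show "\<exists>b. supported (order_chains X) b \<and> (\<forall>K. m dvd z K - boundary U b K)" by blast
qed

text \<open>Adding x to the poset glues a cone with apex x along the order complex of the elements
  comparable with x.\<close>

lemma acyclic_mod_insert:
  assumes U: "finite U" "insert x X \<subseteq> U" "x \<notin> X"
    and acyc: "acyclic_mod U m (order_chains X)"
      "acyclic_mod U m (order_chains {y\<in>X. y \<le> x \<or> x \<le> y})"
  shows "acyclic_mod U m (order_chains (insert x X))"
proof (rule acyclic_mod_mayer_vietoris[of U _ X "insert x {y\<in>X. y \<le> x \<or> x \<le> y}"])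
  show "K \<subseteq> X \<or> K \<subseteq> insert x {y \<in> X. y \<le> x \<or> x \<le> y}" if "K \<in> order_chains (insert x X)" for K
    using that unfolding order_chains_def by blast
  show "acyclic_mod U m (order_chains (insert x {y \<in> X. y \<le> x \<or> x \<le> y}))"
    by (rule acyclic_mod_cone[of U _ x]) (use U in auto)
  have "X \<inter> insert x {y \<in> X. y \<le> x \<or> x \<le> y} = {y\<in>X. y \<le> x \<or> x \<le> y}" using U by auto
  then show "acyclic_mod U m (order_chains (X \<inter> insert x {y \<in> X. y \<le> x \<or> x \<le> y}))"
    using acyc by simp
qed (use U acyc in auto)

subsection \<open>Automorphisms of posets\<close>

definition order_aut :: "('a::order \<Rightarrow> 'a) \<Rightarrow> bool" where
  "order_aut g \<longleftrightarrow> bij g \<and> (\<forall>F G. g F \<le> g G \<longleftrightarrow> F \<le> G)"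

lemma order_aut_inj: "order_aut g \<Longrightarrow> inj g"
  by (simp add: order_aut_def bij_is_inj)

lemma order_aut_le: "order_aut g \<Longrightarrow> g F \<le> g G \<longleftrightarrow> F \<le> G"
  by (simp add: order_aut_def)

lemma order_aut_less: "order_aut g \<Longrightarrow> g F < g G \<longleftrightarrow> F < G"
  by (simp add: order_aut_def less_le_not_le)

lemma order_aut_funpow: "order_aut g \<Longrightarrow> order_aut (g ^^ i)"
  by (induction i) (auto simp: order_aut_def intro: bij_comp)

lemma image_funpow: "((`) (g :: 'a \<Rightarrow> 'a) ^^ i) K = (g ^^ i) ` K"
  by (induction i) (auto simp: image_comp)

lemma image_funpow_invariant: "g ` X = X \<Longrightarrow> (g ^^ i) ` X = X"
proof (induction i)
  case (Suc i)
  have "(g ^^ Suc i) ` X = g ` ((g ^^ i) ` X)" by (simp add: image_comp)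
  then show ?case using Suc by simp
qed simp

lemma incidence_image:
  assumes "order_aut g"
  shows "incidence (g F) (g ` K) = incidence F K"
proof -
  have "{G \<in> g ` K. G < g F} = g ` {G\<in>K. G < F}"
    using order_aut_less[OF assms] by auto
  moreover have "inj_on g A" for A
    using order_aut_inj[OF assms] by (rule inj_on_subset) auto
  ultimately show ?thesis unfolding incidence_def by (simp add: card_image)
qed

lemma order_chains_image:
  assumes "order_aut g" "g ` X = X"
  shows "g ` K \<in> order_chains X \<longleftrightarrow> K \<in> order_chains X"
proof -
  have "g ` K \<subseteq> X \<longleftrightarrow> K \<subseteq> X"
    using assms(2) inj_image_subset_iff[OF order_aut_inj[OF assms(1)]] by metis
  then show ?thesis unfolding order_chains_def using order_aut_le[OF assms(1)] by auto
qed

lemma boundary_image: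
  assumes "order_aut g" "g ` U = U"
  shows "boundary U (\<lambda>K. c (g ` K)) K = boundary U c (g ` K)"
proof -
  have inj: "inj g" by (rule order_aut_inj[OF assms(1)])
  have "boundary U c (g ` K) = (\<Sum>F\<in>g ` (U - K). incidence F (g ` K) * c (insert F (g ` K)))"
    unfolding boundary_def by (simp add: image_set_diff[OF inj] assms(2))
  also have "\<dots> = (\<Sum>F\<in>U - K. incidence (g F) (g ` K) * c (insert (g F) (g ` K)))"
    by (subst sum.reindex) (use inj in \<open>auto intro: inj_on_subset\<close>)
  finally show ?thesis by (simp add: boundary_def incidence_image[OF assms(1)])
qed

text \<open>An automorphism preserving the finite chain K preserves the number of elements of K
  below F, and this number determines F in K.\<close>

lemma order_chains_image_fixed:
  assumes g: "order_aut g" and K: "K \<in> order_chains X" "finite K" "g ` K = K" and F: "F \<in> K"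
  shows "g F = F"
proof (rule ccontr)
  assume ne: "g F \<noteq> F"
  have gF: "g F \<in> K" using F K by blast
  have eq: "card {G\<in>K. G < g F} = card {G\<in>K. G < F}"
  proof -
    have "{G\<in>K. G < g F} = g ` {G\<in>K. G < F}"
      using K(3) order_aut_less[OF g] by (auto 0 4 simp: image_iff)
    then show ?thesis
      using order_aut_inj[OF g] by (simp add: card_image inj_on_subset)
  qed
  consider "F < g F" | "g F < F"
    using K(1) F gF ne unfolding order_chains_def by fastforce
  then show False
  proof cases
    case 1
    then have "{G\<in>K. G < F} \<subset> {G\<in>K. G < g F}" using F by auto
    from psubset_card_mono[OF _ this] eq K(2) show False by simp
  next
    case 2
    then have "{G\<in>K. G < g F} \<subset> {G\<in>K. G < F}" using gF by auto
    from psubset_card_mono[OF _ this] eq K(2) show False by simp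
  qed
qed

text \<open>This is the gain from passing to an order complex: no simplex is mapped to itself with
  its vertices permuted, so the fixed simplices form an order complex again and fixed point theorems
  can be iterated.\<close>

lemma order_chains_fixed:
  assumes "order_aut g" "finite X"
  shows "{K \<in> order_chains X. g ` K = K} = order_chains {F\<in>X. g F = F}"
proof (intro equalityI subsetI)
  fix K assume K: "K \<in> {K \<in> order_chains X. g ` K = K}"
  then have "finite K" using chains_finite assms(2) by blast
  with K have "\<forall>F\<in>K. g F = F" using order_chains_image_fixed[OF assms(1), of K X] by auto
  with K show "K \<in> order_chains {F\<in>X. g F = F}"
    unfolding order_chains_def by auto
next
  fix K assume "K \<in> order_chains {F\<in>X. g F = F}"
  then have "K \<in> order_chains X" "\<forall>F\<in>K. g F = F" unfolding order_chains_def by auto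
  then show "K \<in> {K \<in> order_chains X. g ` K = K}" by force
qed

subsection \<open>Free orbits of maps of prime order\<close>

text \<open>\<open>\<iota> K\<close> is the number of steps from K to a chosen representative of its
  orbit. A non-fixed orbit has exactly p elements, so the index takes each value below p once and
  drops by one along \<phi>, wrapping around at the representative.\<close>

lemma prime_order_orbit_index:
  fixes \<phi> :: "'b \<Rightarrow> 'b" and p :: nat
  assumes p: "prime p" and per: "\<And>K. (\<phi> ^^ p) K = K"
  obtains \<iota> :: "'b \<Rightarrow> nat" where
    "\<And>K. \<phi> K \<noteq> K \<Longrightarrow> \<iota> K < p"
    "\<And>K j. \<phi> K \<noteq> K \<Longrightarrow> j < p \<Longrightarrow> \<iota> ((\<phi> ^^ j) K) = 0 \<longleftrightarrow> j = \<iota> K"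
    "\<And>K. \<phi> K \<noteq> K \<Longrightarrow> \<iota> (\<phi> K) = (if \<iota> K = 0 then p - 1 else \<iota> K - 1)"
proof -
  have p0: "p > 0" "p > 1" using p prime_gt_1_nat prime_gt_0_nat by auto
  have perm: "(\<phi> ^^ (p * m)) K = K" for m K
  proof (induction m)
    case (Suc m)
    have "(\<phi> ^^ (p * Suc m)) K = (\<phi> ^^ p) ((\<phi> ^^ (p * m)) K)"
      by (metis comp_apply funpow_add mult_Suc_right)
    then show ?case by (simp only: per Suc.IH)
  qed simp
  have modp: "(\<phi> ^^ i) K = (\<phi> ^^ (i mod p)) K" for i K
  proof -
    have "(\<phi> ^^ i) K = (\<phi> ^^ (i mod p + p * (i div p))) K" by simp
    also have "\<dots> = (\<phi> ^^ (i mod p)) ((\<phi> ^^ (p * (i div p))) K)" by (simp only: funpow_add comp_apply)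
    finally show ?thesis by (simp only: perm)
  qed
  have inj: "K = L" if "(\<phi> ^^ i) K = (\<phi> ^^ i) L" for i K L
  proof -
    have "(\<phi> ^^ (p * i - i)) ((\<phi> ^^ i) J) = J" for J
    proof -
      have "(\<phi> ^^ (p * i - i)) ((\<phi> ^^ i) J) = (\<phi> ^^ (p * i - i + i)) J" by (simp only: funpow_add comp_apply)
      also have "p * i - i + i = p * i" using p0 by simp
      finally show ?thesis using perm by simp
    qed
    with that show ?thesis by metis
  qed
  have uniq: "i = j" if ne: "\<phi> K \<noteq> K" and ij: "i < p" "j < p" "(\<phi> ^^ i) K = (\<phi> ^^ j) K" for i j K
    using ij
  proof (induction i j rule: linorder_wlog)
    case (le i j)
    show ?case
    proof (rule ccontr)
      assume "i \<noteq> j"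
      define d where "d = j - i"
      have d: "0 < d" "d < p" "j = i + d" using le \<open>i \<noteq> j\<close> by (auto simp: d_def)
      have "(\<phi> ^^ i) ((\<phi> ^^ d) K) = (\<phi> ^^ i) K"
        using le(4) unfolding d(3) by (simp only: funpow_add comp_apply)
      then have fd: "(\<phi> ^^ d) K = K" by (rule inj)
      have fdm: "(\<phi> ^^ (d * m)) K = K" for m
      proof (induction m)
        case (Suc m)
        have "(\<phi> ^^ (d * Suc m)) K = (\<phi> ^^ d) ((\<phi> ^^ (d * m)) K)"
          by (metis comp_apply funpow_add mult_Suc_right)
        then show ?case by (simp only: fd Suc.IH)
      qed simp
      \<comment> \<open>As p is prime, some multiple of d is 1 modulo p; a period d would therefore
        make \<phi> itself fix K.\<close>
      have "coprime d p" using d p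
        by (metis coprime_commute nat_dvd_not_less prime_imp_coprime)
      then obtain m where "[d * m = 1] (mod p)" using cong_solve_coprime_nat by fastforce
      then have "(d * m) mod p = 1" using p0 by (simp add: cong_def)
      then have "\<phi> K = (\<phi> ^^ (d * m)) K" using modp[of "d * m" K] by simp
      with fdm ne show False by simp
    qed
  next
    case (sym i j)
    then show ?case by (metis)
  qed
  define orb where "orb K = range (\<lambda>i. (\<phi> ^^ i) K)" for K
  \<comment> \<open>Chosen from the orbit as a set, so that it depends on the orbit only.\<close>
  define rep where "rep K = (SOME L. L \<in> orb K)" for K
  have orb: "orb (\<phi> K) = orb K" for K
  proof -
    have "(\<phi> ^^ i) (\<phi> K) = (\<phi> ^^ Suc i) K" for i by (simp only: funpow_Suc_right comp_apply)
    then have "orb (\<phi> K) \<subseteq> orb K" by (auto simp: orb_def simp del: funpow.simps)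
    moreover have "(\<phi> ^^ i) K = (\<phi> ^^ (i + p - 1)) (\<phi> K)" for i
    proof -
      have "(\<phi> ^^ (i + p - 1)) (\<phi> K) = (\<phi> ^^ Suc (i + p - 1)) K"
        by (simp only: funpow_Suc_right comp_apply)
      also have "Suc (i + p - 1) = i + p" using p0 by simp
      finally show ?thesis by (simp only: funpow_add comp_apply per)
    qed
    then have "orb K \<subseteq> orb (\<phi> K)" by (auto simp: orb_def simp del: funpow.simps)
    ultimately show ?thesis by auto
  qed
  have rep: "rep (\<phi> K) = rep K" for K by (simp add: rep_def orb)
  have rep': "rep ((\<phi> ^^ j) K) = rep K" for j K by (induction j) (auto simp: rep)
  have ex: "\<exists>i<p. (\<phi> ^^ i) K = rep K" for K
  proof -
    have "rep K \<in> orb K" unfolding rep_def by (rule someI[of _ K]) (auto simp: orb_def intro: range_eqI[of _ _ 0])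
    then obtain i where "rep K = (\<phi> ^^ i) K" by (auto simp: orb_def)
    then have "rep K = (\<phi> ^^ (i mod p)) K" using modp by simp
    then show ?thesis using p0 by (intro exI[of _ "i mod p"]) auto
  qed
  define \<iota> where "\<iota> K = (SOME i. i < p \<and> (\<phi> ^^ i) K = rep K)" for K
  have \<iota>: "\<iota> K < p" "(\<phi> ^^ \<iota> K) K = rep K" for K
    using someI_ex[OF ex, of K] unfolding \<iota>_def by auto
  have \<iota>I: "\<iota> K = i" if "\<phi> K \<noteq> K" "i < p" "(\<phi> ^^ i) K = rep K" for K i
    using uniq[OF that(1) \<iota>(1) that(2)] \<iota>(2) that(3) by simp
  have nf: "\<phi> ((\<phi> ^^ j) K) \<noteq> (\<phi> ^^ j) K" if "\<phi> K \<noteq> K" for j K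
    using inj[of j "\<phi> K" K] that by (metis funpow_swap1)
  show ?thesis
  proof (rule that)
    show "\<iota> K < p" for K by (rule \<iota>)
    show "\<iota> ((\<phi> ^^ j) K) = 0 \<longleftrightarrow> j = \<iota> K" if "\<phi> K \<noteq> K" "j < p" for K j
    proof
      assume "\<iota> ((\<phi> ^^ j) K) = 0"
      then have "(\<phi> ^^ j) K = rep K" using \<iota>(2)[of "(\<phi> ^^ j) K"] rep' by simp
      then show "j = \<iota> K" using \<iota>I[of K j] that by simp
    next
      assume "j = \<iota> K"
      then show "\<iota> ((\<phi> ^^ j) K) = 0"
        using \<iota>I[OF nf[OF that(1), of j], of 0] p0 \<iota>(2)[of K] rep'[of j K] by simp
    qed
    show "\<iota> (\<phi> K) = (if \<iota> K = 0 then p - 1 else \<iota> K - 1)" if ne: "\<phi> K \<noteq> K" for K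
    proof (rule \<iota>I)
      show "\<phi> (\<phi> K) \<noteq> \<phi> K" using nf[OF ne, of 1] by simp
      show "(if \<iota> K = 0 then p - 1 else \<iota> K - 1) < p" using \<iota>(1)[of K] p0 by auto
      have "(\<phi> ^^ (p - 1)) (\<phi> K) = (\<phi> ^^ p) K"
        using p0 by (metis Suc_diff_1 comp_apply funpow_Suc_right)
      moreover have "(\<phi> ^^ (\<iota> K - 1)) (\<phi> K) = (\<phi> ^^ \<iota> K) K" if "\<iota> K \<noteq> 0"
        using that by (cases "\<iota> K") (auto simp: funpow_swap1)
      ultimately show "(\<phi> ^^ (if \<iota> K = 0 then p - 1 else \<iota> K - 1)) (\<phi> K) = rep (\<phi> K)"
        using \<iota>(2)[of K] per by (auto simp: rep)
    qed
  qed
qed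

lemma sum_prime_order_cong:
  fixes w :: "'b \<Rightarrow> int"
  assumes p: "prime p" and per: "\<And>K. (\<phi> ^^ p) K = K"
    and S: "finite S" "\<phi> ` S = S" and inv: "\<And>K. w (\<phi> K) = w K"
  shows "[sum w S = sum w {K\<in>S. \<phi> K = K}] (mod int p)"
proof -
  obtain \<iota> :: "'b \<Rightarrow> nat" where \<iota>: "\<And>K. \<phi> K \<noteq> K \<Longrightarrow> \<iota> K < p"
    "\<And>K j. \<phi> K \<noteq> K \<Longrightarrow> j < p \<Longrightarrow> \<iota> ((\<phi> ^^ j) K) = 0 \<longleftrightarrow> j = \<iota> K"
    using prime_order_orbit_index[OF p per] by metis
  define S' where "S' = {K\<in>S. \<phi> K \<noteq> K}"
  have inj: "inj \<phi>"
  proof (rule injI)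
    fix K L assume "\<phi> K = \<phi> L"
    moreover have "(\<phi> ^^ (p - 1)) (\<phi> J) = J" for J
      using per p by (metis Suc_diff_1 comp_apply funpow_Suc_right prime_gt_0_nat)
    ultimately show "K = L" by metis
  qed
  have S'img: "\<phi> ` S' = S'"
  proof -
    have "S' = S - {K. \<phi> K = K}" by (auto simp: S'_def)
    moreover have "\<phi> ` {K. \<phi> K = K} = {K. \<phi> K = K}" by force
    ultimately show ?thesis using S(2) by (simp add: image_set_diff[OF inj])
  qed
  have S'i: "(\<phi> ^^ i) ` S' = S'" for i by (rule image_funpow_invariant[OF S'img])
  have injn: "inj (\<phi> ^^ i)" for i using inj by (induction i) (auto intro: inj_compose)
  have wi: "w ((\<phi> ^^ i) K) = w K" for i K by (induction i) (auto simp: inv)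
  \<comment> \<open>The indicator of the representatives: exactly one of the p translates of a
    non-fixed K is a representative. Exchanging the sums then exhibits the factor p.\<close>
  let ?\<rho> = "\<lambda>K. if \<iota> K = 0 then 1 else (0::int)"
  have "sum w S' = (\<Sum>K\<in>S'. \<Sum>i<p. w K * ?\<rho> ((\<phi> ^^ i) K))"
  proof (rule sum.cong[OF refl])
    fix K assume "K \<in> S'"
    then have ne: "\<phi> K \<noteq> K" by (simp add: S'_def)
    have "(\<Sum>i<p. ?\<rho> ((\<phi> ^^ i) K)) = (\<Sum>i<p. if i = \<iota> K then 1 else 0)"
      by (rule sum.cong) (use \<iota>(2)[OF ne] in auto)
    also have "\<dots> = 1" using \<iota>(1)[OF ne] by simp
    finally show "w K = (\<Sum>i<p. w K * ?\<rho> ((\<phi> ^^ i) K))" by (simp add: sum_distrib_left[symmetric])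
  qed
  also have "\<dots> = (\<Sum>i<p. \<Sum>K\<in>S'. w ((\<phi> ^^ i) K) * ?\<rho> ((\<phi> ^^ i) K))"
    unfolding wi by (rule sum.swap)
  also have "\<dots> = (\<Sum>i<p. \<Sum>K\<in>S'. w K * ?\<rho> K)"
  proof (rule sum.cong[OF refl])
    fix i
    have "(\<Sum>K\<in>(\<phi> ^^ i) ` S'. w K * ?\<rho> K) = (\<Sum>K\<in>S'. w ((\<phi> ^^ i) K) * ?\<rho> ((\<phi> ^^ i) K))"
      by (subst sum.reindex) (use injn in \<open>auto intro: inj_on_subset\<close>)
    then show "(\<Sum>K\<in>S'. w ((\<phi> ^^ i) K) * ?\<rho> ((\<phi> ^^ i) K)) = (\<Sum>K\<in>S'. w K * ?\<rho> K)"
      using S'i by simp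
  qed
  also have "\<dots> = int p * (\<Sum>K\<in>S'. w K * ?\<rho> K)" by simp
  finally have dvd: "int p dvd sum w S'" by simp
  have "sum w S = sum w {K\<in>S. \<phi> K = K} + sum w S'"
    unfolding S'_def using S(1) by (subst sum.union_disjoint[symmetric]) (auto intro: sum.cong)
  with dvd show ?thesis by (simp add: cong_iff_dvd_diff)
qed

subsection \<open>Smith theory: fixed points of automorphisms of prime order\<close>

text \<open>The group ring element with coefficient \<open>w i\<close> at the i-th power of g,
  acting on chains by pullback.\<close>

definition orbit_op :: "('a \<Rightarrow> 'a) \<Rightarrow> nat \<Rightarrow> (nat \<Rightarrow> int) \<Rightarrow> ('a set \<Rightarrow> int) \<Rightarrow> 'a set \<Rightarrow> int" where
  "orbit_op g p w c K = (\<Sum>i<p. w i * c ((g ^^ i) ` K))"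

lemma orbit_op_diff:
  "orbit_op g p w (\<lambda>K. c K - d K) K = orbit_op g p w c K - orbit_op g p w d K"
  by (simp add: orbit_op_def ring_distribs sum_subtractf)

lemma orbit_op_dvd:
  assumes "\<And>K. m dvd c K - d K"
  shows "m dvd orbit_op g p w c K - orbit_op g p w d K"
  unfolding orbit_op_diff[symmetric] unfolding orbit_op_def by (intro dvd_sum dvd_mult assms)

locale smith =
  fixes U X :: "'a::order set" and g :: "'a \<Rightarrow> 'a" and p :: nat
  assumes finU: "finite U" and XU: "X \<subseteq> U" and aut: "order_aut g"
    and gU: "g ` U = U" and gX: "g ` X = X"
    and per: "\<And>F. (g ^^ p) F = F" and p: "prime p"
    and acyc: "acyclic_mod U (int p) (order_chains X)"
begin

definition Y where "Y = {F\<in>X. g F = F}"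

abbreviation "op \<equiv> orbit_op g p"
abbreviation "CX \<equiv> order_chains X"
abbreviation "CY \<equiv> order_chains Y"
abbreviation "bd \<equiv> boundary U"

lemma CY_CX: "CY \<subseteq> CX"
  by (rule chains_mono) (auto simp: Y_def)

lemma supp_YX: "supported CY c \<Longrightarrow> supported CX c"
  using CY_CX unfolding supported_def by blast

lemma finX: "finite X"
  using finU XU finite_subset by blast

lemma CX_CU: "CX \<subseteq> order_chains U"
  by (rule chains_mono[OF XU])

lemma supp_XU: "supported CX c \<Longrightarrow> supported (order_chains U) c"
  using CX_CU unfolding supported_def by blast

lemma CY_iff: "K \<in> CY \<longleftrightarrow> K \<in> CX \<and> g ` K = K"
  using order_chains_fixed[OF aut finX] unfolding Y_def by auto

lemma CX_pow: "(g ^^ i) ` K \<in> CX \<longleftrightarrow> K \<in> CX"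
  by (rule order_chains_image[OF order_aut_funpow[OF aut] image_funpow_invariant[OF gX]])

lemma supp_bd: "supported CX c \<Longrightarrow> supported CX (bd c)" "supported CY c \<Longrightarrow> supported CY (bd c)"
  by (rule boundary_supported; auto intro: chains_subset)+

lemma supp_op: "supported CX c \<Longrightarrow> supported CX (op w c)"
  unfolding supported_def orbit_op_def by (simp add: CX_pow)

lemma bd_op: "bd (op w c) K = op w (bd c) K"
proof -
  have "bd (\<lambda>K. c ((g ^^ i) ` K)) K = bd c ((g ^^ i) ` K)" for i
    by (rule boundary_image[OF order_aut_funpow[OF aut] image_funpow_invariant[OF gU]])
  then show ?thesis unfolding orbit_op_def by (simp add: boundary_sum boundary_cmult)
qed

lemma op_fixed:
  assumes "K \<in> CY"
  shows "op w c K = (\<Sum>i<p. w i) * c K"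
proof -
  have "(g ^^ i) ` K = K" for i
    using assms image_funpow_invariant[of g K] by (simp add: CY_iff)
  then show ?thesis by (simp add: orbit_op_def sum_distrib_right)
qed

text \<open>On chains of fixed points the operator is multiplication by the sum of its weights,
  which is p or 0 for the two operators in question; off \<open>CY\<close> all the translates
  vanish.\<close>

lemma op_supp_Y:
  assumes "supported CY c" "int p dvd (\<Sum>i<p. w i)"
  shows "int p dvd op w c K"
proof (cases "K \<in> CY")
  case True
  then show ?thesis using assms by (simp add: op_fixed)
next
  case False
  have "c ((g ^^ i) ` K) = 0" for i
  proof (cases "K \<in> CX")
    case True
    have "(g ^^ i) ` K \<notin> CY"
    proof
      assume "(g ^^ i) ` K \<in> CY"
      then have "(g ^^ i) ` (g ` K) = (g ^^ i) ` K"
        by (simp add: CY_iff image_comp comp_def funpow_swap1)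
      then have "g ` K = K"
        using order_aut_inj[OF order_aut_funpow[OF aut]] by (simp add: inj_image_eq_iff)
      with True False show False by (simp add: CY_iff)
    qed
    then show ?thesis using assms by (simp add: supported_def)
  next
    case False
    then have "(g ^^ i) ` K \<notin> CY" using CX_pow CY_CX by blast
    then show ?thesis using assms by (simp add: supported_def)
  qed
  then show ?thesis by (simp add: orbit_op_def)
qed

definition above :: "nat \<Rightarrow> ('a set \<Rightarrow> int) \<Rightarrow> bool" where
  "above m c \<longleftrightarrow> (\<forall>K. card K < m \<longrightarrow> c K = 0)"

lemma above_op: "above m c \<Longrightarrow> above m (op w c)"
proof -
  have "card ((g ^^ i) ` K) = card K" for i K
    by (rule card_image) (rule inj_on_subset[OF order_aut_inj[OF order_aut_funpow[OF aut]]], simp)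
  then show "above m c \<Longrightarrow> above m (op w c)" unfolding above_def orbit_op_def by simp
qed

text \<open>The boundary at K only involves sets with one more element. Erasing a filling on sets of
  at most m elements thus leaves its boundary unchanged in sizes m and above, and makes it 0, like
  z, below m.\<close>

lemma cycle_above:
  assumes "supported CX z" "above m z" "\<And>K. int p dvd bd z K"
  obtains b where "supported CX b" "above (Suc m) b" "\<And>K. int p dvd z K - bd b K"
proof -
  obtain b where b: "supported CX b" "\<And>K. int p dvd z K - bd b K"
    using acyclic_modD[OF acyc assms(1,3)] by blast
  define b' where "b' K = (if card K < Suc m then 0 else b K)" for K
  have "int p dvd z K - bd b' K" for K
  proof (cases "K \<in> CX")
    case True
    then have "finite K" using finX chains_finite by blast
    then have "bd b' K = (if card K < m then 0 else bd b K)"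
      unfolding boundary_def b'_def by simp
    then show ?thesis using b(2)[of K] assms(2) by (auto simp: above_def)
  next
    case False
    have "supported CX b'" using b(1) by (simp add: supported_def b'_def)
    then have "bd b' K = 0" using supp_bd False by (simp add: supported_def)
    then show ?thesis using False assms(1) by (simp add: supported_def)
  qed
  then show ?thesis
    by (intro that[of b']) (use b(1) in \<open>auto simp: supported_def b'_def above_def\<close>)
qed

text \<open>
  For \<open>1 - g\<close> and \<open>1 + g + \<dots> + g ^ (p - 1)\<close>, with coefficients \<open>u\<close> and \<open>v\<close> in either order, the
  kernel of \<open>op v\<close> modulo \<open>p\<close> is the sum of the chains on \<open>Y\<close> and the image of \<open>op u\<close>. In a cycle
  \<open>c + op u e\<close> of degree at least \<open>m\<close> both summands are then boundaries of the expected form; the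
  downward induction on \<open>m\<close> alternates between the two operators.
\<close>

definition splits :: "(nat \<Rightarrow> int) \<Rightarrow> nat \<Rightarrow> bool" where
  "splits u m \<longleftrightarrow> (\<forall>c e. supported CY c \<and> supported CX e \<and> above m c \<and> above m e \<and>
      (\<forall>K. int p dvd bd (\<lambda>K. c K + op u e K) K) \<longrightarrow>
      (\<exists>y w. supported CY y \<and> supported CX w \<and> (\<forall>K. int p dvd c K - bd y K) \<and>
         (\<forall>K. int p dvd op u e K - op u (bd w) K)))"

text \<open>Fill the cycle z by b. Since \<open>op v\<close> kills both summands of z modulo p,
  \<open>op v b\<close> is a cycle one degree up, and \<open>IH\<close> gives a with
  \<open>op v b\<close> congruent to \<open>op v (bd a)\<close>. So \<open>b - bd a\<close> lies in
  the kernel of \<open>op v\<close> and has the form \<open>y + op u w\<close>; taking boundaries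
  recovers z.\<close>

lemma splits_step:
  assumes uv: "int p dvd (\<Sum>i<p. u i)" "int p dvd (\<Sum>i<p. v i)"
    and comp: "\<And>e K. int p dvd op v (op u e) K"
    and ker: "\<And>b. supported CX b \<Longrightarrow> (\<And>K. int p dvd op v b K) \<Longrightarrow>
      \<exists>y w. supported CY y \<and> supported CX w \<and> (\<forall>K. int p dvd b K - (y K + op u w K))"
    and IH: "splits v (Suc m)"
  shows "splits u m"
  unfolding splits_def
proof (intro allI impI, elim conjE)
  fix c e
  assume c: "supported CY c" "above m c" and e: "supported CX e" "above m e"
    and cyc: "\<forall>K. int p dvd bd (\<lambda>K. c K + op u e K) K"
  define z where "z K = c K + op u e K" for K
  have sz: "supported CX z"
    using supp_YX[OF c(1)] supp_op[OF e(1)] unfolding z_def supported_def by simp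
  have az: "above m z" using c(2) above_op[OF e(2)] unfolding z_def above_def by simp
  obtain b where b: "supported CX b" "above (Suc m) b" "\<And>K. int p dvd z K - bd b K"
    using cycle_above[OF sz az] cyc unfolding z_def by blast
  have 1: "int p dvd op v z K" for K
  proof -
    have "op v z K = op v c K + op v (op u e) K"
      unfolding z_def by (simp add: orbit_op_def ring_distribs sum.distrib)
    then show ?thesis using op_supp_Y[OF c(1) uv(2)] comp by simp
  qed
  have "int p dvd bd (\<lambda>K. 0 + op v b K) K" for K
  proof -
    have "int p dvd op v z K - op v (bd b) K" by (rule orbit_op_dvd[OF b(3)])
    with 1[of K] have "int p dvd op v (bd b) K" by (simp add: dvd_diff_right_iff)
    then show ?thesis by (simp add: bd_op)
  qed
  moreover have "supported CY (\<lambda>K. 0)" "above (Suc m) (\<lambda>K. 0)"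
    by (simp_all add: supported_def above_def)
  ultimately obtain a where a: "supported CX a" "\<And>K. int p dvd op v b K - op v (bd a) K"
    using IH b(1,2) unfolding splits_def by meson
  have "supported CX (\<lambda>K. b K - bd a K)"
    using b(1) supp_bd(1)[OF a(1)] by (simp add: supported_def)
  moreover have "int p dvd op v (\<lambda>K. b K - bd a K) K" for K
    using a(2) by (simp add: orbit_op_diff)
  ultimately obtain y w where yw: "supported CY y" "supported CX w"
      "\<And>K. int p dvd b K - bd a K - (y K + op u w K)"
    using ker[of "\<lambda>K. b K - bd a K"] by meson
  have 2: "int p dvd c K + op u e K - (bd y K + op u (bd w) K)" for K
  proof -
    have "int p dvd bd (\<lambda>K. b K - bd a K) K - bd (\<lambda>K. y K + op u w K) K"
      by (rule boundary_dvd[OF yw(3)])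
    then have "int p dvd bd b K - (bd y K + op u (bd w) K)"
      by (simp add: boundary_diff boundary_add bd_op boundary_boundary[OF finU supp_XU[OF a(1)]])
    from dvd_add[OF b(3)[of K] this] show ?thesis by (simp add: z_def algebra_simps)
  qed
  \<comment> \<open>The two summands separate: on \<open>CY\<close> all values of
    \<open>op u\<close> are 0 modulo p, and off \<open>CY\<close> both c and the boundary of y are
    0.\<close>
  have 3: "int p dvd c K - bd y K" for K
  proof (cases "K \<in> CY")
    case True
    have "int p dvd op u e K - op u (bd w) K"
      using uv(1) by (simp add: op_fixed[OF True] flip: right_diff_distrib)
    from dvd_diff[OF 2[of K] this] show ?thesis by simp
  next
    case False
    then show ?thesis using c(1) supp_bd(2)[OF yw(1)] by (simp add: supported_def)
  qed
  have "int p dvd op u e K - op u (bd w) K" for K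
    using dvd_diff[OF 2[of K] 3[of K]] by simp
  with 3 yw show "\<exists>y w. supported CY y \<and> supported CX w \<and> (\<forall>K. int p dvd c K - bd y K) \<and>
         (\<forall>K. int p dvd op u e K - op u (bd w) K)" by blast
qed

lemma splits_top: "splits u (Suc (card U))"
  unfolding splits_def
proof (intro allI impI, elim conjE)
  fix c e assume "supported CY c" "above (Suc (card U)) c" "supported CX e" "above (Suc (card U)) e"
  then have "c K = 0" "e K = 0" for K
  proof -
    have small: "card K < Suc (card U)" if "K \<in> CX"
      using that XU card_mono[OF finU, of K] by (force simp: order_chains_def)
    show "c K = 0" using \<open>supported CY c\<close> \<open>above (Suc (card U)) c\<close> small CY_CX
      unfolding supported_def above_def by (cases "K \<in> CX") auto
    show "e K = 0" using \<open>supported CX e\<close> \<open>above (Suc (card U)) e\<close> small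
      unfolding supported_def above_def by (cases "K \<in> CX") auto
  qed
  then show "\<exists>y w. supported CY y \<and> supported CX w \<and> (\<forall>K. int p dvd c K - bd y K) \<and>
         (\<forall>K. int p dvd op u e K - op u (bd w) K)"
    by (intro exI[of _ "\<lambda>K. 0"]) (simp add: supported_def boundary_def orbit_op_def)
qed

abbreviation norm_w :: "nat \<Rightarrow> int" where "norm_w \<equiv> \<lambda>i. 1"
definition diff_w :: "nat \<Rightarrow> int" where "diff_w i = (if i = 0 then 1 else if i = 1 then - 1 else 0)"

lemma p2: "p \<ge> 2" using p prime_ge_2_nat by blast

lemma op_diff_w: "op diff_w c K = c K - c (g ` K)"
proof -
  have "op diff_w c K = (\<Sum>i\<in>{0,1}. diff_w i * c ((g ^^ i) ` K))"
    unfolding orbit_op_def by (rule sum.mono_neutral_right) (use p2 in \<open>auto simp: diff_w_def\<close>)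
  then show ?thesis by (simp add: diff_w_def)
qed

lemma sum_diff_w: "(\<Sum>i<p. diff_w i) = 0"
proof -
  have "(\<Sum>i<p. diff_w i) = (\<Sum>i\<in>{0,1}. diff_w i)"
    by (rule sum.mono_neutral_right) (use p2 in \<open>auto simp: diff_w_def\<close>)
  then show ?thesis by (simp add: diff_w_def)
qed

lemma pow_p: "(g ^^ p) ` K = K"
  using per by simp

lemma op_norm_shift: "op norm_w c (g ` K) = op norm_w c K"
proof -
  have "op norm_w c (g ` K) = (\<Sum>i<p. c ((g ^^ Suc i) ` K))"
    unfolding orbit_op_def by (simp add: image_comp funpow_swap1 comp_def)
  also have "\<dots> = (\<Sum>i<Suc p. c ((g ^^ i) ` K)) - c K"
    by (subst sum.lessThan_Suc_shift) simp
  also have "\<dots> = (\<Sum>i<p. c ((g ^^ i) ` K))" using pow_p by simp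
  finally show ?thesis by (simp add: orbit_op_def)
qed

lemma comp_diff_norm: "op diff_w (op norm_w e) K = 0"
  by (simp add: op_diff_w op_norm_shift)

lemma comp_norm_diff: "op norm_w (op diff_w e) K = 0"
proof -
  have "op norm_w (op diff_w e) K = op norm_w e K - op norm_w (\<lambda>K. e (g ` K)) K"
    unfolding op_diff_w by (rule orbit_op_diff)
  also have "op norm_w (\<lambda>K. e (g ` K)) K = op norm_w e (g ` K)"
    unfolding orbit_op_def by (simp add: image_comp funpow_swap1 comp_def)
  finally show ?thesis by (simp add: op_norm_shift)
qed

text \<open>Modulo p the chain b is constant along orbits, so on a non-fixed orbit it is the orbit
  sum of its value at the representative.\<close>

lemma ker_diff:
  assumes b: "supported CX b" "\<And>K. int p dvd op diff_w b K"
  shows "\<exists>y w. supported CY y \<and> supported CX w \<and> (\<forall>K. int p dvd b K - (y K + op norm_w w K))"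
proof -
  have per': "((`) g ^^ p) K = K" for K using pow_p by (simp add: image_funpow)
  obtain \<iota> :: "'a set \<Rightarrow> nat" where \<iota>: "\<And>K. g ` K \<noteq> K \<Longrightarrow> \<iota> K < p"
    "\<And>K j. g ` K \<noteq> K \<Longrightarrow> j < p \<Longrightarrow> \<iota> ((g ^^ j) ` K) = 0 \<longleftrightarrow> j = \<iota> K"
    using prime_order_orbit_index[OF p per'] unfolding image_funpow by metis
  define y where "y K = (if g ` K = K then b K else 0)" for K
  define w where "w K = (if g ` K \<noteq> K \<and> \<iota> K = 0 then b K else 0)" for K
  have bi: "int p dvd b K - b ((g ^^ i) ` K)" for i K
  proof (induction i)
    case (Suc i)
    have "int p dvd b ((g ^^ i) ` K) - b (g ` (g ^^ i) ` K)"
      using b(2)[of "(g ^^ i) ` K"] by (simp add: op_diff_w)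
    from dvd_add[OF Suc this] show ?case by (simp add: image_comp comp_def)
  qed simp
  have inj: "g ` (g ^^ i) ` K = (g ^^ i) ` K \<longleftrightarrow> g ` K = K" for i K
  proof -
    have "g ` (g ^^ i) ` K = (g ^^ i) ` g ` K" by (simp add: image_comp comp_def funpow_swap1)
    then show ?thesis using order_aut_inj[OF order_aut_funpow[OF aut]] by (simp add: inj_image_eq_iff)
  qed
  have "int p dvd b K - (y K + op norm_w w K)" for K
  proof (cases "g ` K = K")
    case True
    then have "op norm_w w K = 0" unfolding orbit_op_def w_def by (simp only: inj) simp
    with True show ?thesis by (simp add: y_def)
  next
    case False
    have "op norm_w w K = (\<Sum>i<p. if i = \<iota> K then b ((g ^^ \<iota> K) ` K) else 0)"
      unfolding orbit_op_def
      by (rule sum.cong) (use False \<iota>(2)[OF False] in \<open>auto simp: w_def inj\<close>)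
    also have "\<dots> = b ((g ^^ \<iota> K) ` K)" using \<iota>(1)[OF False] by simp
    finally show ?thesis using bi[of K "\<iota> K"] False by (simp add: y_def)
  qed
  moreover have "supported CY y" "supported CX w"
    using b(1) by (auto simp: supported_def y_def w_def CY_iff)
  ultimately show ?thesis by blast
qed

text \<open>An additive form of Hilbert 90: w is the partial sum of b along the path from K to the
  representative. It drops by b at each step, and the discrepancy on wrapping around is the orbit
  sum of b, which is 0 modulo p.\<close>

lemma ker_norm:
  assumes b: "supported CX b" "\<And>K. int p dvd op norm_w b K"
  shows "\<exists>y w. supported CY y \<and> supported CX w \<and> (\<forall>K. int p dvd b K - (y K + op diff_w w K))"
proof -
  have per': "((`) g ^^ p) K = K" for K using pow_p by (simp add: image_funpow)
  obtain \<iota> :: "'a set \<Rightarrow> nat" where \<iota>: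
    "\<And>K. g ` K \<noteq> K \<Longrightarrow> \<iota> (g ` K) = (if \<iota> K = 0 then p - 1 else \<iota> K - 1)"
    using prime_order_orbit_index[OF p per'] by metis
  define y where "y K = (if g ` K = K then b K else 0)" for K
  define w where "w K = (if g ` K = K then 0 else \<Sum>j<\<iota> K. b ((g ^^ j) ` K))" for K
  have inj: "g ` g ` K = g ` K \<longleftrightarrow> g ` K = K" for K
    using order_aut_inj[OF aut] by (simp add: inj_image_eq_iff)
  have shift: "(\<Sum>j<n. b ((g ^^ j) ` g ` K)) = (\<Sum>j<Suc n. b ((g ^^ j) ` K)) - b K" for n K
    by (subst sum.lessThan_Suc_shift) (simp add: image_comp funpow_swap1 comp_def)
  have "int p dvd b K - (y K + op diff_w w K)" for K
  proof (cases "g ` K = K")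
    case True
    then show ?thesis by (simp add: y_def op_diff_w)
  next
    case False
    show ?thesis
    proof (cases "\<iota> K = 0")
      case True
      have "w (g ` K) = op norm_w b K - b K"
        using False True \<iota>[OF False] p2 unfolding w_def inj by (simp add: shift orbit_op_def del: sum.lessThan_Suc)
      moreover have "w K = 0" using True by (simp add: w_def)
      ultimately have "b K - (y K + op diff_w w K) = op norm_w b K"
        using False by (simp add: y_def op_diff_w)
      then show ?thesis using b(2) by simp
    next
      case nz: False
      have "w (g ` K) = w K - b K"
        using False nz \<iota>[OF False] unfolding w_def inj by (simp add: shift del: sum.lessThan_Suc)
      then show ?thesis using False by (simp add: y_def op_diff_w)
    qed
  qed
  moreover have "supported CY y" "supported CX w"
    using b(1) by (auto simp: supported_def y_def w_def CY_iff CX_pow)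
  ultimately show ?thesis by blast
qed

lemma splits_all: "splits norm_w m \<and> splits diff_w m" if "m \<le> Suc (card U)"
  using that
proof (induction m rule: inc_induct)
  case base
  show ?case by (simp add: splits_top)
next
  case (step m)
  have "splits norm_w m"
    by (rule splits_step[of norm_w diff_w]) (use step ker_diff sum_diff_w comp_diff_norm in auto)
  moreover have "splits diff_w m"
    by (rule splits_step[of diff_w norm_w]) (use step ker_norm sum_diff_w comp_norm_diff in auto)
  ultimately show ?case by simp
qed

lemma acyclic_fixed: "acyclic_mod U (int p) CY"
  unfolding acyclic_mod_def
proof (intro allI impI)
  fix c assume c: "supported CY c" "\<forall>K. int p dvd bd c K"
  have "splits norm_w 0" using splits_all by blast
  moreover have "supported CX (\<lambda>K. 0)" "op norm_w (\<lambda>K. 0) = (\<lambda>K. 0)" "above 0 c" "above 0 (\<lambda>K. 0)"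
    by (simp_all add: supported_def orbit_op_def fun_eq_iff above_def)
  ultimately show "\<exists>b. supported CY b \<and> (\<forall>K. int p dvd c K - bd b K)"
    using c unfolding splits_def by (metis (no_types, lifting) add.right_neutral ext)
qed

end

lemma acyclic_mod_fixed_points:
  assumes "finite U" "X \<subseteq> U" "order_aut g" "g ` U = U" "g ` X = X"
    "\<And>F. (g ^^ p) F = F" "prime p" "acyclic_mod U (int p) (order_chains X)"
  shows "acyclic_mod U (int p) (order_chains {F\<in>X. g F = F})"
proof -
  interpret smith U X g p by standard (use assms in auto)
  show ?thesis using acyclic_fixed by (simp add: Y_def)
qed

subsection \<open>The Lefschetz number of an automorphism\<close>

definition mat_mul :: "'b set \<Rightarrow> ('b \<Rightarrow> 'b \<Rightarrow> int) \<Rightarrow> ('b \<Rightarrow> 'b \<Rightarrow> int) \<Rightarrow> 'b \<Rightarrow> 'b \<Rightarrow> int" where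
  "mat_mul S A B K L = (\<Sum>J\<in>S. A K J * B J L)"

lemma mat_mul_assoc: "mat_mul S (mat_mul S A B) C = mat_mul S A (mat_mul S B C)"
proof (intro ext)
  fix K L
  have "mat_mul S (mat_mul S A B) C K L = (\<Sum>J\<in>S. \<Sum>I\<in>S. A K I * B I J * C J L)"
    by (simp add: mat_mul_def sum_distrib_right)
  also have "\<dots> = (\<Sum>I\<in>S. \<Sum>J\<in>S. A K I * B I J * C J L)" by (rule sum.swap)
  finally show "mat_mul S (mat_mul S A B) C K L = mat_mul S A (mat_mul S B C) K L"
    by (simp add: mat_mul_def sum_distrib_left mult.assoc)
qed

lemma mat_mul_add_right:
  "mat_mul S A (\<lambda>K L. B K L + C K L) = (\<lambda>K L. mat_mul S A B K L + mat_mul S A C K L)"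
  by (simp add: mat_mul_def fun_eq_iff ring_distribs sum.distrib)

lemma mat_mul_add_left:
  "mat_mul S (\<lambda>K L. B K L + C K L) A = (\<lambda>K L. mat_mul S B A K L + mat_mul S C A K L)"
  by (simp add: mat_mul_def fun_eq_iff ring_distribs sum.distrib)

lemma mat_mul_cong_on:
  assumes "\<And>K L. K \<in> S \<Longrightarrow> L \<in> S \<Longrightarrow> A K L = A' K L" "\<And>K L. K \<in> S \<Longrightarrow> L \<in> S \<Longrightarrow> B K L = B' K L"
    "K \<in> S" "L \<in> S"
  shows "mat_mul S A B K L = mat_mul S A' B' K L"
  unfolding mat_mul_def by (rule sum.cong) (use assms in auto)

definition super_trace :: "'b set \<Rightarrow> ('b \<Rightarrow> int) \<Rightarrow> ('b \<Rightarrow> 'b \<Rightarrow> int) \<Rightarrow> int" where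
  "super_trace S s A = (\<Sum>K\<in>S. s K * A K K)"

text \<open>D is odd with respect to the sign s, so moving D around the trace of a product changes
  the sign.\<close>

lemma super_trace_anticommutator:
  assumes "\<And>K L. K \<in> S \<Longrightarrow> L \<in> S \<Longrightarrow> D K L \<noteq> 0 \<Longrightarrow> s K = - s L"
  shows "super_trace S s (\<lambda>K L. mat_mul S D M K L + mat_mul S M D K L) = 0"
proof -
  have "super_trace S s (mat_mul S M D) = (\<Sum>K\<in>S. \<Sum>J\<in>S. s K * (M K J * D J K))"
    by (simp add: super_trace_def mat_mul_def sum_distrib_left)
  also have "\<dots> = (\<Sum>J\<in>S. \<Sum>K\<in>S. s K * (M K J * D J K))" by (rule sum.swap)
  also have "\<dots> = (\<Sum>J\<in>S. \<Sum>K\<in>S. - (s J * (D J K * M K J)))"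
    by (intro sum.cong refl) (use assms in fastforce)
  also have "\<dots> = - super_trace S s (mat_mul S D M)"
    by (simp add: super_trace_def mat_mul_def sum_distrib_left sum_negf)
  finally show ?thesis
    by (simp add: super_trace_def ring_distribs sum.distrib)
qed

text \<open>
  A contraction \<open>H\<close> of \<open>D\<close> modulo \<open>p\<close> makes every super trace of a matrix commuting with \<open>D\<close>
  divisible by \<open>p\<close>, with a quotient of the same form; so it is divisible by all powers of \<open>p\<close>.
\<close>

lemma super_trace_eq_0:
  fixes p :: nat
  assumes p: "p > 1" and S: "finite S"
    and sgn: "\<And>K L. K \<in> S \<Longrightarrow> L \<in> S \<Longrightarrow> D K L \<noteq> 0 \<Longrightarrow> s K = - s L"
    and DD: "\<And>K L. K \<in> S \<Longrightarrow> L \<in> S \<Longrightarrow> mat_mul S D D K L = 0"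
    and DG: "\<And>K L. K \<in> S \<Longrightarrow> L \<in> S \<Longrightarrow> mat_mul S D G K L = mat_mul S G D K L"
    and H: "\<And>K L. K \<in> S \<Longrightarrow> L \<in> S \<Longrightarrow>
        int p dvd mat_mul S D H K L + mat_mul S H D K L - (if K = L then 1 else 0)"
  shows "super_trace S s G = 0"
proof -
  let ?m = "mat_mul S"
  define T where "T K L = ?m D H K L + ?m H D K L" for K L
  \<comment> \<open>The contraction is exact only modulo p; E is the integer error matrix with T = 1
    + p E on S.\<close>
  define E where "E K L = (T K L - (if K = L then 1 else 0)) div int p" for K L
  have T: "T K L = (if K = L then 1 else 0) + int p * E K L" if "K \<in> S" "L \<in> S" for K L
    using H[OF that] unfolding E_def T_def by simp
  have one_r: "?m A (\<lambda>K L. if K = L then 1 else 0) K L = A K L" if "L \<in> S" for A K L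
    using that S by (simp add: mat_mul_def if_distrib[of "\<lambda>x. _ * x"] cong: if_cong)
  have one_l: "?m (\<lambda>K L. if K = L then 1 else 0) A K L = A K L" if "K \<in> S" for A K L
    using that S by (simp add: mat_mul_def if_distrib[of "\<lambda>x. x * _"] cong: if_cong)
  have AT: "?m A T K L = A K L + int p * ?m A E K L" if "K \<in> S" "L \<in> S" for A K L
  proof -
    have "?m A T K L = ?m A (\<lambda>K L. (if K = L then 1 else 0) + int p * E K L) K L"
      by (rule mat_mul_cong_on) (use T that in auto)
    also have "\<dots> = A K L + ?m A (\<lambda>K L. int p * E K L) K L"
      by (simp add: mat_mul_add_right one_r[OF that(2)])
    also have "?m A (\<lambda>K L. int p * E K L) K L = int p * ?m A E K L"
      by (simp add: mat_mul_def sum_distrib_left mult.left_commute)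
    finally show ?thesis .
  qed
  have TA: "?m T A K L = A K L + int p * ?m E A K L" if "K \<in> S" "L \<in> S" for A K L
  proof -
    have "?m T A K L = ?m (\<lambda>K L. (if K = L then 1 else 0) + int p * E K L) A K L"
      by (rule mat_mul_cong_on) (use T that in auto)
    also have "\<dots> = A K L + ?m (\<lambda>K L. int p * E K L) A K L"
      by (simp add: mat_mul_add_left one_l[OF that(1)])
    also have "?m (\<lambda>K L. int p * E K L) A K L = int p * ?m E A K L"
      by (simp add: mat_mul_def sum_distrib_left mult.assoc)
    finally show ?thesis .
  qed
  have zero_l: "?m Z A K L = 0" if "\<And>K L. K \<in> S \<Longrightarrow> L \<in> S \<Longrightarrow> Z K L = 0" "K \<in> S" for Z A K L
    using that by (simp add: mat_mul_def)
  have zero_r: "?m A Z K L = 0" if "\<And>K L. K \<in> S \<Longrightarrow> L \<in> S \<Longrightarrow> Z K L = 0" "L \<in> S" for Z A K L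
    using that by (simp add: mat_mul_def)
  have Tdef: "T = (\<lambda>K L. ?m D H K L + ?m H D K L)" by (simp add: T_def fun_eq_iff)
  \<comment> \<open>Since D D = 0, both sides equal D H D. Cancelling p then shows that E commutes
    with D.\<close>
  have TD: "?m T D K L = ?m D T K L" if KL: "K \<in> S" "L \<in> S" for K L
  proof -
    have "?m T D K L = ?m D (?m H D) K L + ?m H (?m D D) K L"
      unfolding Tdef mat_mul_add_left by (simp add: mat_mul_assoc)
    also have "?m H (?m D D) K L = 0" by (rule zero_r) (use DD KL in auto)
    also have "?m D (?m H D) K L + 0
        = ?m D (?m H D) K L + ?m (?m D D) H K L"
      by (simp add: zero_l DD KL)
    also have "\<dots> = ?m D T K L"
      unfolding Tdef mat_mul_add_right by (simp add: mat_mul_assoc)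
    finally show ?thesis .
  qed
  have ED: "?m D E K L = ?m E D K L" if "K \<in> S" "L \<in> S" for K L
  proof -
    have "int p * ?m D E K L = int p * ?m E D K L"
      using TA[OF that, of D] AT[OF that, of D] TD[OF that] by simp
    then show ?thesis using p by simp
  qed
  \<comment> \<open>A T is the anticommutator of D with A H and has super trace 0. With T = 1 + p E
    this replaces A by A E at the price of a factor -p, and A E again commutes with D.\<close>
  have step: "super_trace S s A = - int p * super_trace S s (?m A E)
      \<and> (\<forall>K\<in>S. \<forall>L\<in>S. ?m D (?m A E) K L = ?m (?m A E) D K L)"
    if A: "\<And>K L. K \<in> S \<Longrightarrow> L \<in> S \<Longrightarrow> ?m D A K L = ?m A D K L" for A
  proof (intro conjI ballI)
    define M where "M = ?m A H"
    have "?m A T K L = ?m D M K L + ?m M D K L" if KL: "K \<in> S" "L \<in> S" for K L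
    proof -
      have "?m A T K L = ?m (?m A D) H K L + ?m M D K L"
        unfolding Tdef M_def mat_mul_add_right by (simp add: mat_mul_assoc)
      also have "?m (?m A D) H K L = ?m (?m D A) H K L"
        by (rule mat_mul_cong_on) (use A KL in auto)
      finally show ?thesis by (simp add: mat_mul_assoc M_def)
    qed
    then have "super_trace S s (?m A T) = super_trace S s (\<lambda>K L. ?m D M K L + ?m M D K L)"
      unfolding super_trace_def by (intro sum.cong) auto
    also have "\<dots> = 0" by (rule super_trace_anticommutator) (use sgn in auto)
    finally have "super_trace S s (?m A T) = 0" .
    moreover have "super_trace S s (?m A T) = super_trace S s A + int p * super_trace S s (?m A E)"
      unfolding super_trace_def by (simp add: AT sum.distrib ring_distribs sum_distrib_left mult.left_commute)
    ultimately show "super_trace S s A = - int p * super_trace S s (?m A E)" by simp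
  next
    fix K L assume KL: "K \<in> S" "L \<in> S"
    have "?m D (?m A E) K L = ?m (?m D A) E K L"
      by (simp add: mat_mul_assoc)
    also have "\<dots> = ?m (?m A D) E K L" by (rule mat_mul_cong_on) (use A KL in auto)
    also have "\<dots> = ?m A (?m D E) K L" by (simp add: mat_mul_assoc)
    also have "\<dots> = ?m A (?m E D) K L" by (rule mat_mul_cong_on) (use ED KL in auto)
    finally show "?m D (?m A E) K L = ?m (?m A E) D K L"
      by (simp add: mat_mul_assoc)
  qed
  have "int p ^ N dvd super_trace S s A"
    if "\<forall>K\<in>S. \<forall>L\<in>S. ?m D A K L = ?m A D K L" for N A
    using that
  proof (induction N arbitrary: A)
    case (Suc N)
    from step[of A] Suc have "super_trace S s A = - int p * super_trace S s (?m A E)"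
      "int p ^ N dvd super_trace S s (?m A E)" by auto
    then show ?case by simp
  qed simp
  then have all: "int p ^ N dvd super_trace S s G" for N using DG by auto
  show ?thesis
  proof (rule ccontr)
    assume nz: "super_trace S s G \<noteq> 0"
    \<comment> \<open>With t the absolute value, p^t exceeds t, so a nonzero integer cannot be
      divisible by this power.\<close>
    define t where "t = nat \<bar>super_trace S s G\<bar>"
    have "t > 0" using nz by (simp add: t_def)
    have "int p ^ t \<le> \<bar>super_trace S s G\<bar>" using dvd_imp_le_int[OF nz all[of t]] by simp
    then have "p ^ t \<le> t" unfolding t_def by (metis nat_int nat_mono of_nat_power)
    moreover have "t < p ^ t" using p by (simp add: power_gt_expt)
    ultimately show False by simp
  qed
qed

section \<open>A chain contraction modulo m and the Lefschetz formula\<close>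

definition basis_chain :: "'b \<Rightarrow> 'b \<Rightarrow> int" where
  "basis_chain K L = (if L = K then 1 else 0)"

lemma supported_expand:
  assumes "finite S" "supported S c"
  shows "c L = (\<Sum>J\<in>S. c J * basis_chain J L)"
proof (cases "L \<in> S")
  case True
  then show ?thesis using assms by (simp add: basis_chain_def if_distrib[of "\<lambda>x. _ * x"] cong: if_cong)
next
  case False
  then show ?thesis using assms by (auto simp: supported_def basis_chain_def intro!: sum.neutral)
qed

lemma boundary_expand:
  assumes "finite S" "supported S c"
  shows "boundary U c L = (\<Sum>J\<in>S. c J * boundary U (basis_chain J) L)"
proof -
  have "c = (\<lambda>L. \<Sum>J\<in>S. c J * basis_chain J L)"
    using supported_expand[OF assms] by (rule ext)
  then have "boundary U c L = boundary U (\<lambda>L. \<Sum>J\<in>S. c J * basis_chain J L) L" by (rule arg_cong)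
  also have "\<dots> = (\<Sum>J\<in>S. c J * boundary U (basis_chain J) L)"
    by (simp only: boundary_sum boundary_cmult)
  finally show ?thesis .
qed

text \<open>The contraction h is built on basis chains by induction on their cardinality: K minus h
  applied to the boundary of K is a cycle modulo m by the induction hypothesis, and any filling of
  it serves as \<open>h K\<close>.\<close>

lemma contraction_exists:
  assumes U: "finite U" "X \<subseteq> U" and acyc: "acyclic_mod U m (order_chains X)"
  shows "\<exists>h. \<forall>K\<in>order_chains X. card K < n \<longrightarrow> supported (order_chains X) (h K) \<and>
     (\<forall>L. m dvd basis_chain K L - boundary U (h K) L
        - (\<Sum>J\<in>order_chains X. boundary U (basis_chain K) J * h J L))"
proof (induction n)
  case (Suc n)
  let ?S = "order_chains X"
  let ?B = "\<lambda>K. boundary U (basis_chain K)"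
  have finS: "finite ?S" using U finite_subset finite_chains by blast
  have finK: "finite K" if "K \<in> ?S" for K using that U finite_subset chains_finite by blast
  obtain h where h: "\<And>K. K \<in> ?S \<Longrightarrow> card K < n \<Longrightarrow> supported ?S (h K)"
    "\<And>K L. K \<in> ?S \<Longrightarrow> card K < n \<Longrightarrow>
      m dvd basis_chain K L - boundary U (h K) L - (\<Sum>J\<in>?S. ?B K J * h J L)"
    using Suc by blast
  have sB: "supported ?S (basis_chain K)" if "K \<in> ?S" for K
    using that by (auto simp: supported_def basis_chain_def)
  have sBd: "supported ?S (?B K)" if "K \<in> ?S" for K
    by (intro boundary_supported sB that) (auto intro: chains_subset)
  have lower: "Suc (card J) = card K" if "K \<in> ?S" "?B K J \<noteq> 0" for K J
  proof -
    from that(2) obtain F where "F \<notin> J" "basis_chain K (insert F J) \<noteq> 0"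
      unfolding boundary_def by (metis (no_types, lifting) DiffE mult_zero_right sum.neutral)
    then have "K = insert F J" "F \<notin> J" by (auto simp: basis_chain_def split: if_splits)
    with finK[OF that(1)] show ?thesis by simp
  qed
  note expand = supported_expand[OF finS] and bd_expand = boundary_expand[OF finS]
  have ex: "\<exists>b. supported ?S b \<and> (\<forall>L. m dvd basis_chain K L - (\<Sum>J\<in>?S. ?B K J * h J L) - boundary U b L)"
    if K: "K \<in> ?S" "card K = n" for K
  proof -
    define z where "z L = basis_chain K L - (\<Sum>J\<in>?S. ?B K J * h J L)" for L
    have lowK: "?B K J = 0 \<or> card J < n" for J using lower[OF K(1), of J] K(2) by (cases "?B K J = 0") auto
    have sz: "supported ?S z"
      unfolding supported_def z_def
    proof (intro allI impI)
      fix L assume L: "L \<notin> ?S"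
      have "(\<Sum>J\<in>?S. ?B K J * h J L) = 0"
        by (rule sum.neutral) (use lowK h(1) L in \<open>auto simp: supported_def\<close>)
      then show "basis_chain K L - (\<Sum>J\<in>?S. ?B K J * h J L) = 0"
        using sB[OF K(1)] L by (simp add: supported_def)
    qed
    have "m dvd boundary U z L" for L
    proof -
      have 1: "boundary U z L = ?B K L - (\<Sum>J\<in>?S. ?B K J * boundary U (h J) L)"
        unfolding z_def boundary_diff by (simp add: boundary_sum boundary_cmult)
      have 2: "?B K L = (\<Sum>J\<in>?S. ?B K J * basis_chain J L)"
        by (rule expand[OF sBd[OF K(1)]])
      have "(\<Sum>J\<in>?S. ?B K J * (\<Sum>I\<in>?S. ?B J I * h I L)) = (\<Sum>J\<in>?S. \<Sum>I\<in>?S. ?B K J * ?B J I * h I L)"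
        by (simp add: sum_distrib_left mult.assoc)
      also have "\<dots> = (\<Sum>I\<in>?S. \<Sum>J\<in>?S. ?B K J * ?B J I * h I L)" by (rule sum.swap)
      also have "\<dots> = (\<Sum>I\<in>?S. boundary U (?B K) I * h I L)"
        by (simp add: bd_expand[OF sBd[OF K(1)]] sum_distrib_right)
      also have "\<dots> = 0"
      proof -
        have "supported (order_chains U) (basis_chain K)"
          using sB[OF K(1)] chains_mono[OF U(2)] unfolding supported_def by blast
        then show ?thesis using boundary_boundary[OF U(1)] by simp
      qed
      finally have 3: "(\<Sum>J\<in>?S. ?B K J * (\<Sum>I\<in>?S. ?B J I * h I L)) = 0" .
      have "boundary U z L = (\<Sum>J\<in>?S. ?B K J * (basis_chain J L - boundary U (h J) L
          - (\<Sum>I\<in>?S. ?B J I * h I L)))"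
        unfolding 1 using 2 3 by (simp add: right_diff_distrib sum_subtractf)
      also have "m dvd \<dots>"
      proof (rule dvd_sum)
        fix J assume J: "J \<in> ?S"
        show "m dvd ?B K J * (basis_chain J L - boundary U (h J) L - (\<Sum>I\<in>?S. ?B J I * h I L))"
          using lowK[of J] h(2)[OF J] by auto
      qed
      finally show ?thesis .
    qed
    from acyclic_modD[OF acyc sz this] show ?thesis unfolding z_def by blast
  qed
  then obtain b where b: "\<And>K. K \<in> ?S \<Longrightarrow> card K = n \<Longrightarrow> supported ?S (b K)"
    "\<And>K L. K \<in> ?S \<Longrightarrow> card K = n \<Longrightarrow> m dvd basis_chain K L - (\<Sum>J\<in>?S. ?B K J * h J L) - boundary U (b K) L"
    by metis
  define h' where "h' K = (if card K = n then b K else h K)" for K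
  \<comment> \<open>The boundary of K involves only sets smaller by one, hence none of those of size
    n on which h is redefined.\<close>
  have same: "(\<Sum>J\<in>?S. ?B K J * h' J L) = (\<Sum>J\<in>?S. ?B K J * h J L)" if "K \<in> ?S" "card K < Suc n" for K L
    by (rule sum.cong) (use lower[OF that(1)] that(2) in \<open>force simp: h'_def\<close>)+
  show ?case
  proof (rule exI[of _ h'], intro ballI impI)
    fix K assume K: "K \<in> ?S" "card K < Suc n"
    show "supported ?S (h' K) \<and> (\<forall>L. m dvd basis_chain K L - boundary U (h' K) L - (\<Sum>J\<in>?S. ?B K J * h' J L))"
    proof (cases "card K = n")
      case True
      have "m dvd basis_chain K L - boundary U (b K) L - (\<Sum>J\<in>?S. ?B K J * h J L)" for L
        using b(2)[OF K(1) True, of L] by (simp add: algebra_simps)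
      then show ?thesis unfolding same[OF K] using b(1)[OF K(1) True] True by (simp add: h'_def)
    next
      case False
      then have "card K < n" using K by simp
      then show ?thesis unfolding same[OF K] using h[OF K(1)] False by (simp add: h'_def)
    qed
  qed
qed simp

text \<open>G is the permutation matrix of g on chains, so its super trace is the signed number of
  invariant chains. The value is 0 over the integers although acyclicity is known modulo p only, and
  g may have any order, including multiples of p.\<close>

lemma lefschetz_fixed_points:
  fixes p :: nat
  assumes U: "finite U" "X \<subseteq> U" and g: "order_aut g" "g ` U = U" "g ` X = X"
    and p: "p > 1" and acyc: "acyclic_mod U (int p) (order_chains X)"
  shows "(\<Sum>K\<in>order_chains {F\<in>X. g F = F}. (-1) ^ card K) = (0::int)"
proof -
  let ?S = "order_chains X"
  have finX: "finite X" using U finite_subset by blast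
  have finS: "finite ?S" using finX finite_chains by blast
  have finK: "finite K" if "K \<in> ?S" for K using that finX chains_finite by blast
  have cardK: "card K \<le> card X" if "K \<in> ?S" for K
    using that finX by (auto simp: order_chains_def intro: card_mono)
  obtain h where h: "\<And>K. K \<in> ?S \<Longrightarrow> supported ?S (h K)"
    "\<And>K L. K \<in> ?S \<Longrightarrow> int p dvd basis_chain K L - boundary U (h K) L
        - (\<Sum>J\<in>?S. boundary U (basis_chain K) J * h J L)"
    using contraction_exists[OF U acyc, of "Suc (card X)"] cardK by (metis le_imp_less_Suc)
  define D where "D K L = boundary U (basis_chain L) K" for K L
  define H where "H K L = h L K" for K L
  define G where "G K L = basis_chain L (g ` K)" for K L
  have sB: "supported ?S (basis_chain K)" if "K \<in> ?S" for K
    using that by (auto simp: supported_def basis_chain_def)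
  have bd_expand: "boundary U c K = (\<Sum>J\<in>?S. D K J * c J)" if "supported ?S c" for c K
    unfolding D_def by (simp add: boundary_expand[OF finS that, of U K] mult.commute)
  have "super_trace ?S (\<lambda>K. (-1) ^ card K) G = 0"
  proof (rule super_trace_eq_0[OF p finS, of D _ G H])
    fix K L assume KL: "K \<in> ?S" "L \<in> ?S"
    show "(-1) ^ card K = - ((-1) ^ card L :: int)" if "D K L \<noteq> 0"
    proof -
      from that obtain F where "F \<notin> K" "basis_chain L (insert F K) \<noteq> 0"
        unfolding boundary_def D_def by (metis (no_types, lifting) DiffE mult_zero_right sum.neutral)
      then have "L = insert F K" "F \<notin> K" by (auto simp: basis_chain_def split: if_splits)
      with finK[OF KL(1)] show ?thesis by simp
    qed
    have sD: "supported ?S (\<lambda>J. D J L)"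
      unfolding D_def by (intro boundary_supported sB KL) (auto intro: chains_subset)
    show "mat_mul ?S D D K L = 0"
    proof -
      have "mat_mul ?S D D K L = boundary U (\<lambda>J. D J L) K"
        by (simp add: mat_mul_def bd_expand[OF sD])
      also have "\<dots> = 0" unfolding D_def
        by (rule boundary_boundary[OF U(1)])
          (use sB[OF KL(2)] chains_mono[OF U(2)] in \<open>auto simp: supported_def\<close>)
      finally show ?thesis .
    qed
    show "mat_mul ?S D G K L = mat_mul ?S G D K L"
    proof -
      have sG: "supported ?S (\<lambda>J. G J L)"
        using sB[OF KL(2)] order_chains_image[OF g(1,3)] by (simp add: G_def supported_def)
      have "mat_mul ?S D G K L = boundary U (\<lambda>J. G J L) K"
        by (simp add: mat_mul_def bd_expand[OF sG])
      also have "\<dots> = boundary U (basis_chain L) (g ` K)"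
        unfolding G_def by (rule boundary_image[OF g(1,2)])
      also have "\<dots> = (\<Sum>J\<in>?S. G K J * D J L)"
      proof -
        have "g ` K \<in> ?S" using KL order_chains_image[OF g(1,3)] by simp
        then show ?thesis using finS
          by (simp add: G_def basis_chain_def D_def if_distrib[of "\<lambda>x. x * _"] cong: if_cong)
      qed
      finally show ?thesis by (simp add: mat_mul_def)
    qed
    show "int p dvd mat_mul ?S D H K L + mat_mul ?S H D K L - (if K = L then 1 else 0)"
    proof -
      have "mat_mul ?S D H K L = boundary U (h L) K"
        by (simp add: mat_mul_def H_def bd_expand[OF h(1)[OF KL(2)]])
      moreover have "mat_mul ?S H D K L = (\<Sum>J\<in>?S. boundary U (basis_chain L) J * h J K)"
        by (simp add: mat_mul_def H_def D_def mult.commute)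
      ultimately have "mat_mul ?S D H K L + mat_mul ?S H D K L - (if K = L then 1 else 0) =
          - (basis_chain L K - boundary U (h L) K - (\<Sum>J\<in>?S. boundary U (basis_chain L) J * h J K))"
        by (simp add: basis_chain_def)
      then show ?thesis using h(2)[OF KL(2), of K] by (simp only: dvd_minus_iff)
    qed
  qed
  also have "super_trace ?S (\<lambda>K. (-1) ^ card K) G = (\<Sum>K\<in>{K\<in>?S. g ` K = K}. (-1) ^ card K)"
    unfolding super_trace_def using finS
    by (simp add: G_def basis_chain_def if_distrib[of "\<lambda>x. _ * x"] sum.inter_filter cong: if_cong)
  finally show ?thesis by (simp add: order_chains_fixed[OF g(1) finX])
qed

subsection \<open>Oliver's fixed point theorem\<close>

text \<open>The generators are treated one at a time; by commutativity the common fixed set of those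
  already treated is invariant under the next one.\<close>

lemma acyclic_mod_fixed_points_list:
  assumes X: "finite X" "acyclic_mod X (int p) (order_chains X)" and p: "prime p"
    and gs: "\<And>g. g \<in> set gs \<Longrightarrow> order_aut g \<and> g ` X = X \<and> (\<forall>F. (g ^^ p) F = F)"
    and comm: "\<And>g h F. g \<in> set gs \<Longrightarrow> h \<in> set gs \<Longrightarrow> g (h F) = h (g F)"
  shows "acyclic_mod X (int p) (order_chains {F\<in>X. \<forall>g\<in>set gs. g F = F})"
  using gs comm
proof (induction gs)
  case Nil
  then show ?case using X by simp
next
  case (Cons g gs)
  let ?Y = "{F\<in>X. \<forall>h\<in>set gs. h F = F}"
  have g: "order_aut g" "g ` X = X" "\<And>F. (g ^^ p) F = F" using Cons.prems(1)[of g] by auto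
  have comm: "h (g F) = g (h F)" if "h \<in> set gs" for h F using Cons.prems(2) that by auto
  have "g ` ?Y = ?Y"
  proof (intro equalityI subsetI)
    fix F assume "F \<in> g ` ?Y"
    then obtain G where G: "G \<in> ?Y" "F = g G" by blast
    have "h F = F" if "h \<in> set gs" for h
    proof -
      have "h G = G" using G(1) that by blast
      then show ?thesis using comm[OF that, of G] by (simp add: G(2))
    qed
    then show "F \<in> ?Y" using G g(2) by auto
  next
    fix F assume F: "F \<in> ?Y"
    then obtain G where G: "G \<in> X" "F = g G" using g(2) by auto
    have "h G = G" if "h \<in> set gs" for h
    proof -
      have "h (g G) = g G" using F G(2) that by blast
      then have "g (h G) = g G" by (simp only: comm[OF that])
      then show ?thesis using order_aut_inj[OF g(1)] by (simp add: inj_eq)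
    qed
    with G show "F \<in> g ` ?Y" by auto
  qed
  then have "acyclic_mod X (int p) (order_chains {F\<in>?Y. g F = F})"
    by (intro acyclic_mod_fixed_points) (use X p g Cons in auto)
  moreover have "{F\<in>?Y. g F = F} = {F\<in>X. \<forall>h\<in>set (g # gs). h F = F}" by auto
  ultimately show ?case by simp
qed

text \<open>Normality in the group series enters as invariance of the successive fixed point sets.
  The sums over chains include the empty chain and are thus, up to sign, reduced Euler
  characteristics.\<close>

lemma oliver_fixed_point:
  fixes p q :: nat and \<tau> \<mu> :: "'a::order \<Rightarrow> 'a"
  assumes X: "finite X" "acyclic_mod X (int p) (order_chains X)" and p: "prime p" and q: "prime q"
    and gs: "\<And>g. g \<in> set gs \<Longrightarrow> order_aut g \<and> g ` X = X \<and> (\<forall>F. (g ^^ p) F = F)"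
    and comm: "\<And>g h F. g \<in> set gs \<Longrightarrow> h \<in> set gs \<Longrightarrow> g (h F) = h (g F)"
    and \<tau>: "order_aut \<tau>" "\<tau> ` X = X"
      "\<tau> ` {F\<in>X. \<forall>g\<in>set gs. g F = F} = {F\<in>X. \<forall>g\<in>set gs. g F = F}"
    and \<mu>: "order_aut \<mu>" "\<And>F. (\<mu> ^^ q) F = F"
      "\<mu> ` {F\<in>X. (\<forall>g\<in>set gs. g F = F) \<and> \<tau> F = F} = {F\<in>X. (\<forall>g\<in>set gs. g F = F) \<and> \<tau> F = F}"
  shows "\<exists>F\<in>X. (\<forall>g\<in>set gs. g F = F) \<and> \<tau> F = F \<and> \<mu> F = F"
proof -
  let ?P = "{F\<in>X. \<forall>g\<in>set gs. g F = F}"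
  let ?Y = "{F\<in>X. (\<forall>g\<in>set gs. g F = F) \<and> \<tau> F = F}"
  have "acyclic_mod X (int p) (order_chains ?P)"
    by (rule acyclic_mod_fixed_points_list) (use assms in auto)
  then have "(\<Sum>K\<in>order_chains {F\<in>?P. \<tau> F = F}. (-1) ^ card K) = (0::int)"
    by (intro lefschetz_fixed_points[of X _ _ p]) (use X \<tau> p prime_gt_1_nat in auto)
  moreover have "{F\<in>?P. \<tau> F = F} = ?Y" by auto
  ultimately have 0: "(\<Sum>K\<in>order_chains ?Y. (-1) ^ card K) = (0::int)" by simp
  have fin: "finite ?Y" using X by simp
  have img: "(`) \<mu> ` order_chains ?Y = order_chains ?Y"
  proof (intro equalityI subsetI)
    fix K assume "K \<in> (`) \<mu> ` order_chains ?Y"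
    then show "K \<in> order_chains ?Y" using order_chains_image[OF \<mu>(1,3)] by auto
  next
    fix K assume K: "K \<in> order_chains ?Y"
    then have "K \<subseteq> \<mu> ` ?Y" unfolding \<mu>(3) by (simp add: order_chains_def)
    then obtain L where L: "K = \<mu> ` L" by (auto simp: subset_image_iff)
    then show "K \<in> (`) \<mu> ` order_chains ?Y" using K order_chains_image[OF \<mu>(1,3), of L] by auto
  qed
  have "[(\<Sum>K\<in>order_chains ?Y. (-1) ^ card K) =
      (\<Sum>K\<in>{K\<in>order_chains ?Y. \<mu> ` K = K}. (-1::int) ^ card K)] (mod int q)"
  proof (rule sum_prime_order_cong[OF q])
    show "((`) \<mu> ^^ q) K = K" for K using \<mu>(2) by (simp add: image_funpow)
    show "(- 1::int) ^ card (\<mu> ` K) = (- 1) ^ card K" for K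
      using order_aut_inj[OF \<mu>(1)] by (simp add: card_image inj_on_subset[of _ UNIV])
  qed (use fin img in \<open>auto intro: finite_chains\<close>)
  from cong_sym[OF this] have 1: "int q dvd (\<Sum>K\<in>order_chains {F\<in>?Y. \<mu> F = F}. (-1::int) ^ card K)"
    unfolding 0 order_chains_fixed[OF \<mu>(1) fin] by (simp only: cong_0_iff)
  have "{F\<in>?Y. \<mu> F = F} \<noteq> {}"
  proof
    \<comment> \<open>Without fixed points only the empty chain would be counted, and q would divide
      1.\<close>
    assume e: "{F\<in>?Y. \<mu> F = F} = {}"
    have "order_chains ({} :: 'a set) = {{}}" by (auto simp: order_chains_def)
    with 1 have "int q dvd 1" unfolding e by simp
    with q show False by simp
  qed
  then show ?thesis by auto
qed

subsection \<open>Decision trees and acyclicity\<close>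

text \<open>Substituting b for v also removes every query of v, since the induction on trees passes
  to the variable set without v.\<close>

lemma prune_tree:
  "\<exists>t'. set_decision_tree t' \<subseteq> set_decision_tree t - {v} \<and> depth t' \<le> depth t
     \<and> (\<forall>x. run t' x = run t (x(v := b)))"
proof (induction t)
  case (Answer a)
  show ?case by (rule exI[of _ "Answer a"]) simp
next
  case (Query u l r)
  then obtain l' r' where l: "set_decision_tree l' \<subseteq> set_decision_tree l - {v}" "depth l' \<le> depth l"
      "\<forall>x. run l' x = run l (x(v := b))"
    and r: "set_decision_tree r' \<subseteq> set_decision_tree r - {v}" "depth r' \<le> depth r"
      "\<forall>x. run r' x = run r (x(v := b))" by blast
  show ?case
  proof (cases "u = v")
    case True
    have "run (if b then r' else l') x = run (Query u l r) (x(v := b))" for x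
      unfolding True run.simps fun_upd_same using l(3) r(3) by simp
    moreover have "set_decision_tree (if b then r' else l') \<subseteq> set_decision_tree (Query u l r) - {v}"
      "depth (if b then r' else l') \<le> depth (Query u l r)" using l(1,2) r(1,2) by auto
    ultimately show ?thesis by blast
  next
    case False
    have "run (Query u l' r') x = run (Query u l r) (x(v := b))" for x
      unfolding run.simps fun_upd_other[OF False] using l(3) r(3) by simp
    moreover have "set_decision_tree (Query u l' r') \<subseteq> set_decision_tree (Query u l r) - {v}"
      "depth (Query u l' r') \<le> depth (Query u l r)" using l(1,2) r(1,2) False by auto
    ultimately show ?thesis by blast
  qed
qed

text \<open>The star of v is a simplicial cone, but {v} is not comparable with the faces avoiding v,
  so the poset criterion for cones does not apply directly. Starting from the faces containing v,
  those avoiding v are added with smaller ones first: at the time F is added, every face above F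
  contains \<open>insert v F\<close>, which is therefore comparable with all that is comparable with
  F.\<close>

lemma acyclic_mod_star:
  fixes \<Delta> :: "'v set set"
  assumes U: "finite U" "\<Delta> - {{}} \<subseteq> U" and down: "\<And>F G. F \<in> \<Delta> \<Longrightarrow> G \<subseteq> F \<Longrightarrow> G \<in> \<Delta>"
    and v: "{v} \<in> \<Delta>"
  shows "acyclic_mod U m (order_chains {F. F \<noteq> {} \<and> insert v F \<in> \<Delta>})"
proof -
  define S1 where "S1 = {F\<in>\<Delta>. v \<in> F}"
  define S0 where "S0 = {F. F \<noteq> {} \<and> insert v F \<in> \<Delta> \<and> v \<notin> F}"
  have S0\<Delta>: "S0 \<subseteq> \<Delta> - {{}}" unfolding S0_def using down by blast
  have finS0: "finite S0" using S0\<Delta> U finite_subset by (metis order_trans)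
  have S1U: "S1 \<subseteq> U" using U(2) by (auto simp: S1_def)
  have "acyclic_mod U m (order_chains (W \<union> S1))" if "W \<subseteq> S0" for W
    using finite_subset[OF that finS0] that
  proof (induction "card W" arbitrary: W)
    case 0
    then have "W = {}" by simp
    moreover have "acyclic_mod U m (order_chains S1)"
      by (rule acyclic_mod_cone[of U _ "{v}"]) (use U S1U v in \<open>auto simp: S1_def\<close>)
    ultimately show ?case by simp
  next
    case (Suc n)
    then have "W \<noteq> {}" by auto
    then obtain F where F: "F \<in> W" "\<And>G. G \<in> W \<Longrightarrow> F \<subseteq> G \<Longrightarrow> G = F"
      using finite_has_maximal[OF Suc.prems(1)] by metis
    let ?W = "W - {F}"
    have Fv: "v \<notin> F" "F \<in> S0" using F Suc.prems by (auto simp: S0_def)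
    have "acyclic_mod U m (order_chains (insert F (?W \<union> S1)))"
    proof (rule acyclic_mod_insert[OF U(1)])
      show "insert F (?W \<union> S1) \<subseteq> U" using S1U Suc.prems(2) S0\<Delta> U(2) F by blast
      show "F \<notin> ?W \<union> S1" using Fv by (auto simp: S1_def)
      show "acyclic_mod U m (order_chains (?W \<union> S1))"
        using Suc F by (intro Suc.hyps(1)) auto
      show "acyclic_mod U m (order_chains {G \<in> ?W \<union> S1. G \<le> F \<or> F \<le> G})"
      proof (rule acyclic_mod_cone[OF U(1), of _ "insert v F"])
        show "{G \<in> ?W \<union> S1. G \<le> F \<or> F \<le> G} \<subseteq> U" using S1U Suc.prems(2) S0\<Delta> U(2) by blast
        show "insert v F \<in> {G \<in> ?W \<union> S1. G \<le> F \<or> F \<le> G}" using Fv by (auto simp: S1_def S0_def)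
        show "G \<le> insert v F \<or> insert v F \<le> G" if "G \<in> {G \<in> ?W \<union> S1. G \<le> F \<or> F \<le> G}" for G
          using that F(2)[of G] Fv(1) by (auto simp: S1_def)
      qed
    qed
    moreover have "insert F (?W \<union> S1) = W \<union> S1" using F by auto
    ultimately show ?case by simp
  qed
  from this[of S0] have "acyclic_mod U m (order_chains (S0 \<union> S1))" by simp
  moreover have "S0 \<union> S1 = {F. F \<noteq> {} \<and> insert v F \<in> \<Delta>}"
    unfolding S0_def S1_def using down by (auto simp: insert_absorb)
  ultimately show ?thesis by simp
qed

text \<open>After the first query v the two subtrees decide the deletion and the link of v, with one
  variable less. The complex is the union of the deletion and the star of v, which meet in the link.
  A tree without queries forces the full simplex.\<close>

lemma nonevasive_imp_acyclic:
  fixes \<Delta> :: "'v set set"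
  assumes "finite V" "\<Delta> \<subseteq> Pow V" "\<And>F G. F \<in> \<Delta> \<Longrightarrow> G \<subseteq> F \<Longrightarrow> G \<in> \<Delta>" "\<Delta> \<noteq> {}"
    and "set_decision_tree t \<subseteq> V" "\<And>x. run t x \<longleftrightarrow> {v\<in>V. x v} \<in> \<Delta>" "depth t < card V"
    and "finite U" "\<Delta> - {{}} \<subseteq> U"
  shows "acyclic_mod U m (order_chains (\<Delta> - {{}}))"
  using assms(1-7,9)
proof (induction "card V" arbitrary: V \<Delta> t)
  case 0
  then show ?case by simp
next
  case (Suc n)
  note U = \<open>finite U\<close> Suc.prems(8)
  note down = Suc.prems(3)
  have emp: "{} \<in> \<Delta>" using Suc.prems(4) down by blast
  show ?case
  proof (cases t)
    case (Answer b)
    have "\<Delta> = Pow V"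
    proof -
      have b using Suc.prems(6)[of "\<lambda>_. False"] emp Answer by simp
      then have "V \<in> \<Delta>" using Suc.prems(6)[of "\<lambda>_. True"] Answer by simp
      then show ?thesis using Suc.prems(2) down by blast
    qed
    moreover have "V \<noteq> {}" using Suc by auto
    ultimately show ?thesis
      by (intro acyclic_mod_cone[OF U, of V]) auto
  next
    case (Query v l r)
    have vV: "v \<in> V" using Query Suc.prems(5) by simp
    let ?V = "V - {v}"
    have cV: "n = card ?V" using Suc vV by simp
    obtain l' where l': "set_decision_tree l' \<subseteq> set_decision_tree l - {v}" "depth l' \<le> depth l"
      "\<forall>x. run l' x = run l (x(v := False))" using prune_tree by metis
    obtain r' where r': "set_decision_tree r' \<subseteq> set_decision_tree r - {v}" "depth r' \<le> depth r"
      "\<forall>x. run r' x = run r (x(v := True))" using prune_tree by metis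
    define del where "del = {F\<in>\<Delta>. v \<notin> F}"
    define lnk where "lnk = {F. v \<notin> F \<and> insert v F \<in> \<Delta>}"
    have lnk_del: "lnk \<subseteq> del" unfolding lnk_def del_def using down by blast
    have acd: "acyclic_mod U m (order_chains (del - {{}}))"
    proof (rule Suc.hyps(1)[OF cV])
      show "run l' x \<longleftrightarrow> {u\<in>?V. x u} \<in> del" for x
      proof -
        have "run l' x = run t (x(v := False))" using l' Query by simp
        also have "\<dots> \<longleftrightarrow> {u\<in>V. (x(v := False)) u} \<in> \<Delta>" by (rule Suc.prems(6))
        also have "{u\<in>V. (x(v := False)) u} = {u\<in>?V. x u}" by auto
        finally show ?thesis by (simp add: del_def)
      qed
      show "depth l' < card ?V" using Suc.prems(7) l'(2) Query cV Suc.hyps(2) by simp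
      show "set_decision_tree l' \<subseteq> ?V" using l'(1) Suc.prems(5) Query by auto
      show "del \<noteq> {}" using emp by (auto simp: del_def)
    qed (use Suc.prems down in \<open>auto simp: del_def\<close>)
    show ?thesis
    proof (cases "{v} \<in> \<Delta>")
      \<comment> \<open>If {v} is not a face, the link has no faces at all, not even the empty one,
        and cannot enter the induction.\<close>
      case False
      then have "del = \<Delta>" using down by (fastforce simp: del_def)
      with acd show ?thesis by simp
    next
      case True
      have acl: "acyclic_mod U m (order_chains (lnk - {{}}))"
      proof (rule Suc.hyps(1)[OF cV])
        show "run r' x \<longleftrightarrow> {u\<in>?V. x u} \<in> lnk" for x
        proof -
          have "run r' x = run t (x(v := True))" using r' Query by simp
          also have "\<dots> \<longleftrightarrow> {u\<in>V. (x(v := True)) u} \<in> \<Delta>" by (rule Suc.prems(6))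
          also have "{u\<in>V. (x(v := True)) u} = insert v {u\<in>?V. x u}" using vV by auto
          finally show ?thesis by (simp add: lnk_def)
        qed
        show "depth r' < card ?V" using Suc.prems(7) r'(2) Query cV Suc.hyps(2) by simp
        show "set_decision_tree r' \<subseteq> ?V" using r'(1) Suc.prems(5) Query by auto
        show "lnk \<noteq> {}" using True by (auto simp: lnk_def)
        show "G \<in> lnk" if "F \<in> lnk" "G \<subseteq> F" for F G
          using that down[of "insert v F" "insert v G"] by (auto simp: lnk_def)
        show "lnk \<subseteq> Pow ?V" using Suc.prems(2) by (auto simp: lnk_def)
        show "lnk - {{}} \<subseteq> U" using lnk_del U(2) by (auto simp: del_def)
      qed (use Suc.prems in auto)
      let ?star = "{F. F \<noteq> {} \<and> insert v F \<in> \<Delta>}"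
      show ?thesis
      proof (rule acyclic_mod_mayer_vietoris[OF U, of "del - {{}}" ?star])
        show "acyclic_mod U m (order_chains ?star)"
          by (rule acyclic_mod_star) (use U down True in auto)
        have "(del - {{}}) \<inter> ?star = lnk - {{}}"
          using lnk_del by (auto simp: del_def lnk_def)
        then show "acyclic_mod U m (order_chains ((del - {{}}) \<inter> ?star))" using acl by simp
        show "?star \<subseteq> \<Delta> - {{}}" using down by blast
        \<comment> \<open>A chain with a member F containing v lies in the star: every other member
          contains F or is contained in F, so adding v to it stays within \<Delta>.\<close>
        show "K \<subseteq> del - {{}} \<or> K \<subseteq> ?star" if K: "K \<in> order_chains (\<Delta> - {{}})" for K
        proof (cases "\<exists>F\<in>K. v \<in> F")
          case True
          then obtain F where F: "F \<in> K" "v \<in> F" by auto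
          have "insert v G \<in> \<Delta> \<and> G \<noteq> {}" if "G \<in> K" for G
          proof -
            have "F \<subseteq> G \<or> G \<subseteq> F" "G \<in> \<Delta> - {{}}" "F \<in> \<Delta>" using K F(1) that unfolding order_chains_def by auto
            then show ?thesis using F(2) down[of F "insert v G"] by (auto simp: insert_absorb)
          qed
          then show ?thesis by auto
        next
          case False
          then show ?thesis using K unfolding order_chains_def del_def by auto
        qed
      qed (use acd in \<open>auto simp: del_def\<close>)
    qed
  qed
qed

lemma not_evasive_imp_acyclic:
  assumes V: "finite V" and \<Delta>: "\<Delta> \<subseteq> Pow V" "\<And>F G. F \<in> \<Delta> \<Longrightarrow> G \<subseteq> F \<Longrightarrow> G \<in> \<Delta>" "\<Delta> \<noteq> {}"
    and ne: "\<not> evasive V (\<lambda>x. {v\<in>V. x v} \<in> \<Delta>)"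
  shows "acyclic_mod (\<Delta> - {{}}) m (order_chains (\<Delta> - {{}}))"
proof -
  let ?f = "\<lambda>x. {v\<in>V. x v} \<in> \<Delta>"
  have inv: "?f x = ?f y" if "\<And>v. v \<in> V \<Longrightarrow> x v = y v" for x y
  proof -
    have "{v\<in>V. x v} = {v\<in>V. y v}" using that by auto
    then show ?thesis by simp
  qed
  have "query_complexity V ?f \<le> card V" by (rule query_complexity_le_card[OF V inv]) auto
  with ne have less: "query_complexity V ?f < card V" by (simp add: evasive_def)
  have "\<exists>d t. set_decision_tree t \<subseteq> V \<and> (\<forall>x. run t x = ?f x) \<and> depth t = d"
    using decision_tree_exists[OF V, of ?f] inv by blast
  from LeastI_ex[OF this] obtain t where
    "set_decision_tree t \<subseteq> V" "\<forall>x. run t x = ?f x" "depth t = query_complexity V ?f"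
    unfolding query_complexity_def by blast
  with less show ?thesis
    by (intro nonevasive_imp_acyclic[of V \<Delta> t]) (use V \<Delta> finite_subset[OF \<Delta>(1)] in auto)
qed

subsection \<open>Relabellings induced by permutations of an indexing set\<close>

lemma relabel_comp: "relabel a (relabel b G) = relabel (a \<circ> b) G"
  by (auto simp: relabel_def image_comp comp_def)

lemma relabel_id: "relabel id G = G"
  by (simp add: relabel_def)

lemma order_aut_relabel:
  assumes "bij a"
  shows "order_aut (relabel a)"
  unfolding order_aut_def
proof (intro conjI allI)
  let ?b = "inv_into UNIV a"
  have inv: "?b \<circ> a = id" "a \<circ> ?b = id"
    using assms by (auto simp: fun_eq_iff bij_is_inj bij_is_surj surj_f_inv_f)
  show "bij (relabel a)"
    by (rule o_bij[of "relabel ?b"]) (simp_all add: fun_eq_iff relabel_comp inv relabel_id)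
  have "inj ((`) a)" using bij_is_inj[OF assms] by (simp add: inj_def inj_image_eq_iff)
  then show "relabel a F \<le> relabel a G \<longleftrightarrow> F \<le> G" for F G
    unfolding relabel_def by (rule inj_image_subset_iff)
qed

lemma relabel_image_property:
  assumes P: "graph_property n \<P>" and a: "a permutes {1..n}"
  shows "relabel a ` (\<P> - {{}}) = \<P> - {{}}"
proof (intro equalityI subsetI)
  fix G assume "G \<in> relabel a ` (\<P> - {{}})"
  then show "G \<in> \<P> - {{}}" using P a by (auto simp: graph_property_def relabel_def)
next
  fix G assume G: "G \<in> \<P> - {{}}"
  have "relabel (inv_into UNIV a) G \<in> \<P> - {{}}"
    using P permutes_inv[OF a] G by (auto simp: graph_property_def relabel_def)
  moreover have "G = relabel a (relabel (inv_into UNIV a) G)"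
    by (simp add: relabel_comp permutes_inv_o(1)[OF a] relabel_id)
  ultimately show "G \<in> relabel a ` (\<P> - {{}})" by blast
qed

lemma funpow_closed: "(\<And>w. w \<in> W \<Longrightarrow> \<pi> w \<in> W) \<Longrightarrow> w \<in> W \<Longrightarrow> (\<pi> ^^ m) w \<in> W"
  by (induction m) auto

lemma bij_betw_periodic:
  assumes W: "\<And>w. w \<in> W \<Longrightarrow> \<pi> w \<in> W" and per: "\<And>w. w \<in> W \<Longrightarrow> (\<pi> ^^ m) w = w" and m: "m > 0"
  shows "bij_betw \<pi> W W"
proof (rule bij_betw_byWitness[of _ "\<pi> ^^ (m - 1)"])
  show "\<forall>w\<in>W. (\<pi> ^^ (m - 1)) (\<pi> w) = w"
    using per m by (metis Suc_diff_1 comp_apply funpow_Suc_right)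
  show "\<forall>w\<in>W. \<pi> ((\<pi> ^^ (m - 1)) w) = w"
    using per m by (metis Suc_diff_1 comp_apply funpow.simps(2))
  show "\<pi> ` W \<subseteq> W" using W by auto
  show "(\<pi> ^^ (m - 1)) ` W \<subseteq> W" using funpow_closed[of W \<pi>] W by auto
qed

text \<open>Groups are described on a convenient index set W and carried to the vertices {1..n} by
  an arbitrary bijection.\<close>

locale transport =
  fixes W :: "'w set" and n :: nat and \<phi> :: "'w \<Rightarrow> nat"
  assumes bij\<phi>: "bij_betw \<phi> W {1..n}"
begin

abbreviation "\<psi> \<equiv> inv_into W \<phi>"

definition conj_perm :: "('w \<Rightarrow> 'w) \<Rightarrow> nat \<Rightarrow> nat" where
  "conj_perm \<pi> v = (if v \<in> {1..n} then \<phi> (\<pi> (\<psi> v)) else v)"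

definition act :: "('w \<Rightarrow> 'w) \<Rightarrow> nat set set \<Rightarrow> nat set set" where
  "act \<pi> = relabel (conj_perm \<pi>)"

lemma \<psi>_in: "v \<in> {1..n} \<Longrightarrow> \<psi> v \<in> W"
  using bij\<phi> by (metis bij_betw_imp_surj_on inv_into_into)

lemma \<phi>_in: "w \<in> W \<Longrightarrow> \<phi> w \<in> {1..n}"
  using bij\<phi> by (meson bij_betwE)

lemma \<psi>\<phi>: "w \<in> W \<Longrightarrow> \<psi> (\<phi> w) = w"
  using bij\<phi> by (simp add: bij_betw_inv_into_left)

lemma \<phi>\<psi>: "v \<in> {1..n} \<Longrightarrow> \<phi> (\<psi> v) = v"
  using bij\<phi> by (simp add: bij_betw_inv_into_right)

lemma conj_perm_\<phi>: "w \<in> W \<Longrightarrow> conj_perm \<pi> (\<phi> w) = \<phi> (\<pi> w)"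
  using \<phi>_in[of w] by (simp add: conj_perm_def \<psi>\<phi>)

lemma conj_perm_comp:
  assumes "\<And>w. w \<in> W \<Longrightarrow> \<pi>' w \<in> W"
  shows "conj_perm \<pi> \<circ> conj_perm \<pi>' = conj_perm (\<pi> \<circ> \<pi>')"
proof
  fix v
  show "(conj_perm \<pi> \<circ> conj_perm \<pi>') v = conj_perm (\<pi> \<circ> \<pi>') v"
  proof (cases "v \<in> {1..n}")
    case True
    then have "conj_perm \<pi>' v = \<phi> (\<pi>' (\<psi> v))" by (simp add: conj_perm_def)
    then show ?thesis using conj_perm_\<phi>[OF assms[OF \<psi>_in[OF True]], of \<pi>] True by (simp add: conj_perm_def)
  next
    case False
    then show ?thesis by (auto simp: conj_perm_def)
  qed
qed

lemma conj_perm_cong: "(\<And>w. w \<in> W \<Longrightarrow> \<pi> w = \<pi>' w) \<Longrightarrow> conj_perm \<pi> = conj_perm \<pi>'"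
  using \<psi>_in by (auto simp: conj_perm_def fun_eq_iff)

lemma conj_perm_id: "conj_perm id = id"
  using \<phi>\<psi> by (auto simp: conj_perm_def fun_eq_iff)

lemma conj_perm_permutes:
  assumes "bij_betw \<pi> W W"
  shows "conj_perm \<pi> permutes {1..n}"
proof (rule bij_imp_permutes)
  have "bij_betw (\<phi> \<circ> \<pi> \<circ> \<psi>) {1..n} {1..n}"
    by (rule bij_betw_trans[OF bij_betw_inv_into[OF bij\<phi>] bij_betw_trans[OF assms bij\<phi>], unfolded comp_assoc[symmetric]])
  then show "bij_betw (conj_perm \<pi>) {1..n} {1..n}"
    by (rule bij_betw_cong[THEN iffD1, rotated]) (simp add: conj_perm_def)
qed (auto simp: conj_perm_def)

lemma act_comp: "(\<And>w. w \<in> W \<Longrightarrow> \<pi>' w \<in> W) \<Longrightarrow> act \<pi> (act \<pi>' G) = act (\<pi> \<circ> \<pi>') G"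
  by (simp add: act_def relabel_comp conj_perm_comp)

lemma act_cong: "(\<And>w. w \<in> W \<Longrightarrow> \<pi> w = \<pi>' w) \<Longrightarrow> act \<pi> = act \<pi>'"
  unfolding act_def by (rule arg_cong[OF conj_perm_cong])

lemma act_trivial: "(\<And>w. w \<in> W \<Longrightarrow> \<pi> w = w) \<Longrightarrow> act \<pi> G = G"
  using conj_perm_cong[of \<pi> id] by (simp add: act_def conj_perm_id relabel_id)

lemma act_funpow:
  assumes "\<And>w. w \<in> W \<Longrightarrow> \<pi> w \<in> W"
  shows "(act \<pi> ^^ m) G = act (\<pi> ^^ m) G"
proof (induction m)
  case 0
  show ?case by (simp add: act_trivial)
next
  case (Suc m)
  have "(act \<pi> ^^ Suc m) G = act \<pi> (act (\<pi> ^^ m) G)" by (simp add: Suc)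
  also have "\<dots> = act (\<pi> \<circ> (\<pi> ^^ m)) G"
    by (rule act_comp) (use assms funpow_closed[of W \<pi>] in auto)
  finally show ?case by (simp add: comp_def)
qed

lemma act_funpow_fixed:
  assumes "\<And>w. w \<in> W \<Longrightarrow> \<pi> w \<in> W" "act \<pi> G = G"
  shows "act (\<pi> ^^ m) G = G"
proof -
  have "(act \<pi> ^^ m) G = G" by (induction m) (auto simp: assms(2))
  then show ?thesis using act_funpow[of \<pi>] assms(1) by simp
qed

lemma act_order_aut: "bij_betw \<pi> W W \<Longrightarrow> order_aut (act \<pi>)"
  unfolding act_def by (rule order_aut_relabel[OF permutes_bij[OF conj_perm_permutes]])

lemma act_property: "bij_betw \<pi> W W \<Longrightarrow> graph_property n \<P> \<Longrightarrow> act \<pi> ` (\<P> - {{}}) = \<P> - {{}}"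
  unfolding act_def by (rule relabel_image_property[OF _ conj_perm_permutes])

text \<open>Ordered pairs, so every edge occurs twice; this is the origin of the factor in the
  bounds for \<open>2 * card G\<close>.\<close>

definition adj :: "nat set set \<Rightarrow> ('w \<times> 'w) set" where
  "adj G = {(a, b). a \<in> W \<and> b \<in> W \<and> {\<phi> a, \<phi> b} \<in> G}"

lemma adj_sym: "(a, b) \<in> adj G \<Longrightarrow> (b, a) \<in> adj G"
  by (simp add: adj_def insert_commute)

lemma adj_act:
  assumes "act \<pi> G = G" "\<And>w. w \<in> W \<Longrightarrow> \<pi> w \<in> W" "(a, b) \<in> adj G"
  shows "(\<pi> a, \<pi> b) \<in> adj G"
proof -
  have ab: "a \<in> W" "b \<in> W" "{\<phi> a, \<phi> b} \<in> G" using assms(3) by (auto simp: adj_def)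
  then have "conj_perm \<pi> ` {\<phi> a, \<phi> b} \<in> act \<pi> G" unfolding act_def relabel_def by (intro imageI)
  then show ?thesis using ab assms by (simp add: adj_def conj_perm_\<phi>)
qed

lemma card_adj_le:
  assumes G: "G \<subseteq> vertex_pairs n"
  shows "card (adj G) \<le> 2 * card G" "finite (adj G)"
proof -
  have finG: "finite G"
    by (rule finite_subset[OF G]) (auto simp: vertex_pairs_def)
  define fib where "fib e = {(a, b). a \<in> W \<and> b \<in> W \<and> {\<phi> a, \<phi> b} = e}" for e
  have fib: "card (fib e) \<le> 2 \<and> finite (fib e)" if eG: "e \<in> G" for e
  proof -
    obtain u v where uv: "e = {u, v}" "u \<noteq> v"
      using eG G unfolding vertex_pairs_def card_2_iff by blast
    have sub: "fib e \<subseteq> {(\<psi> u, \<psi> v), (\<psi> v, \<psi> u)}"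
      using uv \<psi>\<phi> by (auto simp: fib_def doubleton_eq_iff)
    have "card (fib e) \<le> card {(\<psi> u, \<psi> v), (\<psi> v, \<psi> u)}" by (rule card_mono[OF _ sub]) simp
    also have "card {x, y} \<le> 2" for x y :: "'w \<times> 'w" by (cases "x = y") auto
    finally show ?thesis using finite_subset[OF sub] by simp
  qed
  have adj: "adj G = (\<Union>e\<in>G. fib e)" by (auto simp: adj_def fib_def)
  have "card (adj G) \<le> (\<Sum>e\<in>G. card (fib e))" unfolding adj by (rule card_UN_le[OF finG])
  also have "\<dots> \<le> (\<Sum>e\<in>G. 2)" by (rule sum_mono) (use fib in auto)
  finally show "card (adj G) \<le> 2 * card G" by simp
  show "finite (adj G)" unfolding adj using finG fib by auto
qed

lemma adj_nonempty:
  assumes "G \<subseteq> vertex_pairs n" "G \<noteq> {}"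
  obtains a b where "(a, b) \<in> adj G" "a \<noteq> b"
proof -
  obtain e where "e \<in> G" using assms by auto
  then obtain u v where e: "{u, v} \<in> G" "u \<noteq> v" "u \<in> {1..n}" "v \<in> {1..n}"
    using assms(1) by (auto simp: vertex_pairs_def card_2_iff subset_iff)
  have "(\<psi> u, \<psi> v) \<in> adj G" using e \<psi>_in \<phi>\<psi> by (simp add: adj_def)
  moreover have "\<psi> u \<noteq> \<psi> v" using e \<phi>\<psi> by metis
  ultimately show ?thesis using that by blast
qed

end

subsection \<open>A group with large orbits on pairs\<close>

text \<open>
  The vertices are \<open>k\<close> copies \<open>Inl (i, x)\<close> of the field with \<open>p\<close> elements and one copy \<open>Inr t\<close>
  of the field with \<open>r\<close> elements. The map \<open>\<beta>\<close> is a \<open>k\<close>-th root of the multiplication by the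
  primitive root \<open>g\<close> on all blocks; this makes the group generated by \<open>\<beta>\<close> and \<open>\<rho>\<close> cyclic without
  any coprimality condition between \<open>k\<close> and \<open>p - 1\<close>.
\<close>

locale block_group =
  fixes p k r q g h :: nat
  assumes p: "prime p" and r: "prime r" and q: "prime q" and k: "k > 0"
    and cop: "coprime (k * (p - 1)) r"
    and g: "residue_primroot p g" and h: "[h ^ q = 1] (mod r)" "\<not> [h = 1] (mod r)"
begin

definition W :: "((nat \<times> nat) + nat) set" where
  "W = ({..<k} \<times> {..<p}) <+> {..<r}"

fun \<sigma> :: "nat \<Rightarrow> (nat \<times> nat) + nat \<Rightarrow> (nat \<times> nat) + nat" where
  "\<sigma> i (Inl (j, x)) = Inl (j, if j = i then (x + 1) mod p else x)"
| "\<sigma> i (Inr t) = Inr t"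

fun \<beta> :: "(nat \<times> nat) + nat \<Rightarrow> (nat \<times> nat) + nat" where
  "\<beta> (Inl (i, x)) = (if i + 1 < k then Inl (i + 1, x) else Inl (0, (g * x) mod p))"
| "\<beta> (Inr t) = Inr t"

fun \<rho> :: "(nat \<times> nat) + nat \<Rightarrow> (nat \<times> nat) + nat" where
  "\<rho> (Inl y) = Inl y"
| "\<rho> (Inr t) = Inr ((t + 1) mod r)"

fun \<mu> :: "(nat \<times> nat) + nat \<Rightarrow> (nat \<times> nat) + nat" where
  "\<mu> (Inl y) = Inl y"
| "\<mu> (Inr t) = Inr ((h * t) mod r)"

lemma p1: "p > 1" "p > 0" and r1: "r > 1" "r > 0" and q1: "q > 1" "q > 0"
  using p r q prime_gt_1_nat prime_gt_0_nat by auto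

lemma W_Inl [simp]: "Inl (i, x) \<in> W \<longleftrightarrow> i < k \<and> x < p"
  and W_Inr [simp]: "Inr t \<in> W \<longleftrightarrow> t < r"
  by (auto simp: W_def)

lemma W_cases:
  assumes "w \<in> W"
  obtains (L) i x where "w = Inl (i, x)" "i < k" "x < p" | (R) t where "w = Inr t" "t < r"
  using assms by (auto simp: W_def)

lemma card_W: "card W = p * k + r" and finite_W: "finite W"
  by (simp_all add: W_def card_Plus mult.commute)

lemma closed_\<sigma>: "w \<in> W \<Longrightarrow> \<sigma> i w \<in> W"
  using p1 by (auto elim!: W_cases)

lemma closed_\<beta>: "w \<in> W \<Longrightarrow> \<beta> w \<in> W"
  using p1 k by (auto elim!: W_cases)

lemma closed_\<rho>: "w \<in> W \<Longrightarrow> \<rho> w \<in> W"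
  using r1 by (auto elim!: W_cases)

lemma closed_\<mu>: "w \<in> W \<Longrightarrow> \<mu> w \<in> W"
  using r1 by (auto elim!: W_cases)

lemma \<sigma>_pow: "x < p \<Longrightarrow> (\<sigma> i ^^ m) (Inl (j, x)) = Inl (j, if j = i then (x + m) mod p else x)"
  by (induction m) (auto simp: mod_Suc_eq)

lemma \<sigma>_pow_Inr: "(\<sigma> i ^^ m) (Inr t) = Inr t"
  by (induction m) auto

lemma \<rho>_pow: "t < r \<Longrightarrow> (\<rho> ^^ m) (Inr t) = Inr ((t + m) mod r)"
  by (induction m) (auto simp: mod_Suc_eq)

lemma \<rho>_pow_Inl: "(\<rho> ^^ m) (Inl y) = Inl y"
  by (induction m) auto

lemma \<mu>_pow: "t < r \<Longrightarrow> (\<mu> ^^ m) (Inr t) = Inr ((h ^ m * t) mod r)"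
  by (induction m) (auto simp: mod_mult_right_eq mult.assoc)

lemma \<mu>_pow_Inl: "(\<mu> ^^ m) (Inl y) = Inl y"
  by (induction m) auto

lemma \<beta>_pow_Inr: "(\<beta> ^^ m) (Inr t) = Inr t"
  by (induction m) auto

lemma \<beta>_pow_less: "i + m < k \<Longrightarrow> (\<beta> ^^ m) (Inl (i, x)) = Inl (i + m, x)"
  by (induction m) auto

lemma \<beta>_pow_to_0: "i < k \<Longrightarrow> (\<beta> ^^ (k - i)) (Inl (i, x)) = Inl (0, (g * x) mod p)"
proof -
  assume i: "i < k"
  have "(\<beta> ^^ (k - i)) (Inl (i, x)) = \<beta> ((\<beta> ^^ (k - i - 1)) (Inl (i, x)))"
    using i by (metis Suc_diff_1 comp_apply funpow.simps(2) zero_less_diff)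
  also have "(\<beta> ^^ (k - i - 1)) (Inl (i, x)) = Inl (k - 1, x)"
    using \<beta>_pow_less[of i "k - i - 1" x] i by simp
  finally show ?thesis using k by simp
qed

lemma \<beta>_pow_k: "i < k \<Longrightarrow> (\<beta> ^^ k) (Inl (i, x)) = Inl (i, (g * x) mod p)"
proof -
  assume i: "i < k"
  then have "(\<beta> ^^ k) (Inl (i, x)) = (\<beta> ^^ (i + (k - i))) (Inl (i, x))" by simp
  also have "\<dots> = (\<beta> ^^ i) ((\<beta> ^^ (k - i)) (Inl (i, x)))" by (simp only: funpow_add comp_apply)
  also have "\<dots> = Inl (i, (g * x) mod p)" using i \<beta>_pow_less[of 0 i] by (simp add: \<beta>_pow_to_0)
  finally show ?thesis .
qed

lemma \<beta>_pow_k_mult: "i < k \<Longrightarrow> x < p \<Longrightarrow> (\<beta> ^^ (k * m)) (Inl (i, x)) = Inl (i, (g ^ m * x) mod p)"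
proof (induction m)
  case (Suc m)
  have "(\<beta> ^^ (k * Suc m)) (Inl (i, x)) = (\<beta> ^^ k) ((\<beta> ^^ (k * m)) (Inl (i, x)))"
    by (metis comp_apply funpow_add mult_Suc_right)
  then show ?case using Suc by (simp add: \<beta>_pow_k mod_mult_right_eq mult.assoc)
qed simp

lemma g_cop: "coprime g p" "coprime p g"
  using g by (auto simp: residue_primroot_def coprime_commute)

lemma h_cop: "coprime h r"
proof -
  have "coprime (h ^ q) r" using h(1) cong_imp_coprime[of 1 "h ^ q" r] by (simp add: cong_sym_eq)
  then show ?thesis using q1 by simp
qed

lemma per_\<sigma>: "w \<in> W \<Longrightarrow> (\<sigma> i ^^ p) w = w"
  by (auto elim!: W_cases simp: \<sigma>_pow \<sigma>_pow_Inr)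

lemma per_\<rho>: "w \<in> W \<Longrightarrow> (\<rho> ^^ r) w = w"
  by (auto elim!: W_cases simp: \<rho>_pow \<rho>_pow_Inl)

lemma per_\<mu>: "w \<in> W \<Longrightarrow> (\<mu> ^^ q) w = w"
proof (elim W_cases)
  fix t assume "w = Inr t" "t < r"
  moreover have "[h ^ q * t = 1 * t] (mod r)" by (rule cong_mult[OF h(1) cong_refl])
  ultimately show "(\<mu> ^^ q) w = w" by (simp add: \<mu>_pow cong_def)
qed (simp add: \<mu>_pow_Inl)

lemma per_\<beta>: "w \<in> W \<Longrightarrow> (\<beta> ^^ (k * (p - 1))) w = w"
proof (elim W_cases)
  fix i x assume "w = Inl (i, x)" "i < k" "x < p"
  moreover have "[g ^ (p - 1) * x = 1 * x] (mod p)"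
    using fermat_theorem[OF p] g_cop p1 by (intro cong_mult cong_refl) (metis coprime_absorb_left not_prime_unit p coprime_commute)
  ultimately show "(\<beta> ^^ (k * (p - 1))) w = w" by (simp add: \<beta>_pow_k_mult cong_def)
qed (simp add: \<beta>_pow_Inr)

lemma bij_\<sigma>: "bij_betw (\<sigma> i) W W"
  by (rule bij_betw_periodic[of _ _ p]) (use closed_\<sigma> per_\<sigma> p1 in auto)

lemma bij_\<rho>: "bij_betw \<rho> W W"
  by (rule bij_betw_periodic[of _ _ r]) (use closed_\<rho> per_\<rho> r1 in auto)

lemma bij_\<mu>: "bij_betw \<mu> W W"
  by (rule bij_betw_periodic[of _ _ q]) (use closed_\<mu> per_\<mu> q1 in auto)

lemma bij_\<beta>: "bij_betw \<beta> W W"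
  by (rule bij_betw_periodic[of _ _ "k * (p - 1)"]) (use closed_\<beta> per_\<beta> p1 k in auto)

lemma comm_\<sigma>: "\<sigma> i (\<sigma> j w) = \<sigma> j (\<sigma> i w)"
  by (cases w) auto

lemma comm_\<sigma>_\<rho>: "\<sigma> i (\<rho> w) = \<rho> (\<sigma> i w)"
  by (cases w) auto

lemma comm_\<sigma>_\<mu>: "\<sigma> i (\<mu> w) = \<mu> (\<sigma> i w)"
  by (cases w) auto

lemma comm_\<beta>_\<rho>: "\<beta> (\<rho> w) = \<rho> (\<beta> w)"
  by (cases w) auto

lemma comm_\<beta>_\<mu>: "\<beta> (\<mu> w) = \<mu> (\<beta> w)"
  by (cases w) auto

lemma \<sigma>_\<beta>_Suc: "w \<in> W \<Longrightarrow> Suc i < k \<Longrightarrow> \<sigma> (Suc i) (\<beta> w) = \<beta> (\<sigma> i w)"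
  by (auto elim!: W_cases)

text \<open>Together with \<open>\<sigma>_\<beta>_Suc\<close> this says that \<beta> normalizes the
  group of translations. On wrapping around, \<beta> multiplies by g, so a translation by 1 after it
  is a translation by e = 1/g before it.\<close>

lemma \<sigma>_\<beta>_0:
  obtains e where "\<And>w. w \<in> W \<Longrightarrow> \<sigma> 0 (\<beta> w) = \<beta> ((\<sigma> (k - 1) ^^ e) w)"
proof -
  obtain e where e: "[g * e = 1] (mod p)" using cong_solve_coprime_nat[OF g_cop(1)] by auto
  have *: "(g * x + 1) mod p = (g * ((x + e) mod p)) mod p" for x
  proof -
    have "[g * x + 1 = g * x + g * e] (mod p)" by (intro cong_add cong_refl cong_sym[OF e])
    then show ?thesis by (simp add: cong_def mod_mult_right_eq distrib_left)
  qed
  show ?thesis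
  proof (rule that[of e])
    fix w assume "w \<in> W"
    then show "\<sigma> 0 (\<beta> w) = \<beta> ((\<sigma> (k - 1) ^^ e) w)"
    proof (cases rule: W_cases)
      case (L i x)
      show ?thesis
      proof (cases "i = k - 1")
        case True
        then show ?thesis using L k * [of x] by (simp add: \<sigma>_pow mod_Suc_eq)
      next
        case False
        then have "Suc i < k" using L by simp
        then show ?thesis using L by (simp add: \<sigma>_pow)
      qed
    qed (simp add: \<sigma>_pow_Inr)
  qed
qed

text \<open>\<mu> normalizes the translations of the field with r elements; e is the inverse of h
  modulo r.\<close>

lemma \<rho>_\<mu>:
  obtains e where "\<And>w. w \<in> W \<Longrightarrow> \<rho> (\<mu> w) = \<mu> ((\<rho> ^^ e) w)"
proof -
  obtain e where e: "[h * e = 1] (mod r)" using cong_solve_coprime_nat[OF h_cop] by auto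
  have *: "(h * x + 1) mod r = (h * ((x + e) mod r)) mod r" for x
  proof -
    have "[h * x + 1 = h * x + h * e] (mod r)" by (intro cong_add cong_refl cong_sym[OF e])
    then show ?thesis by (simp add: cong_def mod_mult_right_eq distrib_left)
  qed
  show ?thesis
  proof (rule that[of e])
    fix w assume "w \<in> W"
    then show "\<rho> (\<mu> w) = \<mu> ((\<rho> ^^ e) w)"
      using * by (auto elim!: W_cases simp: \<rho>_pow \<rho>_pow_Inl mod_Suc_eq)
  qed
qed

text \<open>Chinese remaindering: e is a multiple of the period of \<beta> and is 1 modulo r. The
  single map \<open>\<beta> \<circ> \<rho>\<close>, to which the Lefschetz formula is applied, thus
  generates \<rho> and with it \<beta>; this is what the coprimality assumption is for.\<close>

lemma \<beta>\<rho>_pow: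
  obtains e where "\<And>w. w \<in> W \<Longrightarrow> ((\<beta> \<circ> \<rho>) ^^ e) w = \<rho> w"
proof -
  have pow: "((\<beta> \<circ> \<rho>) ^^ m) w = (\<beta> ^^ m) ((\<rho> ^^ m) w)" for m w
  proof (induction m)
    case (Suc m)
    have "\<rho> ((\<beta> ^^ m) w) = (\<beta> ^^ m) (\<rho> w)" for m w
      by (induction m) (auto simp flip: comm_\<beta>_\<rho>)
    then show ?case using Suc by simp
  qed simp
  obtain u where u: "[k * (p - 1) * u = 1] (mod r)" using cong_solve_coprime_nat[OF cop] by auto
  define e where "e = k * (p - 1) * u"
  have "(\<beta> ^^ e) w = w" if "w \<in> W" for w
  proof -
    have "((\<beta> ^^ (k * (p - 1))) ^^ u) w = w"
      by (induction u) (use per_\<beta>[OF that] in auto)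
    then show ?thesis by (simp add: e_def funpow_mult)
  qed
  moreover have "(\<rho> ^^ e) w = \<rho> w" if "w \<in> W" for w
    using that
  proof (cases rule: W_cases)
    case (R t)
    have "[t + e = t + 1] (mod r)" using u by (intro cong_add cong_refl) (simp add: e_def)
    then show ?thesis using R by (simp add: \<rho>_pow cong_def)
  qed (simp add: \<rho>_pow_Inl)
  ultimately show ?thesis using that[of e] closed_\<rho> by (simp add: pow)
qed

end

section \<open>The action on graphs and its nonempty invariant graphs\<close>

locale block_action = block_group p k r q g h + transport "block_group.W p k r" n \<phi>
  for p k r q g h n \<phi>
begin

lemma act_comm:
  assumes "\<And>w. w \<in> W \<Longrightarrow> \<pi> w \<in> W" "\<And>w. w \<in> W \<Longrightarrow> \<pi>' w \<in> W"
    "\<And>w. w \<in> W \<Longrightarrow> \<pi> (\<pi>' w) = \<pi>' (\<pi> w)"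
  shows "act \<pi> (act \<pi>' G) = act \<pi>' (act \<pi> G)"
proof -
  have "act (\<pi> \<circ> \<pi>') = act (\<pi>' \<circ> \<pi>)" by (rule act_cong) (simp add: assms(3))
  then show ?thesis using act_comp[of \<pi>' \<pi> G] act_comp[of \<pi> \<pi>' G] assms(1,2) by simp
qed

text \<open>Normality in use: the relation between \<alpha>' and \<alpha> turns invariance of G
  under \<alpha> into invariance of its image under \<alpha>'.\<close>

lemma act_transfer:
  assumes "\<And>w. w \<in> W \<Longrightarrow> \<pi> w \<in> W" "\<And>w. w \<in> W \<Longrightarrow> \<alpha> w \<in> W"
    "\<And>w. w \<in> W \<Longrightarrow> \<alpha>' (\<pi> w) = \<pi> (\<alpha> w)" "act \<alpha> G = G"
  shows "act \<alpha>' (act \<pi> G) = act \<pi> G"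
proof -
  have "act (\<alpha>' \<circ> \<pi>) = act (\<pi> \<circ> \<alpha>)" by (rule act_cong) (simp add: assms(3))
  then show ?thesis using act_comp[of \<pi> \<alpha>' G] act_comp[of \<alpha> \<pi> G] assms by simp
qed

lemma invariant_graph_exists:
  assumes P: "graph_property n \<P>" "nontrivial_property n \<P>" "monotone_property \<P>"
    and ne: "\<not> evasive_property n \<P>"
  obtains G where "G \<in> \<P>" "G \<noteq> {}" "\<And>i. i < k \<Longrightarrow> act (\<sigma> i) G = G"
    "act \<beta> G = G" "act \<rho> G = G" "act \<mu> G = G"
proof -
  define X where "X = \<P> - {{}}"
  have PV: "\<P> \<subseteq> Pow (vertex_pairs n)" using P by (simp add: graph_property_def)
  have finV: "finite (vertex_pairs n)" by (auto simp: vertex_pairs_def)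
  have finX: "finite X" using PV finV by (simp add: X_def finite_subset)
  have acyc: "acyclic_mod X m (order_chains X)" for m
    unfolding X_def
  proof (rule not_evasive_imp_acyclic[OF finV PV])
    show "\<P> \<noteq> {}" using P by (simp add: nontrivial_property_def)
    show "\<not> evasive (vertex_pairs n) (\<lambda>x. {v \<in> vertex_pairs n. x v} \<in> \<P>)"
      using ne unfolding evasive_property_def membership_function_def by simp
    show "G \<in> \<P>" if "F \<in> \<P>" "G \<subseteq> F" for F G
      using P(3) that by (auto simp: monotone_property_def)
  qed
  define gs where "gs = map (\<lambda>i. act (\<sigma> i)) [0..<k]"
  define \<tau> where "\<tau> = \<beta> \<circ> \<rho>"
  have gs: "(\<forall>f\<in>set gs. f F = F) \<longleftrightarrow> (\<forall>i<k. act (\<sigma> i) F = F)" for F by (auto simp: gs_def)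
  have closed_\<tau>: "w \<in> W \<Longrightarrow> \<tau> w \<in> W" for w by (simp add: \<tau>_def closed_\<beta> closed_\<rho>)
  have bij_\<tau>: "bij_betw \<tau> W W" unfolding \<tau>_def by (rule bij_betw_trans[OF bij_\<rho> bij_\<beta>])
  have XX: "act \<pi> ` X = X" if "bij_betw \<pi> W W" for \<pi>
    unfolding X_def by (rule act_property[OF that P(1)])
  \<comment> \<open>An injective map of a finite set into itself is onto, so only inclusions of the
    fixed point sets are checked below.\<close>
  have inv_eq: "f ` Y = Y" if "order_aut f" "f ` Y \<subseteq> Y" "finite Y" for f and Y :: "nat set set set"
    by (rule endo_inj_surj) (use that order_aut_inj[OF that(1)] in \<open>auto intro: inj_on_subset\<close>)
  have \<rho>_fixed: "act \<rho> G = G \<and> act \<beta> G = G" if "act \<tau> G = G" for G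
  proof -
    obtain e where e: "\<And>w. w \<in> W \<Longrightarrow> (\<tau> ^^ e) w = \<rho> w" unfolding \<tau>_def using \<beta>\<rho>_pow by metis
    have "act (\<tau> ^^ e) G = G" by (rule act_funpow_fixed) (use closed_\<tau> that in auto)
    moreover have "act (\<tau> ^^ e) = act \<rho>" by (rule act_cong) (use e in auto)
    ultimately have 1: "act \<rho> G = G" by simp
    have "act \<beta> (act \<rho> G) = act \<tau> G" unfolding \<tau>_def by (rule act_comp) (rule closed_\<rho>)
    with 1 that show ?thesis by simp
  qed
  have "\<exists>F\<in>X. (\<forall>f\<in>set gs. f F = F) \<and> act \<tau> F = F \<and> act \<mu> F = F"
  proof (rule oliver_fixed_point[OF finX acyc p q])
    fix f assume "f \<in> set gs"
    then obtain i where f: "f = act (\<sigma> i)" by (auto simp: gs_def)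
    show "order_aut f \<and> f ` X = X \<and> (\<forall>F. (f ^^ p) F = F)"
      unfolding f
    proof (intro conjI allI)
      show "order_aut (act (\<sigma> i))" by (rule act_order_aut[OF bij_\<sigma>])
      show "act (\<sigma> i) ` X = X" by (rule XX[OF bij_\<sigma>])
      show "(act (\<sigma> i) ^^ p) F = F" for F
        using act_funpow[of "\<sigma> i" p F] closed_\<sigma> act_trivial[of "\<sigma> i ^^ p" F] per_\<sigma> by simp
    qed
  next
    fix f f' F assume "f \<in> set gs" "f' \<in> set gs"
    then obtain i j where "f = act (\<sigma> i)" "f' = act (\<sigma> j)" by (auto simp: gs_def)
    then show "f (f' F) = f' (f F)" using act_comm[of "\<sigma> i" "\<sigma> j" F] closed_\<sigma> comm_\<sigma> by simp
  next
    show "order_aut (act \<tau>)" by (rule act_order_aut[OF bij_\<tau>])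
    show "act \<tau> ` X = X" by (rule XX[OF bij_\<tau>])
    show "act \<tau> ` {F \<in> X. \<forall>f\<in>set gs. f F = F} = {F \<in> X. \<forall>f\<in>set gs. f F = F}"
      unfolding gs
    proof (rule inv_eq[OF act_order_aut[OF bij_\<tau>]])
      show "act \<tau> ` {F \<in> X. \<forall>i<k. act (\<sigma> i) F = F} \<subseteq> {F \<in> X. \<forall>i<k. act (\<sigma> i) F = F}"
      proof (clarify, intro conjI allI impI)
        fix F i assume F: "F \<in> X" "\<forall>i<k. act (\<sigma> i) F = F"
        show "act \<tau> F \<in> X" using F XX[OF bij_\<tau>] by auto
        assume i: "i < k"
        show "act (\<sigma> i) (act \<tau> F) = act \<tau> F"
        proof (cases i)
          case 0
          obtain e where e: "\<And>w. w \<in> W \<Longrightarrow> \<sigma> 0 (\<beta> w) = \<beta> ((\<sigma> (k - 1) ^^ e) w)" using \<sigma>_\<beta>_0 by metis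
          have cp: "(\<sigma> (k - 1) ^^ e) (\<rho> w) = \<rho> ((\<sigma> (k - 1) ^^ e) w)" for w
            by (induction e) (simp_all add: comm_\<sigma>_\<rho>)
          show ?thesis unfolding 0
          proof (rule act_transfer[where \<alpha> = "\<sigma> (k - 1) ^^ e"])
            show "act (\<sigma> (k - 1) ^^ e) F = F"
              by (rule act_funpow_fixed) (use closed_\<sigma> F k in auto)
            show "(\<sigma> (k - 1) ^^ e) w \<in> W" if "w \<in> W" for w
              by (rule funpow_closed[OF _ that]) (rule closed_\<sigma>)
            show "\<sigma> 0 (\<tau> w) = \<tau> ((\<sigma> (k - 1) ^^ e) w)" if "w \<in> W" for w
              using e[OF closed_\<rho>[OF that]] cp by (simp add: \<tau>_def)
          qed (rule closed_\<tau>)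
        next
          case (Suc j)
          show ?thesis unfolding Suc
          proof (rule act_transfer[where \<alpha> = "\<sigma> j"])
            show "act (\<sigma> j) F = F" using F i Suc by simp
            show "\<sigma> (Suc j) (\<tau> w) = \<tau> (\<sigma> j w)" if "w \<in> W" for w
              using \<sigma>_\<beta>_Suc[OF closed_\<rho>[OF that], of j] i Suc by (simp add: \<tau>_def comm_\<sigma>_\<rho>)
          qed (auto intro: closed_\<tau> closed_\<sigma>)
        qed
      qed
    qed (use finX in simp)
    show "order_aut (act \<mu>)" by (rule act_order_aut[OF bij_\<mu>])
    show "(act \<mu> ^^ q) F = F" for F
      using act_funpow[of \<mu> q F] closed_\<mu> act_trivial[of "\<mu> ^^ q" F] per_\<mu> by simp
    show "act \<mu> ` {F \<in> X. (\<forall>f\<in>set gs. f F = F) \<and> act \<tau> F = F}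
        = {F \<in> X. (\<forall>f\<in>set gs. f F = F) \<and> act \<tau> F = F}"
      unfolding gs
    proof (rule inv_eq[OF act_order_aut[OF bij_\<mu>]])
      show "act \<mu> ` {F \<in> X. (\<forall>i<k. act (\<sigma> i) F = F) \<and> act \<tau> F = F}
        \<subseteq> {F \<in> X. (\<forall>i<k. act (\<sigma> i) F = F) \<and> act \<tau> F = F}"
      proof (clarify, intro conjI allI impI)
        fix F i assume F: "F \<in> X" "\<forall>i<k. act (\<sigma> i) F = F" "act \<tau> F = F"
        show "act \<mu> F \<in> X" using F XX[OF bij_\<mu>] by auto
        show "act (\<sigma> i) (act \<mu> F) = act \<mu> F" if "i < k"
          by (rule act_transfer[where \<alpha> = "\<sigma> i"]) (use F that closed_\<mu> closed_\<sigma> comm_\<sigma>_\<mu> in auto)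
        have \<beta>: "act \<beta> (act \<mu> F) = act \<mu> F"
          by (rule act_transfer[where \<alpha> = \<beta>]) (use \<rho>_fixed[OF F(3)] closed_\<mu> closed_\<beta> comm_\<beta>_\<mu> in auto)
        obtain e where e: "\<And>w. w \<in> W \<Longrightarrow> \<rho> (\<mu> w) = \<mu> ((\<rho> ^^ e) w)" using \<rho>_\<mu> by metis
        have \<rho>: "act \<rho> (act \<mu> F) = act \<mu> F"
        proof (rule act_transfer[where \<alpha> = "\<rho> ^^ e"])
          show "(\<rho> ^^ e) w \<in> W" if "w \<in> W" for w
            by (rule funpow_closed[OF _ that]) (rule closed_\<rho>)
          show "act (\<rho> ^^ e) F = F"
            by (rule act_funpow_fixed) (use closed_\<rho> \<rho>_fixed[OF F(3)] in auto)
        qed (use closed_\<mu> e in auto)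
        have "act \<beta> (act \<rho> (act \<mu> F)) = act \<tau> (act \<mu> F)"
          unfolding \<tau>_def by (rule act_comp) (rule closed_\<rho>)
        then show "act \<tau> (act \<mu> F) = act \<mu> F" using \<beta> \<rho> by simp
      qed
    qed (use finX in simp)
  qed
  then obtain G where "G \<in> X" "\<forall>i<k. act (\<sigma> i) G = G" "act \<tau> G = G" "act \<mu> G = G"
    unfolding gs by blast
  then show ?thesis using \<rho>_fixed by (intro that[of G]) (auto simp: X_def)
qed

end

section \<open>Orbits on pairs of vertices\<close>

context block_action
begin

text \<open>A single pair of adjacent vertices already has a large orbit on ordered pairs, whose
  size depends on the kinds of its two ends. Ends in different blocks F_p yield k p^2 adjacent pairs
  and fall under the first alternative.\<close>

lemma invariant_graph_large:
  assumes G: "G \<subseteq> vertex_pairs n" "G \<noteq> {}"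
    and inv: "\<And>i. i < k \<Longrightarrow> act (\<sigma> i) G = G" "act \<beta> G = G" "act \<rho> G = G" "act \<mu> G = G"
  shows "k * (p * (p - 1)) \<le> 2 * card G \<or> r * q \<le> 2 * card G \<or> k * p * r \<le> 2 * card G"
proof -
  define R where "R = adj G"
  have move: "((\<pi> ^^ m) a, (\<pi> ^^ m) b) \<in> R"
    if "\<And>w. w \<in> W \<Longrightarrow> \<pi> w \<in> W" "act \<pi> G = G" "(a, b) \<in> R" for \<pi> m a b
    using that(3) unfolding R_def
    by (induction m) (use adj_act[OF that(2,1)] in auto)
  have m\<sigma>: "((\<sigma> i ^^ m) a, (\<sigma> i ^^ m) b) \<in> R" if "i < k" "(a, b) \<in> R" for i m a b
    by (rule move) (use closed_\<sigma> inv(1) that in auto)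
  have m\<beta>: "((\<beta> ^^ m) a, (\<beta> ^^ m) b) \<in> R" if "(a, b) \<in> R" for m a b
    by (rule move) (use closed_\<beta> inv(2) that in auto)
  have m\<rho>: "((\<rho> ^^ m) a, (\<rho> ^^ m) b) \<in> R" if "(a, b) \<in> R" for m a b
    by (rule move) (use closed_\<rho> inv(3) that in auto)
  have m\<mu>: "((\<mu> ^^ m) a, (\<mu> ^^ m) b) \<in> R" if "(a, b) \<in> R" for m a b
    by (rule move) (use closed_\<mu> inv(4) that in auto)
  have RW: "a \<in> W" "b \<in> W" if "(a, b) \<in> R" for a b using that by (auto simp: R_def adj_def)
  have sym: "(b, a) \<in> R" if "(a, b) \<in> R" for a b using that adj_sym by (simp add: R_def)
  have finR: "finite R" and cardR: "card R \<le> 2 * card G" using card_adj_le[OF G(1)] by (auto simp: R_def)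
  have bound: "card A \<le> 2 * card G" if "inj_on f A" "f ` A \<subseteq> R" for f :: "'z \<Rightarrow> _" and A
    using card_inj_on_le[OF that finR] cardR by simp
  have hit: "\<exists>m. (x + m) mod s = y" if "x < s" "y < s" for x y s :: nat
    by (rule exI[of _ "y + s - x"]) (use that in simp)
  have case_same: "k * (p * (p - 1)) \<le> 2 * card G"
    if xy: "(Inl (i, x), Inl (i, y)) \<in> R" "x \<noteq> y" for i x y
  proof -
    have b: "i < k" "x < p" "y < p" using RW[OF xy(1)] by auto
    \<comment> \<open>The pair is moved to block 0 first; passing the end of the cycle of blocks
      multiplies both coordinates by g.\<close>
    define x0 y0 where "x0 = (g * x) mod p" and "y0 = (g * y) mod p"
    have 0: "(Inl (0, x0), Inl (0, y0)) \<in> R"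
      using m\<beta>[OF xy(1), of "k - i"] \<beta>_pow_to_0[OF b(1)] by (simp add: x0_def y0_def)
    have ne: "x0 \<noteq> y0"
    proof
      assume "x0 = y0"
      then have "[g * x = g * y] (mod p)" by (simp add: x0_def y0_def cong_def)
      then have "[x = y] (mod p)" using cong_mult_lcancel_nat[OF g_cop(1)] by simp
      then show False using b xy(2) by (simp add: cong_def)
    qed
    have b0: "x0 < p" "y0 < p" using p1 by (auto simp: x0_def y0_def)
    define d where "d = (y0 + (p - x0)) mod p"
    have d: "(Inl (0, 0), Inl (0, d)) \<in> R"
      using m\<sigma>[OF _ 0, of 0 "p - x0"] k b0 by (simp add: \<sigma>_pow d_def)
    have dp: "d < p" using p1 by (simp add: d_def)
    have d0: "d \<noteq> 0"
    proof
      assume "d = 0"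
      then have "[y0 + (p - x0) = 0] (mod p)" by (simp add: d_def cong_def)
      then have "[y0 + (p - x0) + x0 = 0 + x0] (mod p)" by (intro cong_add cong_refl)
      then show False using b0 ne by (simp add: cong_def)
    qed
    have cop_d: "coprime d p" using d0 dp p by (metis coprime_commute dvd_imp_le neq0_conv not_le prime_imp_coprime)
    \<comment> \<open>The powers of \<beta>^k multiply the nonzero difference d by all powers of the
      primitive root g and so reach every nonzero difference c.\<close>
    have all0: "(Inl (0, 0), Inl (0, c)) \<in> R" if c: "0 < c" "c < p" for c
    proof -
      obtain d' where d': "[d * d' = 1] (mod p)" using cong_solve_coprime_nat[OF cop_d] by auto
      have "coprime c p" using c p by (metis coprime_commute dvd_imp_le not_le prime_imp_coprime)
      moreover have "coprime d' p"
        using d' by (metis cong_imp_coprime cong_sym coprime_1_left coprime_mult_left_iff)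
      ultimately have cop: "coprime (c * d') p" by simp
      then have "\<not> p dvd c * d'" using p by (metis coprime_absorb_right not_prime_unit)
      then have "(c * d') mod p \<in> totatives p"
        using p1 by (simp add: totatives_prime[OF p] mod_greater_zero_iff_not_dvd)
      then obtain m where m: "(c * d') mod p = g ^ m mod p"
        using residue_primroot_is_generator[OF p1(1) g] by (auto simp: bij_betw_def)
      have "[g ^ m * d = c * d' * d] (mod p)" using m by (intro cong_mult cong_refl) (simp add: cong_def)
      also have "[c * d' * d = c * 1] (mod p)" using cong_mult[OF cong_refl[of c] d'] by (simp add: ac_simps)
      finally have "(g ^ m * d) mod p = c" using c by (simp add: cong_def)
      then show ?thesis using m\<beta>[OF d, of "k * m"] k p1 dp by (simp add: \<beta>_pow_k_mult)
    qed
    have all: "(Inl (j, u), Inl (j, v)) \<in> R" if uv: "j < k" "u < p" "v < p" "u \<noteq> v" for j u v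
    proof -
      define c where "c = (v + (p - u)) mod p"
      have cu: "(c + u) mod p = v" using uv by (simp add: c_def mod_add_left_eq)
      have "c > 0" using cu uv by (intro Nat.gr0I) auto
      moreover have "c < p" using p1 by (simp add: c_def)
      ultimately have "(Inl (0, 0), Inl (0, c)) \<in> R" by (rule all0)
      from m\<sigma>[OF _ this, of 0 u] have "(Inl (0, u), Inl (0, v)) \<in> R"
        using k uv cu \<open>c < p\<close> p1 by (simp add: \<sigma>_pow)
      from m\<beta>[OF this, of j] show ?thesis using \<beta>_pow_less[of 0 j] uv by simp
    qed
    let ?A = "{..<k} \<times> (SIGMA u:{..<p}. {..<p} - {u})"
    have "card ?A = k * (p * (p - 1))" by (simp add: card_cartesian_product card_Diff_singleton_if)
    moreover have "card ?A \<le> 2 * card G"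
      by (rule bound[of "\<lambda>(j, u, v). (Inl (j, u), Inl (j, v))"]) (auto simp: inj_on_def intro: all)
    ultimately show ?thesis by simp
  qed
  have \<sigma>_spread: "\<exists>m. (\<sigma> i ^^ m) (Inl (i, x)) = Inl (i, u)" if "x < p" "u < p" for i x u
    using hit[of x p u] that by (auto simp: \<sigma>_pow)
  have case_diff: "k * (p * p) \<le> 2 * card G"
    if xy: "(Inl (i, x), Inl (j, y)) \<in> R" "i \<noteq> j" for i j x y
  proof -
    have b: "i < k" "j < k" using RW[OF xy(1)] by auto
    \<comment> \<open>\<beta> shifts both block indices by one modulo k and keeps them distinct. The
      coordinates need no bookkeeping, since independent translations of the two blocks make them
      arbitrary afterwards.\<close>
    have step: "\<exists>x y. (Inl ((i + m) mod k, x), Inl ((j + m) mod k, y)) \<in> R" for m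
    proof (induction m)
      case 0
      then show ?case using b xy by auto
    next
      case (Suc m)
      then obtain x y where "(Inl ((i + m) mod k, x), Inl ((j + m) mod k, y)) \<in> R" by blast
      from m\<beta>[OF this, of 1] have R: "(\<beta> (Inl ((i + m) mod k, x)), \<beta> (Inl ((j + m) mod k, y))) \<in> R" by simp
      have "\<exists>u. \<beta> (Inl ((s + m) mod k, z)) = Inl ((s + Suc m) mod k, u)" for s z
        using k mod_less_divisor[OF k, of "s + m"] by (auto simp: mod_Suc)
      then show ?case using R by metis
    qed
    have spread: "(Inl (i', u), Inl (j', v)) \<in> R"
      if R: "(Inl (i', x), Inl (j', y)) \<in> R" and ne: "i' \<noteq> j'" and uv: "u < p" "v < p" for i' j' x y u v
    proof -
      have b: "i' < k" "j' < k" "x < p" "y < p" using RW[OF R] by auto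
      obtain m where m: "(x + m) mod p = u" using hit b uv by blast
      obtain m' where m': "(y + m') mod p = v" using hit b uv by blast
      have "(Inl (i', u), Inl (j', y)) \<in> R" using m\<sigma>[OF b(1) R, of m] ne b m by (simp add: \<sigma>_pow)
      from m\<sigma>[OF b(2) this, of m'] show ?thesis using ne b m' uv by (simp add: \<sigma>_pow)
    qed
    have "\<exists>j'. \<forall>u<p. \<forall>v<p. (Inl (i', u), Inl (j', v)) \<in> R" if i'k: "i' < k" for i'
    proof -
      obtain m where m: "(i + m) mod k = i'" using hit b i'k by blast
      have "(i + m) mod k \<noteq> (j + m) mod k"
      proof
        assume "(i + m) mod k = (j + m) mod k"
        then have "[i + m = j + m] (mod k)" by (simp add: cong_def)
        then have "[i = j] (mod k)" by (simp add: cong_add_rcancel_nat)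
        then show False using b xy by (simp add: cong_def)
      qed
      then show ?thesis using spread step[of m] m by metis
    qed
    \<comment> \<open>Every block i' is completely joined to some block \<open>J i'\<close>;
      counting by the first end gives k p^2 ordered pairs.\<close>
    then obtain J where J: "\<And>i' u v. i' < k \<Longrightarrow> u < p \<Longrightarrow> v < p \<Longrightarrow> (Inl (i', u), Inl (J i', v)) \<in> R" by metis
    have "card ({..<k} \<times> {..<p} \<times> {..<p}) \<le> 2 * card G"
      by (rule bound[of "\<lambda>(i', u, v). (Inl (i', u), Inl (J i', v))"]) (auto simp: inj_on_def intro: J)
    then show ?thesis by (simp add: card_cartesian_product)
  qed
  have case_mixed: "k * p * r \<le> 2 * card G" if xt: "(Inl (i, x), Inr t) \<in> R" for i x t
  proof -
    have b: "i < k" "x < p" "t < r" using RW[OF xt] by auto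
    have 0: "(Inl (0, (g * x) mod p), Inr t) \<in> R"
      using m\<beta>[OF xt, of "k - i"] \<beta>_pow_to_0[OF b(1)] by (simp add: \<beta>_pow_Inr)
    have "(Inl (j, u), Inr s) \<in> R" if js: "j < k" "u < p" "s < r" for j u s
    proof -
      obtain m where m: "((g * x) mod p + m) mod p = u" using hit js p1 by (metis mod_less_divisor)
      obtain m' where m': "(t + m') mod r = s" using hit js b by blast
      have "(Inl (0, u), Inr t) \<in> R" using m\<sigma>[OF k 0, of m] m p1 by (simp add: \<sigma>_pow \<sigma>_pow_Inr)
      from m\<beta>[OF this, of j] have "(Inl (j, u), Inr t) \<in> R"
        using \<beta>_pow_less[of 0 j] js by (simp add: \<beta>_pow_Inr)
      from m\<rho>[OF this, of m'] show ?thesis using b m' by (simp add: \<rho>_pow \<rho>_pow_Inl)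
    qed
    then have "card ({..<k} \<times> {..<p} \<times> {..<r}) \<le> 2 * card G"
      by (intro bound[of "\<lambda>(j, u, s). (Inl (j, u), Inr s)"]) (auto simp: inj_on_def)
    then show ?thesis by (simp add: card_cartesian_product mult.assoc)
  qed
  have case_field: "r * q \<le> 2 * card G" if tt: "(Inr t, Inr t') \<in> R" "t \<noteq> t'" for t t'
  proof -
    have b: "t < r" "t' < r" using RW[OF tt(1)] by auto
    define d where "d = (t' + (r - t)) mod r"
    have d: "(Inr 0, Inr d) \<in> R" using m\<rho>[OF tt(1), of "r - t"] b by (simp add: \<rho>_pow d_def)
    have dr: "d < r" using r1 by (simp add: d_def)
    have d0: "d \<noteq> 0"
    proof
      assume "d = 0"
      then have "[t' + (r - t) = 0] (mod r)" by (simp add: d_def cong_def)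
      then have "[t' + (r - t) + t = 0 + t] (mod r)" by (intro cong_add cong_refl)
      then show False using b tt(2) by (simp add: cong_def)
    qed
    have cop_d: "coprime d r" using d0 dr r by (metis coprime_commute dvd_imp_le neq0_conv not_le prime_imp_coprime)
    have R: "(Inr s, Inr ((h ^ m * d mod r + s) mod r)) \<in> R" if "s < r" for s m
    proof -
      have "(Inr 0, Inr (h ^ m * d mod r)) \<in> R" using m\<mu>[OF d, of m] dr r1 by (simp add: \<mu>_pow)
      from m\<rho>[OF this, of s] show ?thesis using that r1 by (simp add: \<rho>_pow)
    qed
    \<comment> \<open>The order of h divides the prime q and is not 1, so the q multiples of d by
      powers of h are distinct.\<close>
    have ordq: "ord r h = q"
    proof -
      have "ord r h dvd q" using h(1) by (simp only: ord_divides)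
      then have "ord r h = 1 \<or> ord r h = q" using q by (meson prime_nat_iff)
      moreover have "ord r h \<noteq> 1" using h(2) ord_divides[of h 1 r] by auto
      ultimately show ?thesis by simp
    qed
    have inj: "inj_on (\<lambda>(s, m). (Inr s :: (nat \<times> nat) + nat, Inr ((h ^ m * d mod r + s) mod r) :: (nat \<times> nat) + nat)) ({..<r} \<times> {..<q})"
    proof (rule inj_onI, clarify, intro conjI)
      fix s m m' assume m: "m < q" "m' < q"
        and "(h ^ m * d mod r + s) mod r = (h ^ m' * d mod r + s) mod r"
      then have "[h ^ m * d + s = h ^ m' * d + s] (mod r)" by (simp add: cong_def mod_add_left_eq)
      then have "[h ^ m * d = h ^ m' * d] (mod r)" by (simp add: cong_add_rcancel_nat)
      then have "[h ^ m = h ^ m'] (mod r)" using cop_d by (simp add: cong_mult_rcancel_nat)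
      then have "[m = m'] (mod q)"
        using order_divides_expdiff[of r h m m'] h_cop by (simp add: ordq coprime_commute)
      then show "m = m'" using m by (simp add: cong_def)
    qed (rule refl)
    have "card ({..<r} \<times> {..<q}) \<le> 2 * card G"
      by (rule bound[OF inj]) (auto intro: R)
    then show ?thesis by (simp add: card_cartesian_product)
  qed
  obtain a b where ab: "(a, b) \<in> R" "a \<noteq> b" using adj_nonempty[OF G] by (auto simp: R_def)
  from RW[OF ab(1)] show ?thesis
  proof (elim W_cases)
    fix i x j y assume e: "a = Inl (i, x)" "b = Inl (j, y)"
    show ?thesis
    proof (cases "i = j")
      case True
      then show ?thesis using case_same[of i x y] ab e by auto
    next
      case False
      then have "k * (p * p) \<le> 2 * card G" using case_diff[of i x j y] ab e by auto
      moreover have "k * (p * (p - 1)) \<le> k * (p * p)" by (intro mult_le_mono) auto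
      ultimately show ?thesis by linarith
    qed
  next
    fix i x t assume "a = Inl (i, x)" "b = Inr t"
    then show ?thesis using case_mixed ab by auto
  next
    fix i x t assume "a = Inr t" "b = Inl (i, x)"
    then show ?thesis using case_mixed sym[OF ab(1)] by auto
  next
    fix t t' assume "a = Inr t" "b = Inr t'"
    then show ?thesis using case_field ab by auto
  qed
qed

end

lemma evasive_of_prime_decomposition:
  fixes p q r k n :: nat
  assumes p: "prime p" and r: "prime r" and q: "prime q" "q dvd r - 1" and k: "k > 0"
    and cop: "coprime (k * (p - 1)) r" and n: "n = p * k + r"
    and P: "graph_property n \<P>" "nontrivial_property n \<P>" "monotone_property \<P>"
    and small: "\<And>G. G \<in> \<P> \<Longrightarrow> 2 * card G < k * (p * (p - 1)) \<and> 2 * card G < r * q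
      \<and> 2 * card G < k * p * r"
  shows "evasive_property n \<P>"
proof (rule ccontr)
  assume ne: "\<not> evasive_property n \<P>"
  obtain g where g: "residue_primroot p g"
    using prime_primitive_root_exists[of p] p prime_gt_1_nat by auto
  obtain \<gamma> where \<gamma>: "residue_primroot r \<gamma>"
    using prime_primitive_root_exists[of r] r prime_gt_1_nat by auto
  \<comment> \<open>A power of the primitive root modulo r whose order is exactly q.\<close>
  define h where "h = \<gamma> ^ ((r - 1) div q)"
  have ord: "ord r \<gamma> = r - 1" using \<gamma> r by (simp add: residue_primroot_def totient_prime)
  have r1: "r - 1 > 0" using r prime_gt_1_nat[OF r] by simp
  have "h ^ q = \<gamma> ^ (r - 1)" using q(2) by (simp add: h_def power_mult[symmetric])
  then have h1: "[h ^ q = 1] (mod r)" using ord_divides[of \<gamma> "r - 1" r] by (simp add: ord)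
  have h2: "\<not> [h = 1] (mod r)"
  proof
    assume "[h = 1] (mod r)"
    then have "r - 1 dvd (r - 1) div q" using ord_divides[of \<gamma> "(r - 1) div q" r] by (simp add: ord h_def)
    moreover have "0 < (r - 1) div q" using q r1 by (metis dvd_div_eq_0_iff gr0I less_irrefl)
    ultimately have "r - 1 \<le> (r - 1) div q" by (rule dvd_imp_le)
    moreover have "(r - 1) div q < r - 1" using r1 prime_gt_1_nat[OF q(1)] by simp
    ultimately show False by simp
  qed
  interpret block_group p k r q g h
    by standard (use p r q k cop g h1 h2 in auto)
  obtain \<phi> where "bij_betw \<phi> W {1..n}"
    using finite_same_card_bij[OF finite_W, of "{1..n}"] card_W n by auto
  then interpret block_action p k r q g h n \<phi> by unfold_locales
  obtain G where G: "G \<in> \<P>" "G \<noteq> {}" "\<And>i. i < k \<Longrightarrow> act (\<sigma> i) G = G"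
    "act \<beta> G = G" "act \<rho> G = G" "act \<mu> G = G"
    using invariant_graph_exists[OF P ne] by blast
  have "G \<subseteq> vertex_pairs n" using G(1) P(1) by (auto simp: graph_property_def)
  from invariant_graph_large[OF this G(2-6)] small[OF G(1)] show False by linarith
qed

subsection \<open>The large sieve inequality for prime moduli\<close>

definition unit_exp :: "real \<Rightarrow> complex" where
  "unit_exp x = cis (2 * pi * x)"

lemma unit_exp_add: "unit_exp (x + y) = unit_exp x * unit_exp y"
  by (simp add: unit_exp_def cis_mult distrib_left)

lemma unit_exp_cnj: "cnj (unit_exp x) = unit_exp (- x)"
  by (simp add: unit_exp_def cis_cnj)

lemma norm_unit_exp [simp]: "norm (unit_exp x) = 1"
  by (simp add: unit_exp_def)

lemma unit_exp_int [simp]: "unit_exp (of_int z) = 1"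
  by (simp add: unit_exp_def)

lemma unit_exp_0 [simp]: "unit_exp 0 = 1"
  by (simp add: unit_exp_def)

lemma unit_exp_power: "unit_exp x ^ n = unit_exp (real n * x)"
  by (simp add: unit_exp_def Complex.DeMoivre mult.left_commute)

text \<open>A weak form of Jordan's inequality: on this range x^2 < 3, so the cubic Taylor term is
  at most x / 2.\<close>

lemma sin_ge_half:
  assumes "0 \<le> x" "x \<le> pi / 2"
  shows "x / 2 \<le> sin x"
proof -
  have "\<bar>sin x - (\<Sum>m<3. sin_coeff m * x ^ m)\<bar> \<le> inverse (fact 3) * \<bar>x\<bar> ^ 3"
    by (rule Maclaurin_sin_bound)
  moreover have "(\<Sum>m<3. sin_coeff m * x ^ m) = x"
    by (simp add: numeral_3_eq_3 sin_coeff_def)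
  moreover have "inverse (fact 3) * \<bar>x\<bar> ^ 3 = x ^ 3 / 6"
    using assms by (simp add: fact_numeral field_simps)
  ultimately have 1: "sin x \<ge> x - x ^ 3 / 6" by linarith
  have "x \<le> 1.6" using assms pi_approx by simp
  then have "x * x \<le> 1.6 * 1.6" using assms by (intro mult_mono) auto
  then have "x * (x * x) \<le> x * 3" using assms by (intro mult_left_mono) auto
  then have "x ^ 3 / 6 \<le> x / 2" by (simp add: power3_eq_cube)
  with 1 show ?thesis by simp
qed

lemma norm_one_minus_unit_exp:
  assumes "0 < x" "x \<le> 1 / 2"
  shows "2 * x \<le> norm (1 - unit_exp x)"
proof -
  have "(norm (1 - unit_exp x))\<^sup>2 = (1 - cos (2 * pi * x))\<^sup>2 + (sin (2 * pi * x))\<^sup>2"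
    by (simp add: cmod_power2 unit_exp_def)
  also have "\<dots> = 2 - 2 * cos (2 * pi * x)"
    using sin_cos_squared_add[of "2 * pi * x"] by (simp add: power2_eq_square algebra_simps)
  also have "\<dots> = (2 * sin (pi * x))\<^sup>2"
    using cos_double_sin[of "pi * x"] by (simp add: mult.assoc power2_eq_square)
  finally have eq: "(norm (1 - unit_exp x))\<^sup>2 = (2 * sin (pi * x))\<^sup>2" .
  have "pi * x / 2 \<le> sin (pi * x)"
    by (rule sin_ge_half) (use assms in auto)
  moreover have "2 * x \<le> pi * x" using assms pi_ge_two by (intro mult_right_mono) auto
  ultimately have "2 * x \<le> 2 * sin (pi * x)" by simp
  moreover have "2 * sin (pi * x) \<le> norm (1 - unit_exp x)"
    by (rule power2_le_imp_le[OF eq_refl[OF eq[symmetric]]]) simp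
  ultimately show ?thesis by simp
qed

text \<open>The natural bound is the inverse square of the distance from x to the nearest integer.
  It is majorized by a sum over both neighbours 0 and 1, because the two terms are later summed
  separately over a spaced set.\<close>

lemma norm_geometric_unit_exp:
  assumes "0 < x" "x < 1"
  shows "(norm (\<Sum>n<N. unit_exp (real n * x)))\<^sup>2 \<le> 1 / x\<^sup>2 + 1 / (1 - x)\<^sup>2"
proof -
  define d where "d = min x (1 - x)"
  have d: "0 < d" "d \<le> 1 / 2" using assms by (auto simp: d_def min_def)
  have nd: "2 * d \<le> norm (1 - unit_exp x)"
  proof (cases "x \<le> 1 / 2")
    case True
    then show ?thesis using norm_one_minus_unit_exp[of x] assms by (simp add: d_def)
  next
    case False
    have "unit_exp (1 - x) = cnj (unit_exp x)"
      using unit_exp_add[of 1 "- x"] unit_exp_int[of 1] by (simp add: unit_exp_cnj)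
    then have "1 - unit_exp (1 - x) = cnj (1 - unit_exp x)" by simp
    then have "norm (1 - unit_exp (1 - x)) = norm (1 - unit_exp x)" by (metis complex_mod_cnj)
    then show ?thesis using norm_one_minus_unit_exp[of "1 - x"] False assms by (simp add: d_def)
  qed
  let ?S = "\<Sum>n<N. unit_exp (real n * x)"
  have "?S = (\<Sum>n<N. unit_exp x ^ n)" by (simp add: unit_exp_power)
  then have "(1 - unit_exp x) * ?S = 1 - unit_exp x ^ N" by (simp add: one_diff_power_eq)
  then have "norm (1 - unit_exp x) * norm ?S = norm (1 - unit_exp x ^ N)" by (metis norm_mult)
  also have "\<dots> \<le> 1 + 1" by (rule order_trans[OF norm_triangle_ineq4]) (simp add: norm_power)
  finally have "norm (1 - unit_exp x) * norm ?S \<le> 2" by simp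
  moreover have "2 * d * norm ?S \<le> norm (1 - unit_exp x) * norm ?S" by (rule mult_right_mono[OF nd]) simp
  ultimately have "norm ?S \<le> 1 / d" using d by (simp add: field_simps)
  then have "(norm ?S)\<^sup>2 \<le> (1 / d)\<^sup>2" by (intro power_mono) auto
  also have "(1 / d)\<^sup>2 \<le> 1 / x\<^sup>2 + 1 / (1 - x)\<^sup>2" by (auto simp: d_def min_def power_divide)
  finally show ?thesis .
qed

lemma sum_inverse_squares_le: "finite M \<Longrightarrow> 0 \<notin> M \<Longrightarrow> (\<Sum>m\<in>M. 1 / (real m)\<^sup>2) \<le> 2"
proof -
  assume M: "finite M" "0 \<notin> M"
  have *: "(\<Sum>m=1..N. 1 / (real m)\<^sup>2) \<le> 2 - 1 / real N" if "N \<ge> 1" for N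
    using that
  proof (induction N rule: nat_induct_at_least)
    case (Suc N)
    have "1 / (real (Suc N))\<^sup>2 \<le> 1 / (real N * real (Suc N))"
      using Suc by (intro divide_left_mono) (auto simp: power2_eq_square)
    also have "\<dots> = 1 / real N - 1 / real (Suc N)" using Suc by (simp add: field_simps)
    finally show ?case using Suc by simp
  qed simp
  define N where "N = Max (insert 1 M)"
  have "M \<subseteq> {1..N}" using M by (auto simp: N_def Suc_le_eq intro!: Nat.gr0I)
  then have "(\<Sum>m\<in>M. 1 / (real m)\<^sup>2) \<le> (\<Sum>m=1..N. 1 / (real m)\<^sup>2)" by (intro sum_mono2) auto
  also have "\<dots> \<le> 2 - 1 / real N" using M by (intro *) (simp add: N_def)
  also have "\<dots> \<le> 2" by simp
  finally show ?thesis .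
qed

text \<open>Separation by \<delta> on the circle of reals modulo 1; the integer z runs over the
  lifts of a difference.\<close>

definition spaced :: "real \<Rightarrow> 'j set \<Rightarrow> ('j \<Rightarrow> real) \<Rightarrow> bool" where
  "spaced \<delta> J \<theta> \<longleftrightarrow> (\<forall>j\<in>J. \<forall>l\<in>J. j \<noteq> l \<longrightarrow> (\<forall>z::int. \<bar>\<theta> j - \<theta> l - of_int z\<bar> \<ge> \<delta>))"

text \<open>Rounding \<open>f l / \<delta>\<close> down is injective on J and takes values at least
  1, which reduces the sum to one of inverse squares of distinct positive integers.\<close>

lemma sum_inverse_squares_spaced:
  fixes f :: "'j \<Rightarrow> real"
  assumes J: "finite J" and \<delta>: "\<delta> > 0" and low: "\<And>l. l \<in> J \<Longrightarrow> f l \<ge> \<delta>"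
    and sep: "\<And>j l. j \<in> J \<Longrightarrow> l \<in> J \<Longrightarrow> j \<noteq> l \<Longrightarrow> \<bar>f j - f l\<bar> \<ge> \<delta>"
  shows "(\<Sum>l\<in>J. 1 / (f l)\<^sup>2) \<le> 2 / \<delta>\<^sup>2"
proof -
  define m where "m l = nat \<lfloor>f l / \<delta>\<rfloor>" for l
  have m: "1 \<le> m l" "real (m l) * \<delta> \<le> f l" "f l < (real (m l) + 1) * \<delta>" if "l \<in> J" for l
  proof -
    have "1 \<le> f l / \<delta>" using low[OF that] \<delta> by simp
    then have fl: "1 \<le> \<lfloor>f l / \<delta>\<rfloor>" by linarith
    then show "1 \<le> m l" unfolding m_def by linarith
    have "real (m l) = of_int \<lfloor>f l / \<delta>\<rfloor>" using fl by (simp add: m_def)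
    then have "real (m l) \<le> f l / \<delta>" "f l / \<delta> < real (m l) + 1" by linarith+
    then show "real (m l) * \<delta> \<le> f l" "f l < (real (m l) + 1) * \<delta>" using \<delta> by (auto simp: field_simps)
  qed
  have inj: "inj_on m J"
  proof (rule inj_onI, rule ccontr)
    fix j l assume jl: "j \<in> J" "l \<in> J" "m j = m l" "j \<noteq> l"
    have "\<bar>f j - f l\<bar> < \<delta>" using m(2,3)[OF jl(1)] m(2,3)[OF jl(2)] jl(3) by (auto simp: abs_less_iff algebra_simps)
    with sep[OF jl(1,2,4)] show False by simp
  qed
  have "(\<Sum>l\<in>J. 1 / (f l)\<^sup>2) \<le> (\<Sum>l\<in>J. 1 / (real (m l))\<^sup>2 / \<delta>\<^sup>2)"
  proof (rule sum_mono)
    fix l assume l: "l \<in> J"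
    have "(real (m l) * \<delta>)\<^sup>2 \<le> (f l)\<^sup>2" using m[OF l] \<delta> by (intro power_mono) auto
    then have "1 / (f l)\<^sup>2 \<le> 1 / (real (m l) * \<delta>)\<^sup>2" using m(1)[OF l] \<delta> by (intro divide_left_mono) (auto simp: zero_less_mult_iff)
    then show "1 / (f l)\<^sup>2 \<le> 1 / (real (m l))\<^sup>2 / \<delta>\<^sup>2" by (simp add: power_mult_distrib)
  qed
  also have "\<dots> = (\<Sum>l\<in>J. 1 / (real (m l))\<^sup>2) / \<delta>\<^sup>2" by (simp add: sum_divide_distrib)
  also have "(\<Sum>l\<in>J. 1 / (real (m l))\<^sup>2) = (\<Sum>i\<in>m ` J. 1 / (real i)\<^sup>2)" by (simp add: sum.reindex[OF inj])
  also have "\<dots> \<le> 2" by (rule sum_inverse_squares_le) (use J m(1) in force)+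
  finally show ?thesis using \<delta> by (simp add: divide_right_mono)
qed

lemma unit_exp_frac: "unit_exp (real n * frac x) = unit_exp (real n * x)"
proof -
  have "real n * frac x = real n * x + of_int (- (int n * \<lfloor>x\<rfloor>))" by (simp add: frac_def algebra_simps)
  then show ?thesis by (simp only: unit_exp_add unit_exp_int mult_1_right)
qed

text \<open>The term l = j gives the square of N. For the others, the fractional parts of the
  differences and their complements to 1 are at least \<delta> and pairwise \<delta>-separated, and
  each family contributes at most 2 / \<delta>^2.\<close>

lemma sum_fejer_spaced:
  assumes J: "finite J" and \<delta>: "\<delta> > 0" and sp: "spaced \<delta> J \<theta>" and j: "j \<in> J"
  shows "(\<Sum>l\<in>J. (norm (\<Sum>n<N. unit_exp (real n * (\<theta> j - \<theta> l))))\<^sup>2) \<le> (real N)\<^sup>2 + 4 / \<delta>\<^sup>2"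
proof -
  let ?F = "\<lambda>l. (norm (\<Sum>n<N. unit_exp (real n * (\<theta> j - \<theta> l))))\<^sup>2"
  define f where "f l = frac (\<theta> j - \<theta> l)" for l
  let ?J = "J - {j}"
  have low: "f l \<ge> \<delta>" "1 - f l \<ge> \<delta>" if "l \<in> ?J" for l
  proof -
    have *: "\<bar>\<theta> j - \<theta> l - of_int z\<bar> \<ge> \<delta>" for z using sp j that by (auto simp: spaced_def)
    show "f l \<ge> \<delta>" using *[of "\<lfloor>\<theta> j - \<theta> l\<rfloor>"] frac_ge_0[of "\<theta> j - \<theta> l"] by (simp add: f_def frac_def)
    show "1 - f l \<ge> \<delta>" using *[of "\<lfloor>\<theta> j - \<theta> l\<rfloor> + 1"] frac_lt_1[of "\<theta> j - \<theta> l"] by (simp add: f_def frac_def)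
  qed
  have sep: "\<bar>f i - f l\<bar> \<ge> \<delta>" if "i \<in> ?J" "l \<in> ?J" "i \<noteq> l" for i l
  proof -
    have "\<bar>\<theta> l - \<theta> i - of_int z\<bar> \<ge> \<delta>" for z
      using sp that by (auto simp: spaced_def)
    from this[of "\<lfloor>\<theta> j - \<theta> i\<rfloor> - \<lfloor>\<theta> j - \<theta> l\<rfloor>"] show ?thesis by (simp add: f_def frac_def algebra_simps)
  qed
  have "(\<Sum>l\<in>?J. ?F l) \<le> (\<Sum>l\<in>?J. 1 / (f l)\<^sup>2 + 1 / (1 - f l)\<^sup>2)"
  proof (rule sum_mono)
    fix l assume l: "l \<in> ?J"
    have "?F l = (norm (\<Sum>n<N. unit_exp (real n * f l)))\<^sup>2" by (simp add: f_def unit_exp_frac)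
    also have "\<dots> \<le> 1 / (f l)\<^sup>2 + 1 / (1 - f l)\<^sup>2"
      using low[OF l] \<delta> by (intro norm_geometric_unit_exp) auto
    finally show "?F l \<le> 1 / (f l)\<^sup>2 + 1 / (1 - f l)\<^sup>2" .
  qed
  also have "\<dots> = (\<Sum>l\<in>?J. 1 / (f l)\<^sup>2) + (\<Sum>l\<in>?J. 1 / (1 - f l)\<^sup>2)" by (rule sum.distrib)
  also have "\<dots> \<le> 2 / \<delta>\<^sup>2 + 2 / \<delta>\<^sup>2"
  proof (rule add_mono)
    show "(\<Sum>l\<in>?J. 1 / (f l)\<^sup>2) \<le> 2 / \<delta>\<^sup>2"
      by (rule sum_inverse_squares_spaced) (use J \<delta> low sep in auto)
    show "(\<Sum>l\<in>?J. 1 / (1 - f l)\<^sup>2) \<le> 2 / \<delta>\<^sup>2"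
    proof (rule sum_inverse_squares_spaced)
      show "\<delta> \<le> \<bar>1 - f i - (1 - f l)\<bar>" if "i \<in> ?J" "l \<in> ?J" "i \<noteq> l" for i l
        using sep[OF that] by (simp add: abs_minus_commute)
    qed (use J \<delta> low in auto)
  qed
  finally have "(\<Sum>l\<in>?J. ?F l) \<le> 4 / \<delta>\<^sup>2" by simp
  moreover have "(\<Sum>l\<in>J. ?F l) = ?F j + (\<Sum>l\<in>?J. ?F l)" using J j by (rule sum.remove)
  moreover have "?F j = (real N)\<^sup>2" by simp
  ultimately show ?thesis by simp
qed

text \<open>The squared norms are summed over all differences u - v with u, v < 2 H, not just over n
  < H: the expansion then has the nonnegative Fejer-type kernel F, and its row sums bound the
  quadratic form. The factor 8 H arises from (2 H)^2 + 4 / \<delta>^2 <= 8 H^2 after division by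
  H.\<close>

lemma large_sieve_dual:
  fixes b :: "'j \<Rightarrow> complex"
  assumes J: "finite J" and \<delta>: "\<delta> > 0" and sp: "spaced \<delta> J \<theta>" and H: "real H \<ge> 1 / \<delta>"
  shows "(\<Sum>n<H. (norm (\<Sum>j\<in>J. b j * unit_exp (real n * \<theta> j)))\<^sup>2) \<le> 8 * real H * (\<Sum>j\<in>J. (norm (b j))\<^sup>2)"
proof -
  define f where "f x = (\<Sum>j\<in>J. b j * unit_exp (x * \<theta> j))" for x :: real
  define F where "F j l = (norm (\<Sum>n<2*H. unit_exp (real n * (\<theta> j - \<theta> l))))\<^sup>2" for j l
  let ?I = "{..<2*H}"
  have H0: "real H > 0" using H \<delta> by (meson divide_pos_pos less_le_trans zero_less_one)
  have F0: "F j l \<ge> 0" for j l by (simp add: F_def)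
  have cnj_sum: "complex_of_real (F j l) = (\<Sum>u\<in>?I. \<Sum>v\<in>?I. unit_exp ((real u - real v) * (\<theta> j - \<theta> l)))" for j l
  proof -
    let ?S = "\<Sum>n\<in>?I. unit_exp (real n * (\<theta> j - \<theta> l))"
    have "complex_of_real (F j l) = ?S * cnj ?S" unfolding F_def by (rule complex_norm_square)
    also have "\<dots> = (\<Sum>u\<in>?I. \<Sum>v\<in>?I. unit_exp (real u * (\<theta> j - \<theta> l)) * unit_exp (- (real v * (\<theta> j - \<theta> l))))"
      by (simp add: sum_product unit_exp_cnj)
    also have "\<dots> = (\<Sum>u\<in>?I. \<Sum>v\<in>?I. unit_exp ((real u - real v) * (\<theta> j - \<theta> l)))"
      by (simp add: unit_exp_add[symmetric] left_diff_distrib)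
    finally show ?thesis .
  qed
  have sq: "complex_of_real ((norm (f x))\<^sup>2) = (\<Sum>j\<in>J. \<Sum>l\<in>J. b j * cnj (b l) * unit_exp (x * (\<theta> j - \<theta> l)))" for x
  proof -
    have "complex_of_real ((norm (f x))\<^sup>2) = f x * cnj (f x)" by (rule complex_norm_square)
    also have "\<dots> = (\<Sum>j\<in>J. \<Sum>l\<in>J. (b j * unit_exp (x * \<theta> j)) * (cnj (b l) * unit_exp (- (x * \<theta> l))))"
      unfolding f_def by (simp add: sum_product unit_exp_cnj)
    also have "\<dots> = (\<Sum>j\<in>J. \<Sum>l\<in>J. b j * cnj (b l) * unit_exp (x * (\<theta> j - \<theta> l)))"
    proof (intro sum.cong refl)
      fix j l
      have "unit_exp (x * \<theta> j) * unit_exp (- (x * \<theta> l)) = unit_exp (x * (\<theta> j - \<theta> l))"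
        by (simp add: unit_exp_add[symmetric] right_diff_distrib)
      then show "(b j * unit_exp (x * \<theta> j)) * (cnj (b l) * unit_exp (- (x * \<theta> l))) = b j * cnj (b l) * unit_exp (x * (\<theta> j - \<theta> l))"
        by (metis (no_types, lifting) mult.assoc mult.left_commute)
    qed
    finally show ?thesis .
  qed
  have half: "(x + x) / 2 = x" for x :: real by simp
  define T where "T = (\<Sum>u\<in>?I. \<Sum>v\<in>?I. (norm (f (real u - real v)))\<^sup>2)"
  have "complex_of_real T = (\<Sum>u\<in>?I. \<Sum>v\<in>?I. \<Sum>j\<in>J. \<Sum>l\<in>J. b j * cnj (b l) * unit_exp ((real u - real v) * (\<theta> j - \<theta> l)))"
    unfolding T_def of_real_sum sq ..
  also have "\<dots> = (\<Sum>j\<in>J. \<Sum>l\<in>J. \<Sum>u\<in>?I. \<Sum>v\<in>?I. b j * cnj (b l) * unit_exp ((real u - real v) * (\<theta> j - \<theta> l)))"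
    by (subst sum.swap, subst (2) sum.swap, subst sum.swap) (simp only: sum.swap[of _ ?I J])
  also have "\<dots> = (\<Sum>j\<in>J. \<Sum>l\<in>J. b j * cnj (b l) * F j l)"
    unfolding cnj_sum by (simp add: sum_distrib_left)
  finally have "T \<le> norm (\<Sum>j\<in>J. \<Sum>l\<in>J. b j * cnj (b l) * F j l)"
    by (metis abs_ge_self norm_of_real)
  also have "\<dots> \<le> (\<Sum>j\<in>J. \<Sum>l\<in>J. norm (b j * cnj (b l) * F j l))"
    by (intro sum_norm_le order_refl)
  \<comment> \<open>Schur's test: the product of norms is at most the mean of their squares, and F
    is nonnegative and symmetric.\<close>
  also have "\<dots> \<le> (\<Sum>j\<in>J. \<Sum>l\<in>J. ((norm (b j))\<^sup>2 * F j l + (norm (b l))\<^sup>2 * F j l) / 2)"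
  proof (intro sum_mono)
    fix j l
    have "2 * (norm (b j) * norm (b l)) \<le> (norm (b j))\<^sup>2 + (norm (b l))\<^sup>2"
      using sum_squares_bound[of "norm (b j)" "norm (b l)"] by (simp add: mult.assoc)
    then have "2 * (norm (b j) * norm (b l)) * F j l \<le> ((norm (b j))\<^sup>2 + (norm (b l))\<^sup>2) * F j l"
      by (rule mult_right_mono) (simp add: F_def)
    moreover have "norm (b j * cnj (b l) * F j l) = norm (b j) * norm (b l) * F j l"
      using F0[of j l] by (simp add: norm_mult)
    ultimately show "norm (b j * cnj (b l) * F j l) \<le> ((norm (b j))\<^sup>2 * F j l + (norm (b l))\<^sup>2 * F j l) / 2"
      by (simp add: algebra_simps)
  qed
  also have "\<dots> = ((\<Sum>j\<in>J. \<Sum>l\<in>J. (norm (b j))\<^sup>2 * F j l) + (\<Sum>j\<in>J. \<Sum>l\<in>J. (norm (b l))\<^sup>2 * F j l)) / 2"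
    by (simp only: sum_divide_distrib[symmetric] sum.distrib)
  also have "(\<Sum>j\<in>J. \<Sum>l\<in>J. (norm (b l))\<^sup>2 * F j l) = (\<Sum>j\<in>J. \<Sum>l\<in>J. (norm (b j))\<^sup>2 * F j l)"
  proof -
    have "F j l = F l j" for j l
    proof -
      have "(\<Sum>n\<in>?I. unit_exp (real n * (\<theta> j - \<theta> l))) = cnj (\<Sum>n\<in>?I. unit_exp (real n * (\<theta> l - \<theta> j)))"
        by (simp add: unit_exp_cnj right_diff_distrib)
      then show ?thesis unfolding F_def by (metis complex_mod_cnj)
    qed
    then show ?thesis by (subst sum.swap) simp
  qed
  also have "((\<Sum>j\<in>J. \<Sum>l\<in>J. (norm (b j))\<^sup>2 * F j l) + (\<Sum>j\<in>J. \<Sum>l\<in>J. (norm (b j))\<^sup>2 * F j l)) / 2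
      = (\<Sum>j\<in>J. \<Sum>l\<in>J. (norm (b j))\<^sup>2 * F j l)" by (rule half)
  also have "\<dots> = (\<Sum>j\<in>J. (norm (b j))\<^sup>2 * (\<Sum>l\<in>J. F j l))" by (simp only: sum_distrib_left)
  also have "\<dots> \<le> (\<Sum>j\<in>J. (norm (b j))\<^sup>2 * (8 * (real H)\<^sup>2))"
  proof (intro sum_mono mult_left_mono)
    fix j assume "j \<in> J"
    then have "(\<Sum>l\<in>J. F j l) \<le> (real (2 * H))\<^sup>2 + 4 / \<delta>\<^sup>2"
      unfolding F_def by (rule sum_fejer_spaced[OF J \<delta> sp])
    moreover have "1 / \<delta>\<^sup>2 \<le> (real H)\<^sup>2"
      using power_mono[OF H, of 2] \<delta> by (simp add: power_divide)
    ultimately show "(\<Sum>l\<in>J. F j l) \<le> 8 * (real H)\<^sup>2" by (simp add: power_mult_distrib)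
  qed simp
  finally have Tle: "T \<le> 8 * (real H)\<^sup>2 * (\<Sum>j\<in>J. (norm (b j))\<^sup>2)"
    unfolding sum_distrib_right[symmetric] by (simp add: mult.commute)
  \<comment> \<open>Each n < H is the difference of the H pairs (n + v, v) with v < H, all of which
    lie in the square of side 2 H.\<close>
  have "real H * (\<Sum>n<H. (norm (f (real n)))\<^sup>2) = (\<Sum>(n, v)\<in>{..<H} \<times> {..<H}. (norm (f (real n)))\<^sup>2)"
    by (simp add: sum.cartesian_product[symmetric] sum_distrib_left)
  also have "\<dots> = (\<Sum>(u, v)\<in>(\<lambda>(n, v). (n + v, v)) ` ({..<H} \<times> {..<H}). (norm (f (real u - real v)))\<^sup>2)"
    by (subst sum.reindex) (auto simp: inj_on_def intro!: sum.cong)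
  also have "\<dots> \<le> (\<Sum>(u, v)\<in>?I \<times> ?I. (norm (f (real u - real v)))\<^sup>2)"
    by (rule sum_mono2) auto
  also have "\<dots> = T" by (simp add: T_def sum.cartesian_product)
  finally have "real H * (\<Sum>n<H. (norm (f (real n)))\<^sup>2) \<le> 8 * (real H)\<^sup>2 * (\<Sum>j\<in>J. (norm (b j))\<^sup>2)"
    using Tle by simp
  then have "real H * (\<Sum>n<H. (norm (f (real n)))\<^sup>2) \<le> real H * (8 * real H * (\<Sum>j\<in>J. (norm (b j))\<^sup>2))"
    by (simp add: power2_eq_square mult.assoc mult.left_commute)
  then show ?thesis using H0 unfolding f_def by (simp only: mult_le_cancel_left_pos)
qed

text \<open>Duality: T is the sum over A of the trigonometric polynomial f whose coefficients are
  the conjugates of \<open>S j\<close>. Cauchy-Schwarz and the dual inequality bound T^2 by 8 H T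
  times the cardinality of A.\<close>

lemma large_sieve:
  assumes J: "finite J" and \<delta>: "\<delta> > 0" and sp: "spaced \<delta> J \<theta>" and H: "real H \<ge> 1 / \<delta>"
    and A: "A \<subseteq> {..<H}"
  shows "(\<Sum>j\<in>J. (norm (\<Sum>n\<in>A. unit_exp (real n * \<theta> j)))\<^sup>2) \<le> 8 * real H * real (card A)"
proof -
  define S where "S j = (\<Sum>n\<in>A. unit_exp (real n * \<theta> j))" for j
  define T where "T = (\<Sum>j\<in>J. (norm (S j))\<^sup>2)"
  define f where "f n = (\<Sum>j\<in>J. cnj (S j) * unit_exp (real n * \<theta> j))" for n
  have T0: "T \<ge> 0" unfolding T_def by (intro sum_nonneg) simp
  have "complex_of_real T = (\<Sum>j\<in>J. S j * cnj (S j))"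
    unfolding T_def of_real_sum complex_norm_square ..
  also have "\<dots> = (\<Sum>j\<in>J. \<Sum>n\<in>A. cnj (S j) * unit_exp (real n * \<theta> j))"
  proof (rule sum.cong[OF refl])
    fix j
    have "S j * c = (\<Sum>n\<in>A. c * unit_exp (real n * \<theta> j))" for c
      by (simp add: S_def sum_distrib_left mult.commute)
    then show "S j * cnj (S j) = (\<Sum>n\<in>A. cnj (S j) * unit_exp (real n * \<theta> j))" .
  qed
  also have "\<dots> = (\<Sum>n\<in>A. f n)" unfolding f_def by (rule sum.swap)
  finally have "T \<le> norm (\<Sum>n\<in>A. f n)" by (metis abs_ge_self norm_of_real)
  also have "\<dots> \<le> (\<Sum>n\<in>A. norm (f n))" by (rule norm_sum)
  finally have "T\<^sup>2 \<le> (\<Sum>n\<in>A. 1 * norm (f n))\<^sup>2" using T0 by (intro power_mono) auto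
  also have "\<dots> \<le> (\<Sum>n\<in>A. 1\<^sup>2) * (\<Sum>n\<in>A. (norm (f n))\<^sup>2)" by (rule Cauchy_Schwarz_ineq_sum)
  also have "\<dots> \<le> real (card A) * (\<Sum>n<H. (norm (f n))\<^sup>2)"
    using A by (auto intro!: mult_left_mono sum_mono2)
  also have "\<dots> \<le> real (card A) * (8 * real H * T)"
    using large_sieve_dual[OF J \<delta> sp H, of "\<lambda>j. cnj (S j)"] by (intro mult_left_mono) (auto simp: f_def T_def)
  finally have "T * T \<le> 8 * real H * real (card A) * T" by (simp add: power2_eq_square mult.commute mult.left_commute)
  then have "T \<le> 8 * real H * real (card A)" using T0 by (cases "T = 0") (auto simp: mult_le_cancel_right)
  then show ?thesis by (simp add: T_def S_def)
qed

lemma sum_unit_exp_mod: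
  fixes p :: nat and z :: int
  assumes "p > 0"
  shows "(\<Sum>a<p. unit_exp (of_int z * (real a / real p))) = (if int p dvd z then of_nat p else 0)"
proof (cases "int p dvd z")
  case True
  then obtain m where "z = int p * m" by auto
  then have "of_int z * (real a / real p) = of_int (m * int a)" for a using assms by simp
  then have "unit_exp (of_int z * (real a / real p)) = 1" for a by (simp only: unit_exp_int)
  then show ?thesis using True by simp
next
  case False
  define \<omega> where "\<omega> = unit_exp (of_int z / real p)"
  have "unit_exp (of_int z * (real a / real p)) = \<omega> ^ a" for a
    by (simp add: \<omega>_def unit_exp_power mult.commute)
  then have S: "(\<Sum>a<p. unit_exp (of_int z * (real a / real p))) = (\<Sum>a<p. \<omega> ^ a)" by simp
  have "\<omega> ^ p = unit_exp (of_int z)" using assms by (simp add: \<omega>_def unit_exp_power del: unit_exp_int)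
  then have "(1 - \<omega>) * (\<Sum>a<p. \<omega> ^ a) = 0" by (simp flip: one_diff_power_eq)
  moreover have "\<omega> \<noteq> 1"
  proof
    assume "\<omega> = 1"
    then have "cos (2 * pi * (of_int z / real p)) = 1"
      by (simp add: \<omega>_def unit_exp_def complex_eq_iff)
    then obtain m :: int where "2 * pi * (of_int z / real p) = of_int m * 2 * pi"
      using cos_one_2pi_int by auto
    then have "2 * pi * (of_int z / real p) = 2 * pi * of_int m" by (simp add: mult.commute mult.left_commute)
    then have "of_int z / real p = of_int m" by (metis mult_cancel_left mult_eq_0_iff pi_neq_zero zero_neq_numeral)
    then have "real_of_int z = of_int (m * int p)" using assms by (simp add: field_simps)
    then have "z = m * int p" by (simp only: of_int_eq_iff)
    with False show False by simp
  qed
  ultimately show ?thesis using S False by simp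
qed

text \<open>Modulo 1, two such fractions differ by an integer m divided by p p', which is at most
  Q^2; it remains to exclude m = 0.\<close>

lemma prime_fractions_spaced:
  fixes \<P> :: "nat set" and Q :: real
  assumes \<P>: "\<And>p. p \<in> \<P> \<Longrightarrow> prime p \<and> real p \<le> Q" and Q: "Q > 0"
  shows "spaced (1 / Q\<^sup>2) (SIGMA p:\<P>. {1..<p}) (\<lambda>(p, a). real a / real p)"
  unfolding spaced_def
proof (clarify)
  fix p a p' a' and z :: int
  assume p: "p \<in> \<P>" "a \<in> {1..<p}" and p': "p' \<in> \<P>" "a' \<in> {1..<p'}" and ne: "\<not> (p = p' \<and> a = a')"
  define m where "m = int a * int p' - int a' * int p - z * int p * int p'"
  have pr: "prime p" "prime p'" and pos: "real p > 0" "real p' > 0"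
    using \<P>[OF p(1)] \<P>[OF p'(1)] p p' by auto
  have "m \<noteq> 0"
  proof
    assume "m = 0"
    then have eq: "int a * int p' = int p * (int a' + z * int p')" by (simp add: m_def algebra_simps)
    show False
    proof (cases "p = p'")
      case True
      then have "int a = int a' + z * int p" using eq pos by (simp add: mult.commute)
      moreover have "a < p" "a' < p" using p p' True by auto
      ultimately have "int a mod int p = int a' mod int p" by simp
      then show False using \<open>a < p\<close> \<open>a' < p\<close> True ne by simp
    next
      case False
      have "int p dvd int a * int p'" using eq by simp
      then have "p dvd a * p'" by (metis int_dvd_int_iff of_nat_mult)
      then have "p dvd a \<or> p dvd p'" using pr by (simp add: prime_dvd_mult_iff)
      moreover have "\<not> p dvd a" using p by (auto dest: dvd_imp_le)
      ultimately show False using pr False by (simp add: primes_dvd_imp_eq)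
    qed
  qed
  then have "1 \<le> \<bar>m\<bar>" by simp
  then have m1: "1 \<le> \<bar>real_of_int m\<bar>" by (metis of_int_1_le_iff of_int_abs)
  have "real a / real p - real a' / real p' - of_int z = of_int m / (real p * real p')"
    using pos by (simp add: m_def field_simps)
  then have "\<bar>real a / real p - real a' / real p' - of_int z\<bar> = \<bar>real_of_int m\<bar> / (real p * real p')"
    using pos by (simp add: abs_mult)
  also have "\<dots> \<ge> 1 / (real p * real p')" using m1 pos by (intro divide_right_mono) auto
  moreover have "1 / Q\<^sup>2 \<le> 1 / (real p * real p')"
    using \<P>[OF p(1)] \<P>[OF p'(1)] pos Q by (intro divide_left_mono) (auto simp: power2_eq_square intro: mult_mono)
  ultimately show "1 / Q\<^sup>2 \<le> \<bar>real a / real p - real a' / real p' - of_int z\<bar>" by linarith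
qed

text \<open>For fixed p, the sum over all a modulo p of the product of the exponential sums of E and
  R counts congruent pairs and is 0. The term a = 0 being the product of the cardinalities, the
  nonzero a contribute its negative. Summation over p, Cauchy-Schwarz and the large sieve for each
  of the two sets give 64 = 8 * 8.\<close>

lemma large_sieve_avoiding_sets:
  fixes \<P> E R :: "nat set" and Q :: real
  assumes \<P>: "finite \<P>" "\<And>p. p \<in> \<P> \<Longrightarrow> prime p \<and> real p \<le> Q" and Q: "Q > 0"
    and H: "real H \<ge> Q\<^sup>2" and E: "E \<subseteq> {..<H}" and R: "R \<subseteq> {..<H}"
    and avoid: "\<And>n r p. n \<in> E \<Longrightarrow> r \<in> R \<Longrightarrow> p \<in> \<P> \<Longrightarrow> \<not> int p dvd int n - int r"
  shows "(real (card \<P>))\<^sup>2 * real (card E) * real (card R) \<le> 64 * (real H)\<^sup>2"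
proof -
  define J where "J = (SIGMA p:\<P>. {1..<p})"
  define \<theta> where "\<theta> = (\<lambda>(p, a). real a / real p)"
  have finJ: "finite J" using \<P>(1) by (auto simp: J_def)
  have sp: "spaced (1 / Q\<^sup>2) J \<theta>" unfolding J_def \<theta>_def by (rule prime_fractions_spaced) (use \<P> Q in auto)
  define S where "S A j = (\<Sum>n\<in>A. unit_exp (real n * \<theta> j))" for A j
  have LS: "(\<Sum>j\<in>J. (norm (S A j))\<^sup>2) \<le> 8 * real H * real (card A)" if "A \<subseteq> {..<H}" for A
    unfolding S_def by (rule large_sieve[OF finJ _ sp _ that]) (use Q H in auto)
  have inner: "(\<Sum>a\<in>{1..<p}. S E (p, a) * cnj (S R (p, a))) = - (of_nat (card E) * of_nat (card R))" if p: "p \<in> \<P>" for p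
  proof -
    have p0: "p > 0" using \<P>(2)[OF p] prime_gt_0_nat by auto
    have "(\<Sum>a<p. S E (p, a) * cnj (S R (p, a))) = (\<Sum>a<p. \<Sum>n\<in>E. \<Sum>r\<in>R. unit_exp (of_int (int n - int r) * (real a / real p)))"
    proof (rule sum.cong[OF refl])
      fix a
      have e: "unit_exp (real n * x) * cnj (unit_exp (real r * x)) = unit_exp (of_int (int n - int r) * x)" for n r x
      proof -
        have "of_int (int n - int r) * x = real n * x + - (real r * x)" by (simp add: algebra_simps)
        then show ?thesis by (simp only: unit_exp_add unit_exp_cnj)
      qed
      have "S E (p, a) * cnj (S R (p, a)) = (\<Sum>n\<in>E. \<Sum>r\<in>R. unit_exp (real n * (real a / real p)) * cnj (unit_exp (real r * (real a / real p))))"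
        unfolding S_def \<theta>_def by (simp add: sum_product)
      then show "S E (p, a) * cnj (S R (p, a)) = (\<Sum>n\<in>E. \<Sum>r\<in>R. unit_exp (of_int (int n - int r) * (real a / real p)))"
        by (simp only: e)
    qed
    also have "\<dots> = (\<Sum>n\<in>E. \<Sum>r\<in>R. \<Sum>a<p. unit_exp (of_int (int n - int r) * (real a / real p)))"
      by (subst sum.swap) (simp only: sum.swap[of _ R "{..<p}"])
    also have "\<dots> = 0"
    proof (rule sum.neutral, rule ballI)
      fix n assume n: "n \<in> E"
      show "(\<Sum>r\<in>R. \<Sum>a<p. unit_exp (of_int (int n - int r) * (real a / real p))) = 0"
      proof (rule sum.neutral, rule ballI)
        fix r assume "r \<in> R"
        then have "\<not> int p dvd int n - int r" using avoid n p by blast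
        then show "(\<Sum>a<p. unit_exp (of_int (int n - int r) * (real a / real p))) = 0"
          by (simp only: sum_unit_exp_mod[OF p0] if_False)
      qed
    qed
    finally have "(\<Sum>a<p. S E (p, a) * cnj (S R (p, a))) = 0" .
    moreover have "{..<p} = insert 0 {1..<p}" using p0 by auto
    moreover have "S A (p, 0) = of_nat (card A)" for A by (simp add: S_def \<theta>_def)
    ultimately show ?thesis by (simp add: eq_neg_iff_add_eq_0 add.commute)
  qed
  have "(\<Sum>j\<in>J. S E j * cnj (S R j)) = (\<Sum>p\<in>\<P>. \<Sum>a\<in>{1..<p}. S E (p, a) * cnj (S R (p, a)))"
    unfolding J_def by (subst sum.Sigma) (use \<P>(1) in auto)
  also have "\<dots> = (\<Sum>p\<in>\<P>. - (of_nat (card E) * of_nat (card R)))" by (rule sum.cong[OF refl inner])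
  also have "\<dots> = - of_real (real (card \<P>) * real (card E) * real (card R))" by (simp add: mult.assoc)
  finally have "real (card \<P>) * real (card E) * real (card R) = norm (\<Sum>j\<in>J. S E j * cnj (S R j))"
    by (simp add: norm_mult)
  also have "\<dots> \<le> (\<Sum>j\<in>J. norm (S E j) * norm (S R j))"
    by (rule sum_norm_le) (simp add: norm_mult)
  finally have "(real (card \<P>) * real (card E) * real (card R))\<^sup>2 \<le> (\<Sum>j\<in>J. norm (S E j) * norm (S R j))\<^sup>2"
    by (intro power_mono) auto
  also have "\<dots> \<le> (\<Sum>j\<in>J. (norm (S E j))\<^sup>2) * (\<Sum>j\<in>J. (norm (S R j))\<^sup>2)" by (rule Cauchy_Schwarz_ineq_sum)
  also have "\<dots> \<le> (8 * real H * real (card E)) * (8 * real H * real (card R))"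
    by (intro mult_mono LS E R) (auto intro: sum_nonneg)
  finally have main: "(real (card E) * real (card R)) * ((real (card \<P>))\<^sup>2 * real (card E) * real (card R))
      \<le> (real (card E) * real (card R)) * (64 * (real H)\<^sup>2)"
    by (simp add: power2_eq_square algebra_simps)
  show ?thesis
  proof (cases "real (card E) * real (card R) = 0")
    case True
    then show ?thesis by auto
  next
    case False
    then have "0 < real (card E) * real (card R)" by (simp add: zero_less_mult_iff)
    with main show ?thesis by (simp only: mult_le_cancel_left_pos)
  qed
qed

subsection \<open>Chebyshev's upper bound\<close>

lemma prod_primes_dvd:
  fixes N :: nat
  assumes "finite S" "\<And>p. p \<in> S \<Longrightarrow> prime p \<and> p dvd N"
  shows "\<Prod>S dvd N"
  using assms
proof (induction S rule: finite_induct)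
  case (insert p S)
  have "coprime p (\<Prod>S)"
    by (rule prod_coprime_right) (use insert in \<open>auto intro: primes_coprime\<close>)
  then show ?case using insert by (simp add: divides_mult)
qed simp

text \<open>All primes in (m, 2 m] divide the central binomial coefficient, which is at most
  4^m.\<close>

lemma sum_ln_primes_dyadic:
  assumes "m > 0"
  shows "(\<Sum>p | prime p \<and> m < p \<and> p \<le> 2 * m. ln (real p)) \<le> real m * ln 4"
proof -
  let ?S = "{p. prime p \<and> m < p \<and> p \<le> 2 * m}"
  have fin: "finite ?S" by (rule finite_subset[of _ "{..2 * m}"]) auto
  have "\<Prod>?S dvd (2 * m) choose m"
  proof (rule prod_primes_dvd[OF fin])
    fix p assume p: "p \<in> ?S"
    have "p dvd fact (2 * m)" using p by (simp add: prime_dvd_fact_iff)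
    also have "fact (2 * m) = fact m * fact m * ((2 * m) choose m)"
      using binomial_fact_lemma[of m "2 * m"] by simp
    finally show "prime p \<and> p dvd (2 * m) choose m"
      using p by (auto simp: prime_dvd_mult_iff prime_dvd_fact_iff)
  qed
  then have "\<Prod>?S \<le> (2 * m) choose m" by (rule dvd_imp_le) simp
  also have "\<dots> \<le> 2 ^ (2 * m)" by (rule binomial_le_pow2)
  finally have le: "\<Prod>?S \<le> 4 ^ m" by (simp add: power_mult)
  have pos: "p > 0" if "p \<in> ?S" for p using that prime_gt_0_nat by auto
  have "(\<Sum>p\<in>?S. ln (real p)) = ln (\<Prod>p\<in>?S. real p)"
    by (rule ln_prod[symmetric]) (use fin pos in auto)
  also have "(\<Prod>p\<in>?S. real p) = real (\<Prod>?S)" by simp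
  also have "ln (real (\<Prod>?S)) \<le> ln (real (4 ^ m))"
    using le pos by (subst ln_le_cancel_iff) (auto simp: prod_pos simp del: of_nat_prod of_nat_power)
  also have "\<dots> = real m * ln 4" by (simp add: ln_realpow)
  finally show ?thesis .
qed

lemma sum_ln_primes_pow2: "(\<Sum>p | prime p \<and> p \<le> 2 ^ j. ln (real p)) \<le> 2 ^ j * ln 4"
proof (induction j)
  case 0
  have "{p :: nat. prime p \<and> p \<le> 2 ^ 0} = {}" by (auto dest: prime_gt_1_nat)
  then show ?case by (simp only: sum.empty) simp
next
  case (Suc j)
  let ?A = "{p :: nat. prime p \<and> p \<le> 2 ^ j}" and ?B = "{p :: nat. prime p \<and> 2 ^ j < p \<and> p \<le> 2 * 2 ^ j}"
  have "{p :: nat. prime p \<and> p \<le> 2 ^ Suc j} = ?A \<union> ?B" by auto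
  then have "(\<Sum>p | prime p \<and> p \<le> 2 ^ Suc j. ln (real p)) = (\<Sum>p\<in>?A. ln (real p)) + (\<Sum>p\<in>?B. ln (real p))"
    by (simp only:) (rule sum.union_disjoint, auto)
  also have "\<dots> \<le> 2 ^ j * ln 4 + real (2 ^ j) * ln 4"
    by (intro add_mono Suc.IH sum_ln_primes_dyadic) simp
  finally show ?case by simp
qed

lemma sum_ln_primes_le:
  fixes z :: real
  assumes "z \<ge> 1"
  shows "(\<Sum>p | prime p \<and> real p \<le> z. ln (real p)) \<le> 2 * z * ln 4"
proof -
  define N where "N = nat \<lfloor>z\<rfloor>"
  have N: "1 \<le> N" "real N \<le> z" using assms by (auto simp: N_def le_nat_iff)
  obtain j where j: "2 ^ j \<le> N" "N < 2 ^ (j + 1)" using ex_power_ivl1[of 2 N] N by auto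
  have "{p. prime p \<and> real p \<le> z} \<subseteq> {p. prime p \<and> p \<le> 2 ^ Suc j}"
  proof clarify
    fix p :: nat assume "prime p" "real p \<le> z"
    then have "p \<le> N" by (simp add: N_def le_nat_floor)
    then show "p \<le> 2 ^ Suc j" using j by simp
  qed
  then have "(\<Sum>p | prime p \<and> real p \<le> z. ln (real p)) \<le> (\<Sum>p | prime p \<and> p \<le> 2 ^ Suc j. ln (real p))"
  proof (rule sum_mono2[rotated])
    show "finite {p :: nat. prime p \<and> p \<le> 2 ^ Suc j}" by (rule finite_subset[of _ "{..2 ^ Suc j}"]) auto
    show "0 \<le> ln (real p)" if "p \<in> {p. prime p \<and> p \<le> 2 ^ Suc j} - {p. prime p \<and> real p \<le> z}" for p :: nat
      using that prime_ge_1_nat by auto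
  qed
  also have "\<dots> \<le> 2 ^ Suc j * ln 4" by (rule sum_ln_primes_pow2)
  also have "\<dots> \<le> 2 * z * ln 4"
  proof (rule mult_right_mono)
    have "real (2 ^ j) \<le> z" using j(1) N(2) by (meson of_nat_le_iff order_trans)
    then show "(2::real) ^ Suc j \<le> 2 * z" by simp
  qed simp
  finally show ?thesis .
qed

lemma finite_nats_le: "finite {n :: nat. real n \<le> z \<and> P n}"
proof (rule finite_subset)
  show "{n :: nat. real n \<le> z \<and> P n} \<subseteq> {..nat \<lfloor>z\<rfloor>}" by (auto simp: le_nat_floor)
qed simp

lemma card_nats_le:
  assumes "z \<ge> 0"
  shows "real (card {n :: nat. 1 \<le> n \<and> real n \<le> z \<and> P n}) \<le> z"
proof -
  have "{n :: nat. 1 \<le> n \<and> real n \<le> z \<and> P n} \<subseteq> {1..nat \<lfloor>z\<rfloor>}" by (auto simp: le_nat_floor)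
  then have "card {n :: nat. 1 \<le> n \<and> real n \<le> z \<and> P n} \<le> card {1..nat \<lfloor>z\<rfloor>}" by (rule card_mono[rotated]) simp
  then show ?thesis using assms by (simp add: le_floor_iff) linarith
qed

text \<open>There are at most sqrt z <= 2 z / ln z primes up to sqrt z. Each larger one contributes
  at least (ln z) / 2 to the sum of logarithms, which is at most 6 z; hence 14 = 2 + 12.\<close>

lemma card_primes_le:
  fixes z :: real
  assumes "z > 1"
  shows "real (card {p. real p \<le> z \<and> prime p}) \<le> 14 * (z / ln z)"
proof -
  let ?A = "{p :: nat. 1 \<le> p \<and> real p \<le> sqrt z \<and> prime p}" and ?B = "{p. (real p \<le> z \<and> prime p) \<and> real p > sqrt z}"
  have lnz: "ln z > 0" using assms by simp
  have finB: "finite ?B" using finite_nats_le[of z "\<lambda>p. prime p \<and> real p > sqrt z"] by (simp add: conj_ac)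
  have "{p. real p \<le> z \<and> prime p} \<subseteq> ?A \<union> ?B" using prime_ge_1_nat by auto
  moreover have "finite ?A" using finite_nats_le[of "sqrt z" "\<lambda>p. 1 \<le> p \<and> prime p"] by (simp add: conj_ac)
  ultimately have "card {p. real p \<le> z \<and> prime p} \<le> card (?A \<union> ?B)" using finB by (intro card_mono) auto
  also have "\<dots> \<le> card ?A + card ?B" by (rule card_Un_le)
  finally have 1: "real (card {p. real p \<le> z \<and> prime p}) \<le> real (card ?A) + real (card ?B)" by linarith
  have 2: "real (card ?A) \<le> sqrt z" by (rule card_nats_le) (use assms in simp)
  have lnhalf: "ln (sqrt z) = ln z / 2" using assms by (simp add: ln_sqrt)
  have "ln (sqrt z) \<le> sqrt z - 1" using assms by (intro ln_le_minus_one) simp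
  then have "ln z \<le> 2 * sqrt z" using lnhalf by simp
  then have "sqrt z * ln z \<le> sqrt z * (2 * sqrt z)" using assms by (intro mult_left_mono) auto
  moreover have "sqrt z * (2 * sqrt z) = 2 * z" using assms by simp
  ultimately have "sqrt z * ln z \<le> 2 * z" by linarith
  then have 3: "sqrt z \<le> 2 * (z / ln z)" using lnz by (simp add: field_simps)
  have "real (card ?B) * (ln z / 2) = (\<Sum>p\<in>?B. ln z / 2)" by simp
  also have "\<dots> \<le> (\<Sum>p\<in>?B. ln (real p))"
  proof (rule sum_mono)
    fix p assume p: "p \<in> ?B"
    have "0 < sqrt z" using assms by simp
    then have "ln (sqrt z) \<le> ln (real p)" using p by (subst ln_le_cancel_iff) (auto intro: prime_gt_0_nat)
    then show "ln z / 2 \<le> ln (real p)" by (simp add: lnhalf)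
  qed
  also have "\<dots> \<le> (\<Sum>p | prime p \<and> real p \<le> z. ln (real p))"
  proof (rule sum_mono2)
    show "finite {p. prime p \<and> real p \<le> z}" using finite_nats_le[of z prime] by (simp add: conj_ac)
    show "0 \<le> ln (real p)" if "p \<in> {p. prime p \<and> real p \<le> z} - ?B" for p
      using that prime_ge_1_nat by auto
  qed auto
  also have "\<dots> \<le> 2 * z * ln 4" by (rule sum_ln_primes_le) (use assms in simp)
  also have "ln (4::real) \<le> 3" using ln_le_minus_one[of "4::real"] by simp
  then have "2 * z * ln 4 \<le> 2 * z * 3" using assms by (intro mult_left_mono) auto
  finally have "real (card ?B) * ln z \<le> 12 * z" by simp
  then have "real (card ?B) \<le> 12 * (z / ln z)" using lnz by (simp add: field_simps)
  with 1 2 3 show ?thesis by simp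
qed

text \<open>Primes up to \<open>d * z\<close> are so few that the hypothesis also holds on \<open>(d * z, z]\<close>.\<close>

lemma dense_primes_above:
  fixes A :: real
  assumes A: "A > 0"
    and dense: "eventually (\<lambda>z :: real. real (card {r :: nat. real r \<le> z \<and> prime r \<and> P r}) \<ge> A * (z / ln z)) at_top"
  obtains d where "0 < d" "d \<le> 1 / 2"
    "eventually (\<lambda>z :: real. real (card {r :: nat. d * z < real r \<and> real r \<le> z \<and> prime r \<and> P r}) \<ge> A / 2 * (z / ln z)) at_top"
proof -
  \<comment> \<open>Chebyshev's constant 14 doubles because ln (d z) >= (ln z) / 2 once z >= 1 /
    d^2; the choice 28 d <= A / 2 leaves half of the density.\<close>
  define d where "d = min (1 / 2) (A / 56)"
  have d: "0 < d" "d \<le> 1 / 2" "28 * d \<le> A / 2" using A by (auto simp: d_def)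
  have "eventually (\<lambda>z :: real. real (card {r :: nat. d * z < real r \<and> real r \<le> z \<and> prime r \<and> P r}) \<ge> A / 2 * (z / ln z)) at_top"
    using dense eventually_ge_at_top[of "1 / d\<^sup>2"] eventually_gt_at_top[of 1]
  proof eventually_elim
    case (elim z)
    have lnz: "ln z > 0" using elim by simp
    have "(1 / d)\<^sup>2 \<le> z" using elim(2) by (simp add: power_divide)
    then have "ln ((1 / d)\<^sup>2) \<le> ln z" using d elim by (subst ln_le_cancel_iff) auto
    then have "2 * ln (1 / d) \<le> ln z" using d by (simp add: ln_realpow)
    moreover have "ln (d * z) = ln z - ln (1 / d)" using d elim by (simp add: ln_mult ln_div)
    ultimately have half: "ln z / 2 \<le> ln (d * z)" by simp
    have lnd: "ln (d * z) > 0" using half lnz by linarith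
    then have dz: "d * z > 1" using d elim by (simp add: ln_gt_zero_iff)
    have "real (card {r. real r \<le> d * z \<and> prime r}) \<le> 14 * (d * z / ln (d * z))" by (rule card_primes_le[OF dz])
    also have "\<dots> \<le> 14 * (d * z / (ln z / 2))"
      using half lnz lnd d elim by (intro mult_left_mono divide_left_mono mult_pos_pos) auto
    also have "\<dots> = 28 * d * (z / ln z)" using lnz by (simp add: field_simps)
    also have "\<dots> \<le> A / 2 * (z / ln z)" using d lnz elim by (intro mult_right_mono) auto
    finally have few: "real (card {r. real r \<le> d * z \<and> prime r}) \<le> A / 2 * (z / ln z)" .
    let ?D = "{r :: nat. d * z < real r \<and> real r \<le> z \<and> prime r \<and> P r}"
    have fin: "finite ?D" using finite_nats_le[of z "\<lambda>r. d * z < real r \<and> prime r \<and> P r"]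
      by (rule finite_subset[rotated]) auto
    have "{r :: nat. real r \<le> z \<and> prime r \<and> P r} \<subseteq> {r. real r \<le> d * z \<and> prime r} \<union> ?D" by auto
    then have "card {r :: nat. real r \<le> z \<and> prime r \<and> P r} \<le> card ({r. real r \<le> d * z \<and> prime r} \<union> ?D)"
      using fin finite_nats_le by (intro card_mono) auto
    also have "\<dots> \<le> card {r. real r \<le> d * z \<and> prime r} + card ?D" by (rule card_Un_le)
    finally have "real (card {r :: nat. real r \<le> z \<and> prime r \<and> P r}) \<le> real (card {r. real r \<le> d * z \<and> prime r}) + real (card ?D)"
      by linarith
    then show ?case using few elim(1) by (simp add: algebra_simps)
  qed
  then show ?thesis using that d by blast
qed

section \<open>From dyadic intervals to a counting function\<close>

lemma dyadic_counting_bigo: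
  fixes bad :: "nat \<Rightarrow> bool" and e C x0 :: real
  assumes e: "e \<ge> 0" and C: "C \<ge> 0" and x0: "x0 \<ge> 2"
    and dyadic: "\<And>x. x \<ge> x0 \<Longrightarrow>
      real (card {n :: nat. x / 2 < real n \<and> real n \<le> x \<and> bad n}) \<le> C * (x powr e * (ln x) ^ 3)"
  shows "(\<lambda>x :: real. real (card {n :: nat. 1 \<le> n \<and> real n \<le> x \<and> bad n})) \<in> O[at_top](\<lambda>x. x powr e * (ln x) ^ 4)"
proof -
  define B where "B x = real (card {n :: nat. 1 \<le> n \<and> real n \<le> x \<and> bad n})" for x :: real
  \<comment> \<open>At most j halvings lead from x to the range below x0. Each costs one dyadic
    bound, replaced by its value at the top x, which e >= 0 permits. The number of halvings is the
    additional factor ln x.\<close>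
  have main: "B x \<le> x0 + real j * (C * (x powr e * (ln x) ^ 3))" if "1 \<le> x" "x \<le> x0 * 2 ^ j" for j x
    using that
  proof (induction j arbitrary: x)
    case 0
    then show ?case using card_nats_le[of x bad] unfolding B_def by simp
  next
    case (Suc j)
    show ?case
    proof (cases "x \<le> x0")
      case True
      have "0 \<le> real (Suc j) * (C * (x powr e * (ln x) ^ 3))"
        using C Suc.prems by (intro mult_nonneg_nonneg) auto
      then show ?thesis using True card_nats_le[of x bad] Suc.prems unfolding B_def by simp
    next
      case False
      have "{n :: nat. 1 \<le> n \<and> real n \<le> x \<and> bad n} \<subseteq>
          {n. 1 \<le> n \<and> real n \<le> x / 2 \<and> bad n} \<union> {n. x / 2 < real n \<and> real n \<le> x \<and> bad n}" by auto
      moreover have "finite {n :: nat. 1 \<le> n \<and> real n \<le> x / 2 \<and> bad n}"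
        by (rule finite_subset[OF _ finite_nats_le[of "x / 2" "\<lambda>_. True"]]) auto
      moreover have "finite {n :: nat. x / 2 < real n \<and> real n \<le> x \<and> bad n}"
        by (rule finite_subset[OF _ finite_nats_le[of x "\<lambda>_. True"]]) auto
      ultimately have "card {n :: nat. 1 \<le> n \<and> real n \<le> x \<and> bad n} \<le>
          card {n :: nat. 1 \<le> n \<and> real n \<le> x / 2 \<and> bad n} + card {n :: nat. x / 2 < real n \<and> real n \<le> x \<and> bad n}"
        by (meson card_Un_le card_mono finite_UnI order_trans)
      then have "B x \<le> B (x / 2) + real (card {n :: nat. x / 2 < real n \<and> real n \<le> x \<and> bad n})"
        unfolding B_def by linarith
      also have "\<dots> \<le> (x0 + real j * (C * ((x / 2) powr e * (ln (x / 2)) ^ 3))) + C * (x powr e * (ln x) ^ 3)"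
        using False x0 Suc.prems by (intro add_mono Suc.IH dyadic) auto
      also have "(x / 2) powr e * (ln (x / 2)) ^ 3 \<le> x powr e * (ln x) ^ 3"
        using False x0 e by (intro mult_mono powr_mono2 power_mono) auto
      then have "x0 + real j * (C * ((x / 2) powr e * (ln (x / 2)) ^ 3)) \<le> x0 + real j * (C * (x powr e * (ln x) ^ 3))"
        using C by (intro add_left_mono mult_left_mono) auto
      finally show ?thesis by (simp add: algebra_simps)
    qed
  qed
  have bound: "B x \<le> (x0 + 3 * C) * (x powr e * (ln x) ^ 4)" if x: "x \<ge> 3" for x
  proof -
    have ln1: "ln x \<ge> 1"
    proof -
      have "exp 1 \<le> x" using x exp_le by linarith
      then show ?thesis using x by (metis exp_gt_zero ln_exp ln_le_cancel_iff order_less_le_trans)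
    qed
    have x1: "x powr e \<ge> 1" using x e by (simp add: ge_one_powr_ge_zero)
    define j where "j = nat \<lceil>log 2 x\<rceil>"
    have log0: "log 2 x \<ge> 0" using x by simp
    have "log 2 x \<le> real j" using log0 by (simp add: j_def) 
    then have "x \<le> 2 powr real j" using x by (simp add: log_le_iff)
    then have "x \<le> 2 ^ j" by (simp add: powr_realpow)
    moreover have "1 * 2 ^ j \<le> x0 * 2 ^ j" using x0 by (intro mult_right_mono) auto
    ultimately have "x \<le> x0 * 2 ^ j" by linarith
    then have "B x \<le> x0 + real j * (C * (x powr e * (ln x) ^ 3))" using x by (intro main) auto
    moreover have "real j \<le> 3 * ln x"
    proof -
      have "real j \<le> log 2 x + 1" using log0 by (simp add: j_def)
      also have "log 2 x \<le> 2 * ln x"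
      proof -
        have "1 / 2 \<le> ln (2::real)" using ln2_ge_two_thirds by simp
        then have "ln x / ln 2 \<le> ln x / (1 / 2)" using ln1 by (intro divide_left_mono) auto
        then show ?thesis by (simp add: log_def)
      qed
      finally show ?thesis using ln1 by simp
    qed
    then have "real j * (C * (x powr e * (ln x) ^ 3)) \<le> 3 * ln x * (C * (x powr e * (ln x) ^ 3))"
      using C ln1 by (intro mult_right_mono) auto
    moreover have "1 \<le> x powr e * (ln x) ^ 4"
      using mult_mono[OF x1 one_le_power[OF ln1, of 4]] by simp
    then have "x0 * 1 \<le> x0 * (x powr e * (ln x) ^ 4)" using x0 by (intro mult_left_mono) auto
    moreover have "3 * ln x * (C * (x powr e * (ln x) ^ 3)) = 3 * C * (x powr e * (ln x) ^ 4)"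
      by (simp add: power_Suc[symmetric] eval_nat_numeral)
    ultimately show ?thesis by (simp add: distrib_right)
  qed
  have "B \<in> O[at_top](\<lambda>x. x powr e * (ln x) ^ 4)"
  proof (rule bigoI)
    show "eventually (\<lambda>x. norm (B x) \<le> (x0 + 3 * C) * norm (x powr e * (ln x) ^ 4)) at_top"
      using eventually_ge_at_top[of 3]
    proof eventually_elim
      case (elim x)
      have "norm (x powr e * (ln x) ^ 4) = x powr e * (ln x) ^ 4" by (simp add: abs_mult)
      then show ?case using bound[OF elim] by (simp add: B_def)
    qed
  qed
  then show ?thesis by (simp add: B_def[abs_def])
qed

subsection \<open>Exceptional vertex numbers\<close>

definition sparse_evasive :: "real \<Rightarrow> real \<Rightarrow> nat \<Rightarrow> bool" where
  "sparse_evasive c \<gamma> n \<longleftrightarrow>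
     (\<forall>\<P>. graph_property n \<P> \<and> nontrivial_property n \<P> \<and> monotone_property \<P>
        \<and> (\<forall>G\<in>\<P>. real (card G) \<le> c * real n powr (1 + \<gamma>)) \<longrightarrow> evasive_property n \<P>)"

lemma largest_prime_factor:
  assumes "largest_prime_factor m > 0"
  shows "prime (largest_prime_factor m)" "largest_prime_factor m dvd m"
proof -
  have m: "m \<ge> 2" using assms by (simp add: largest_prime_factor_def split: if_splits)
  then have "prime_factors m \<noteq> {}" by (simp add: prime_factorization_empty_iff)
  then have "Max (prime_factors m) \<in> prime_factors m" by (intro Max_in) auto
  then show "prime (largest_prime_factor m)" "largest_prime_factor m dvd m"
    using m by (auto simp: largest_prime_factor_def dest: in_prime_factors_imp_prime in_prime_factors_imp_dvd)
qed

text \<open>The congruence gives n = p k + r with p k >= x / 4. For Y = x^(1 + \<gamma>) the three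
  lower bounds for twice the number of edges are d/8 Y, d^2/16 Y and d/16 Y; the constant d^2/64
  keeps the actual value at or below half of the smallest of them.\<close>

lemma sparse_evasive_of_congruence:
  fixes x d \<alpha> \<gamma> \<gamma>' :: real and n p r :: nat
  assumes \<gamma>: "0 < \<gamma>" "\<gamma> \<le> \<alpha>" "\<alpha> < 1" "\<gamma> \<le> \<gamma>'" and d: "0 < d" "d \<le> 1 / 2" and x: "x \<ge> 1"
    and Q: "4 / d\<^sup>2 \<le> x powr \<gamma>'" "x powr \<gamma>' < d * (x / 4)"
    and n: "x / 2 < real n" "real n \<le> x"
    and r: "d * (x / 4) < real r" "real r \<le> x / 4" "prime r"
      "real (largest_prime_factor (r - 1)) > real r powr \<alpha>"
    and p: "d * x powr \<gamma>' < real p" "real p \<le> x powr \<gamma>'" "prime p"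
    and dvd: "int p dvd int n - int r"
  shows "sparse_evasive (d\<^sup>2 / 64) \<gamma> n"
  unfolding sparse_evasive_def
proof (intro allI impI, elim conjE)
  fix \<P> assume P: "graph_property n \<P>" "nontrivial_property n \<P>" "monotone_property \<P>"
    and small: "\<forall>G\<in>\<P>. real (card G) \<le> d\<^sup>2 / 64 * real n powr (1 + \<gamma>)"
  define q where "q = largest_prime_factor (r - 1)"
  have q: "real q > real r powr \<alpha>" using r by (simp add: q_def)
  have "q > 0"
  proof (rule Nat.gr0I)
    assume "q = 0"
    then show False using q powr_ge_zero[of "real r" \<alpha>] by simp
  qed
  then have qp: "prime q" "q dvd r - 1" unfolding q_def by (rule largest_prime_factor)+
  have rn: "r < n" using n r by linarith
  have "int p dvd int (n - r)" using dvd rn by (simp add: of_nat_diff)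
  then have "p dvd n - r" by (simp only: int_dvd_int_iff)
  then obtain k where k: "n - r = p * k" by (auto elim: dvdE)
  have nk: "n = p * k + r" using k rn by simp
  have pk: "real p * real k = real n - real r" using nk by simp
  have p2: "p \<ge> 2" using p by (simp add: prime_ge_2_nat)
  have k0: "k > 0" using k rn by (intro Nat.gr0I) auto
  have pk4: "real p * real k \<ge> x / 4" using pk n r by linarith
  have d2: "0 < d\<^sup>2" using d by simp
  have Q0: "0 < x powr \<gamma>'" using x by simp
  \<comment> \<open>k is at most x / p, and p > d x^\<gamma>' >= 4 / d makes this smaller than d x /
    4 < r. Together with p < r it gives the coprimality below.\<close>
  have kr: "k < r"
  proof -
    have "4 \<le> d\<^sup>2 * x powr \<gamma>'" using Q(1) d2 by (simp add: field_simps)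
    then have "4 / d \<le> d * x powr \<gamma>'" using d by (simp add: field_simps power2_eq_square)
    then have "4 / d < real p" using p(1) by linarith
    then have "4 / d * real k < real p * real k" using k0 by (intro mult_strict_right_mono) auto
    also have "\<dots> \<le> x" using pk n by linarith
    finally have "real k < d * (x / 4)" using d by (simp add: field_simps)
    then show ?thesis using r(1) by linarith
  qed
  have pr: "p < r" using p(2) Q(2) r(1) by linarith
  have "\<not> r dvd k" "\<not> r dvd p - 1" using k0 kr pr p2 by (auto dest: dvd_imp_le)
  then have "\<not> r dvd k * (p - 1)" using r(3) by (simp add: prime_dvd_mult_iff)
  then have cop: "coprime (k * (p - 1)) r" using r(3) prime_imp_coprime coprime_commute by blast
  define Y where "Y = x powr (1 + \<gamma>)"
  have Y: "Y = x * x powr \<gamma>" using x by (simp add: Y_def powr_add)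
  have Y0: "Y > 0" using x by (simp add: Y_def)
  have Yn: "real n powr (1 + \<gamma>) \<le> Y" unfolding Y_def using n x \<gamma> by (intro powr_mono2) auto
  have xg: "x powr \<gamma> \<le> x powr \<gamma>'" "x powr \<gamma> \<le> x powr \<alpha>" "x powr \<gamma> \<le> x"
    using \<gamma> x powr_mono[of \<gamma> 1 x] by (auto intro: powr_mono)
  have dd: "d\<^sup>2 \<le> d / 2" using d by (simp add: power2_eq_square)
  have G: "2 * real (card G) \<le> d\<^sup>2 / 32 * Y" if "G \<in> \<P>" for G
  proof -
    have "real (card G) \<le> d\<^sup>2 / 64 * real n powr (1 + \<gamma>)" using small that by blast
    also have "\<dots> \<le> d\<^sup>2 / 64 * Y" by (rule mult_left_mono[OF Yn]) simp
    finally show ?thesis by simp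
  qed
  have e: "d / 8 * (x * x powr \<gamma>) = x / 4 * (d * x powr \<gamma> / 2)" by simp
  have 1: "d / 8 * Y \<le> real (k * (p * (p - 1)))"
  proof -
    have "d * x powr \<gamma> \<le> real p" using p(1) mult_left_mono[OF xg(1), of d] d by linarith
    then have "d * x powr \<gamma> / 2 \<le> real p - 1" using p2 by linarith
    then have "x / 4 * (d * x powr \<gamma> / 2) \<le> real p * real k * (real p - 1)"
      using pk4 x d by (intro mult_mono) auto
    also have "real p * real k * (real p - 1) = real (k * (p * (p - 1)))" using p2 by (simp add: of_nat_diff)
    finally show ?thesis unfolding Y by (simp only: e)
  qed
  have 2: "d\<^sup>2 / 16 * Y \<le> real (r * q)"
  proof -
    have "(d * (x / 4)) powr \<alpha> \<le> real r powr \<alpha>" using r(1) d x \<gamma> by (intro powr_mono2) auto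
    moreover have "(d * (x / 4)) powr \<alpha> = (d / 4) powr \<alpha> * x powr \<alpha>"
      using d x by (simp add: powr_mult[symmetric])
    \<comment> \<open>Since d / 4 <= 1 and \<alpha> < 1, raising d / 4 to the power \<alpha> does
      not decrease it, so the constant can be free of \<alpha>.\<close>
    moreover have "(d / 4) powr 1 \<le> (d / 4) powr \<alpha>" using d \<gamma> by (intro powr_mono') auto
    then have "d / 4 * x powr \<gamma> \<le> (d / 4) powr \<alpha> * x powr \<alpha>" using d xg x by (intro mult_mono) auto
    ultimately have "d / 4 * x powr \<gamma> \<le> real q" using q by linarith
    then have "d * (x / 4) * (d / 4 * x powr \<gamma>) \<le> real r * real q" using r(1) d x by (intro mult_mono) auto
    then show ?thesis by (simp add: Y power2_eq_square mult_ac)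
  qed
  have 3: "d / 16 * Y \<le> real (k * p * r)"
  proof -
    have "x / 4 * (d * (x powr \<gamma> / 4)) \<le> x / 4 * (d * (x / 4))" using xg(3) d x by (intro mult_left_mono) auto
    also have "\<dots> \<le> real p * real k * real r" using pk4 r(1) d x by (intro mult_mono) auto
    finally show ?thesis by (simp add: Y mult.commute mult.left_commute)
  qed
  have lt: "d\<^sup>2 / 32 * Y < d / 8 * Y" "d\<^sup>2 / 32 * Y < d\<^sup>2 / 16 * Y" "d\<^sup>2 / 32 * Y < d / 16 * Y"
    by (rule mult_strict_right_mono[OF _ Y0], use dd d(1) d2 in linarith)+
  show "evasive_property n \<P>"
  proof (rule evasive_of_prime_decomposition[OF p(3) r(3) qp k0 cop nk P])
    fix G assume "G \<in> \<P>"
    from G[OF this] have g: "real (2 * card G) \<le> d\<^sup>2 / 32 * Y" by simp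
    note less_le_trans[OF lt(1) 1] less_le_trans[OF lt(2) 2] less_le_trans[OF lt(3) 3]
    from this[THEN order.strict_trans1[OF g]]
    show "2 * card G < k * (p * (p - 1)) \<and> 2 * card G < r * q \<and> 2 * card G < k * p * r"
      by (simp only: of_nat_less_iff)
  qed
qed

lemma exceptional_dyadic_bound:
  fixes x d A \<alpha> \<gamma> \<gamma>' :: real
  defines "T \<equiv> \<lambda>z. {r :: nat. d * z < real r \<and> real r \<le> z \<and> prime r
      \<and> real (largest_prime_factor (r - 1)) > real r powr \<alpha>}"
  assumes \<gamma>: "0 < \<gamma>" "\<gamma> \<le> \<alpha>" "\<alpha> < 1" "\<gamma> \<le> \<gamma>'" "1 / 2 \<le> \<gamma>'" "\<gamma>' < 1" and d: "0 < d" "d \<le> 1 / 2"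
    and A: "A > 0" and x: "x > 8"
    and Q: "4 / d\<^sup>2 \<le> x powr \<gamma>'" "x powr \<gamma>' < d * (x / 4)"
    and dense: "real (card (T (x powr \<gamma>'))) \<ge> A * (x powr \<gamma>' / ln (x powr \<gamma>'))"
      "real (card (T (x / 4))) \<ge> A * ((x / 4) / ln (x / 4))"
  shows "real (card {n :: nat. x / 2 < real n \<and> real n \<le> x \<and> \<not> sparse_evasive (d\<^sup>2 / 64) \<gamma> n})
    \<le> 2304 / A ^ 3 * (x powr (2 * \<gamma>' - 1) * (ln x) ^ 3)"
proof -
  define Q where "Q = x powr \<gamma>'"
  define E where "E = {n :: nat. x / 2 < real n \<and> real n \<le> x \<and> \<not> sparse_evasive (d\<^sup>2 / 64) \<gamma> n}"
  \<comment> \<open>H exceeds Q^2 >= x, where \<gamma>' >= 1/2 is used. One range thus contains the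
    exceptional n and the primes r and also satisfies the spacing condition for 1 / Q^2.\<close>
  define H where "H = nat \<lceil>Q\<^sup>2\<rceil> + 1"
  have Q1: "Q \<ge> 1" using x \<gamma> by (simp add: Q_def ge_one_powr_ge_zero)
  have Qsq: "Q\<^sup>2 = x powr (2 * \<gamma>')" using x by (simp add: Q_def powr_power mult.commute)
  have xQ: "x \<le> Q\<^sup>2" unfolding Qsq using x \<gamma> powr_mono[of 1 "2 * \<gamma>'" x] by simp
  have H: "Q\<^sup>2 + 1 \<le> real H" "real H \<le> 3 * Q\<^sup>2"
  proof -
    have "real (nat \<lceil>Q\<^sup>2\<rceil>) = of_int \<lceil>Q\<^sup>2\<rceil>" using Q1 by simp
    moreover have "Q\<^sup>2 \<ge> 1" using Q1 by simp
    ultimately show "Q\<^sup>2 + 1 \<le> real H" "real H \<le> 3 * Q\<^sup>2" unfolding H_def by linarith+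
  qed
  have "(real (card (T Q)))\<^sup>2 * real (card E) * real (card (T (x / 4))) \<le> 64 * (real H)\<^sup>2"
  proof (rule large_sieve_avoiding_sets)
    show "finite (T Q)" unfolding T_def by (rule finite_subset[OF _ finite_nats_le[of Q "\<lambda>_. True"]]) auto
    show "prime p \<and> real p \<le> Q" if "p \<in> T Q" for p using that by (simp add: T_def)
    show "Q > 0" using Q1 by simp
    show "real H \<ge> Q\<^sup>2" using H by simp
    have "real n < real H" if "real n \<le> x" for n using that xQ H by linarith
    then show "E \<subseteq> {..<H}" "T (x / 4) \<subseteq> {..<H}" using x by (auto simp: E_def T_def)
    show "\<not> int p dvd int n - int r" if "n \<in> E" "r \<in> T (x / 4)" "p \<in> T Q" for n r p
      using sparse_evasive_of_congruence[of \<gamma> \<alpha> \<gamma>' d x n r p] that \<gamma> d x Q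
      by (auto simp: E_def T_def Q_def)
  qed
  \<comment> \<open>The bound H <= 3 Q^2 turns 64 into 576; the further factor 4 in 2304 comes from
    taking r up to x / 4.\<close>
  also have "64 * (real H)\<^sup>2 \<le> 64 * (3 * Q\<^sup>2)\<^sup>2" using H by (intro mult_left_mono power_mono) auto
  finally have LS: "(real (card (T Q)))\<^sup>2 * real (card E) * real (card (T (x / 4))) \<le> 576 * Q ^ 4"
    by (simp add: power_mult_distrib power_mult[symmetric])
  have lnx: "ln x > 0" "ln (x / 4) > 0" "ln (x / 4) \<le> ln x" using x by auto
  have lnQ: "ln Q = \<gamma>' * ln x" using x by (simp add: Q_def ln_powr)
  have lnQ': "0 < ln Q" "ln Q \<le> ln x" using lnx \<gamma> by (auto simp: lnQ mult_le_cancel_right2)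
  have TQ: "A * (Q / ln x) \<le> real (card (T Q))"
  proof -
    have "A * (Q / ln x) \<le> A * (Q / ln Q)"
      using A Q1 lnQ' lnx by (intro mult_left_mono divide_left_mono mult_pos_pos) auto
    then show ?thesis using dense(1) by (simp add: Q_def)
  qed
  have TR: "A * (x / (4 * ln x)) \<le> real (card (T (x / 4)))"
  proof -
    have "(x / 4) / ln x \<le> (x / 4) / ln (x / 4)"
      using x lnx by (intro divide_left_mono mult_pos_pos) auto
    then have "A * ((x / 4) / ln x) \<le> A * ((x / 4) / ln (x / 4))" using A by (intro mult_left_mono) auto
    then show ?thesis using dense(2) by simp
  qed
  have "(A * (Q / ln x))\<^sup>2 * (A * (x / (4 * ln x))) * real (card E)
      \<le> (real (card (T Q)))\<^sup>2 * real (card (T (x / 4))) * real (card E)"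
    using A Q1 lnx x by (intro mult_right_mono mult_mono power_mono TQ TR) auto
  also have "\<dots> \<le> 576 * Q ^ 4" using LS by (simp add: mult_ac)
  finally have "(A * (Q / ln x))\<^sup>2 * (A * (x / (4 * ln x))) * real (card E) \<le> 576 * Q ^ 4" .
  moreover have "(A * (Q / ln x))\<^sup>2 * (A * (x / (4 * ln x))) = A ^ 3 * x * Q\<^sup>2 / (4 * (ln x) ^ 3)"
    using lnx by (simp add: field_simps power2_eq_square power3_eq_cube)
  ultimately have "A ^ 3 * x * Q\<^sup>2 / (4 * (ln x) ^ 3) * real (card E) \<le> 576 * Q ^ 4" by (simp only:)
  then have "A ^ 3 * x * Q\<^sup>2 * real (card E) \<le> Q\<^sup>2 * (2304 * Q\<^sup>2 * (ln x) ^ 3)"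
    using lnx by (simp add: field_simps power4_eq_xxxx power2_eq_square)
  then have "Q\<^sup>2 * (A ^ 3 * x * real (card E)) \<le> Q\<^sup>2 * (2304 * Q\<^sup>2 * (ln x) ^ 3)" by (simp add: mult_ac)
  then have "A ^ 3 * x * real (card E) \<le> 2304 * Q\<^sup>2 * (ln x) ^ 3" using Q1 by (simp add: mult_le_cancel_left_pos)
  then have "real (card E) \<le> 2304 / A ^ 3 * (Q\<^sup>2 / x * (ln x) ^ 3)" using A x by (simp add: field_simps)
  also have "Q\<^sup>2 / x = x powr (2 * \<gamma>' - 1)" using x by (simp add: Qsq powr_diff)
  finally show ?thesis unfolding E_def .
qed

theorem theorem2:
  fixes \<alpha> A :: real
  assumes "0 < \<alpha>" "\<alpha> < 1" "0 < A"
    and "\<forall>\<^sub>F z :: real in at_top.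
      real (card {r :: nat. real r \<le> z \<and> prime r
                   \<and> real (largest_prime_factor (r - 1)) > real r powr \<alpha>}) \<ge> A * (z / ln z)"
  shows "\<forall>\<gamma> :: real. 0 < \<gamma> \<and> \<gamma> \<le> \<alpha> \<longrightarrow>
    (\<exists>c > 0.
      (\<lambda>x :: real. real (card {n :: nat. 1 \<le> n \<and> real n \<le> x \<and>
         \<not> (\<forall>\<P>. graph_property n \<P> \<and> nontrivial_property n \<P> \<and> monotone_property \<P>
               \<and> (\<forall>G\<in>\<P>. real (card G) \<le> c * real n powr (1 + \<gamma>))
             \<longrightarrow> evasive_property n \<P>)}))
      \<in> O[at_top](\<lambda>x. x powr (max 0 (2 * \<gamma> - 1)) * (ln x) ^ 4))"
proof (intro allI impI, elim conjE)
  fix \<gamma> :: real assume \<gamma>: "0 < \<gamma>" "\<gamma> \<le> \<alpha>"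
  define \<gamma>' where "\<gamma>' = max \<gamma> (1 / 2)"
  have \<gamma>': "\<gamma> \<le> \<gamma>'" "1 / 2 \<le> \<gamma>'" "\<gamma>' < 1" "max 0 (2 * \<gamma> - 1) = 2 * \<gamma>' - 1"
    using \<gamma> assms(2) by (auto simp: \<gamma>'_def max_def)
  obtain d where d: "0 < d" "d \<le> 1 / 2" and dense: "\<forall>\<^sub>F z :: real in at_top.
      real (card {r :: nat. d * z < real r \<and> real r \<le> z \<and> prime r
        \<and> real (largest_prime_factor (r - 1)) > real r powr \<alpha>}) \<ge> A / 2 * (z / ln z)"
    using dense_primes_above[OF assms(3,4)] by blast
  have pow: "filterlim (\<lambda>x :: real. x powr s) at_top at_top" if "s > 0" for s
    using that by (rule real_powr_at_top)
  have pow': "filterlim (\<lambda>x :: real. x powr \<gamma>') at_top at_top" by (rule pow) (use \<gamma>' in simp)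
  have lin: "filterlim (\<lambda>x :: real. x / 4) at_top at_top" by real_asymp
  have "\<forall>\<^sub>F x in at_top. x powr (1 - \<gamma>') > 4 / d"
    using pow[of "1 - \<gamma>'"] \<gamma>' by (simp add: filterlim_at_top_dense)
  moreover have "\<forall>\<^sub>F x in at_top. 4 / d\<^sup>2 \<le> x powr \<gamma>'"
    using pow[of \<gamma>'] \<gamma>' by (simp add: filterlim_at_top)
  moreover have "\<forall>\<^sub>F x :: real in at_top. x > 8" by (rule eventually_gt_at_top)
  ultimately have "\<forall>\<^sub>F x in at_top.
      real (card {n :: nat. x / 2 < real n \<and> real n \<le> x \<and> \<not> sparse_evasive (d\<^sup>2 / 64) \<gamma> n})
        \<le> 2304 / (A / 2) ^ 3 * (x powr (2 * \<gamma>' - 1) * (ln x) ^ 3)"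
    using eventually_compose_filterlim[OF dense lin] eventually_compose_filterlim[OF dense pow']
  proof eventually_elim
    case (elim x)
    \<comment> \<open>As \<gamma>' < 1, the factor x^(1 - \<gamma>') tends to infinity and
      eventually exceeds 4 / d, which gives the size condition on Q.\<close>
    have "x powr \<gamma>' * x powr (1 - \<gamma>') = x" using elim by (simp add: powr_add[symmetric])
    moreover have "x powr \<gamma>' * (4 / d) < x powr \<gamma>' * x powr (1 - \<gamma>')"
      using elim by (intro mult_strict_left_mono) auto
    ultimately have "x powr \<gamma>' < d * (x / 4)" using d by (simp add: field_simps)
    then show ?case
      using elim \<gamma> \<gamma>' assms d by (intro exceptional_dyadic_bound[where \<alpha> = \<alpha>]) auto
  qed
  then obtain x1 where x1: "\<And>x. x \<ge> x1 \<Longrightarrow>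
      real (card {n :: nat. x / 2 < real n \<and> real n \<le> x \<and> \<not> sparse_evasive (d\<^sup>2 / 64) \<gamma> n})
        \<le> 2304 / (A / 2) ^ 3 * (x powr (2 * \<gamma>' - 1) * (ln x) ^ 3)"
    unfolding eventually_at_top_linorder by blast
  have "(\<lambda>x :: real. real (card {n :: nat. 1 \<le> n \<and> real n \<le> x \<and> \<not> sparse_evasive (d\<^sup>2 / 64) \<gamma> n}))
      \<in> O[at_top](\<lambda>x. x powr (2 * \<gamma>' - 1) * (ln x) ^ 4)"
    by (rule dyadic_counting_bigo[of _ "2304 / (A / 2) ^ 3" "max 2 x1"]) (use \<gamma>' x1 assms in auto)
  then show "\<exists>c > 0.
      (\<lambda>x :: real. real (card {n :: nat. 1 \<le> n \<and> real n \<le> x \<and>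
         \<not> (\<forall>\<P>. graph_property n \<P> \<and> nontrivial_property n \<P> \<and> monotone_property \<P>
               \<and> (\<forall>G\<in>\<P>. real (card G) \<le> c * real n powr (1 + \<gamma>))
             \<longrightarrow> evasive_property n \<P>)}))
      \<in> O[at_top](\<lambda>x. x powr (max 0 (2 * \<gamma> - 1)) * (ln x) ^ 4)"
    \<comment> \<open>The constant is d^2 / 64, where d is the cutoff min (1/2) (A/56) of the dense
      set of primes.\<close>
    unfolding sparse_evasive_def \<gamma>'(4) using d by (intro exI[of _ "d\<^sup>2 / 64"] conjI) auto
qed

end
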